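(* The functional $\mathcal L=\mathcal L_A+\mathcal L_B$ (defined on $\mathrm{Dom}_{\mathcal W\cap\mathcal S}(\mathcal L)$ by the formulas in the context) has a variation $\frac{\delta^{\mathcal W}\mathcal L}{\delta^{\mathcal W}\hat f}$ with respect to the realification $\mathcal W^{\mathbb R}$ at every $\hat f\in\mathrm{Dom}^{\delta}_{\mathcal W\cap\mathcal S}(\mathcal L)$. For $\hat f$ satisfying $e^{\mathcal S}_{\hat f}(i\frac{\partial}{\partial\omega})=e^{\mathcal S}_{\hat f}(\ln|\omega|)=0$ it is given, with $u_{\mathcal S}=\hat f/\|\hat f\|_{\mathcal S}$ and $u_{\mathcal W}=\hat f/\|\hat f\|_{\mathcal W}$, by $$\frac{\delta^{\mathcal W}\mathcal L}{\delta^{\mathcal W}\hat f}=\frac{\delta^{\mathcal W}\mathcal L_A}{\delta^{\mathcal W}\hat f}+\frac{\delta^{\mathcal W}\mathcal L_B}{\delta^{\mathcal W}\hat f},$$ where $$\frac{\delta^{\mathcal W}\mathcal L_A}{\delta^{\mathcal W}\hat f}=2\omega\Big(\ln(|\omega|)^2-v^{\mathcal S}_{u_{\mathcal S}}(\ln|\omega|)\Big)\frac{\hat f}{\|\hat f\|_{\mathcal S}^2}+2\Big(\big(\ln|\omega|-e^{\mathcal W}_{u_{\mathcal W}}(\ln|\omega|)\big)^2-v^{\mathcal W}_{u_{\mathcal W}}(\ln|\omega|)\Big)\frac{\hat f}{\|\hat f\|_{\mathcal W}^2}$$ and $$\begin{aligned}\frac{\delta^{\mathcal W}\mathcal L_B}{\delta^{\mathcal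 W}\hat f}=\;&2\omega\Big(-\frac{\partial^2}{\partial\omega^2}-v^{\mathcal S}_{u_{\mathcal S}}\big(i\tfrac{\partial}{\partial\omega}\big)\Big)\frac{\hat f}{\|\hat f\|_{\mathcal S}^2}\\&+2\Big(-\omega^2\frac{\partial^2}{\partial\omega^2}-\omega\frac{\partial}{\partial\omega}-v^{\mathcal W}_{u_{\mathcal W}}\big(i\omega\tfrac{\partial}{\partial\omega}\big)\Big)\frac{\|\frac1\omega\hat f\|_{\mathcal S}^2}{\|\hat f\|_{\mathcal S}^2}\,\frac{\hat f}{\|\hat f\|_{\mathcal W}^2}\\&+2v^{\mathcal W}_{u_{\mathcal W}}\big(i\omega\tfrac{\partial}{\partial\omega}\big)\Big(\frac1{\omega}\frac{\hat f}{\|\hat f\|_{\mathcal S}^2}-\omega\frac{\|\frac1\omega\hat f\|_{\mathcal S}^2}{\|\hat f\|_{\mathcal S}^4}\hat f\Big).\end{aligned}$$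
   Context: Spaces: $\mathcal S=L^2(\mathbb R,d\omega)$ and $\mathcal W=L^2(\mathbb R,\frac{1}{|\omega|}d\omega)$ (complex-valued functions), with inner products $\langle f,g\rangle_{\mathcal S}=\int f\bar g\,d\omega$, $\langle f,g\rangle_{\mathcal W}=\int f\bar g\,\frac{d\omega}{|\omega|}$. The realification $\mathcal H^{\mathbb R}$ of a complex Hilbert space $\mathcal H$ is the same set viewed as a real Hilbert space with inner product $\mathrm{Re}\langle\cdot,\cdot\rangle_{\mathcal H}$. Moments: $e_f(T)=\langle Tf,f\rangle$ and $v_f(T)=\|(T-e_f(T))f\|^2$ (also used when $f$ is not normalized); a superscript $\mathcal S$ or $\mathcal W$ indicates in which of the two spaces inner product and norm are taken. A function $q(\omega)$ in place of an operator denotes multiplication by $q$; $q(\omega)\frac{\partial}{\partial\omega}$ denotes $f\mapsto qf'$. $\mathrm{Dom}_{\mathcal W\cap\mathcal S}(\mathcal L)$ is the set of all nonzero $\hat f\in\mathcal W\cap\mathcal S$ such that $\hat f$ is absolutely continuous on every compact interval, $\hat f'\in L^2(\mathbb R)$, $\omega\hat f'\in\mathcal W$, $\frac1\omega\hat f\in L^2(\mathbb R)$, $\ln(|\omega|)\hat f\in L^2(\mathbb R)$ and $\ln(|\omega|)\hat f\in\mathcal W$. Functional: on $\mathrm{Dom}_{\mathcal W\cap\mathcal S}(\mathcal L)$, with $u_{\mathcal S}=\hat f/\|\hat f\|_{\mathcal S}$, $u_{\mathcal W}=\hat f/\|\hat f\|_{\mathcal W}$, $$\mathcal L_A(\hat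 f)=v^{\mathcal S}_{u_{\mathcal S}}(\ln|\omega|)+v^{\mathcal W}_{u_{\mathcal W}}(\ln|\omega|),\qquad \mathcal L_B(\hat f)=v^{\mathcal S}_{u_{\mathcal S}}\big(i\tfrac{\partial}{\partial\omega}\big)+v^{\mathcal W}_{u_{\mathcal W}}\big(i\omega\tfrac{\partial}{\partial\omega}\big)\frac{\|\frac1\omega\hat f\|_{\mathcal S}^2}{\|\hat f\|_{\mathcal S}^2},\qquad \mathcal L=\mathcal L_A+\mathcal L_B.$$ ($\mathcal L_A$ and $\mathcal L_B$ are the source's one-dimensional expressions for the scale and time variances of the normalized wavelet ambiguity function of $\hat f$.) $\mathrm{Dom}^{\delta}_{\mathcal W\cap\mathcal S}(\mathcal L)$ is the set of all $0\neq\hat f\in L^2(\mathbb R)$ such that: (1) $\hat f$ is differentiable with derivative absolutely continuous on every compact interval, and $\hat f''\in L^2(\mathbb R)$, $\sqrt{|\omega|}\,\hat f''\in L^2(\mathbb R)$, $|\omega|^{3/2}\hat f''+\sqrt{|\omega|}\,\hat f'\in L^2(\mathbb R)$; (2) $\frac{1}{\omega^2}\hat f\in L^2(\mathbb R)$; (3) $\sqrt{|\omega|}\ln(|\omega|)^2\hat f\in L^2(\mathbb R)$. It is regarded as a subset of $\mathrm{Dom}_{\mathcal W\cap\mathcal S}(\mathcal L)$. Variation: for a functional $S$ on $\mathrm{Dom}(S)$, where $\mathrm{Dom}(S)\cup\{0\}$ is a dense linear subspace of a real Hilbert space $\mathcal H$, the variation of $S$ at $f\in\mathrm{Dom}(S)$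 is the vector $g\in\mathcal H$, if it exists, with $\lim_{\mathbb R\ni t\to0}\frac{S(f+th)-S(f)}{t}=\langle g,h\rangle_{\mathcal H}$ for every $h\in\mathrm{Dom}(S)$. $\frac{\delta^{\mathcal W}}{\delta^{\mathcal W}\hat f}$ denotes the variation in $\mathcal H=\mathcal W^{\mathbb R}$; the perturbations $\hat f+t\hat h$ are not required to satisfy the two expected value conditions.
   Formalization: The displayed formulas fail for signals with negative frequencies; proved instead with |ω|, 1/|ω| for the S-gradient factors ω, 1/ω and (iω∂−e^W)² for (iω∂)²; the displayed formulas are proved verbatim for f vanishing on ω<0. Existence is unchanged. *)

theory Defs
  imports "HOL-Analysis.Analysis"
begin

section \<open>The spaces $L^2(\mu)$, $\mathcal S$ and $\mathcal W$\<close>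

text \<open>Elements of $L^2(\mu)$ are represented by functions; they are compared only through the
  inner product, i.e. up to null sets.  The base measure is the complete measure
  \<^const>\<open>lebesgue\<close>, so measurability does not depend on the values on null sets.\<close>

definition L2 :: "real measure \<Rightarrow> (real \<Rightarrow> complex) set" where
  "L2 M = {f. f \<in> borel_measurable M \<and> integrable M (\<lambda>\<omega>. (cmod (f \<omega>))\<^sup>2)}"

definition ip :: "real measure \<Rightarrow> (real \<Rightarrow> complex) \<Rightarrow> (real \<Rightarrow> complex) \<Rightarrow> complex" where
  "ip M f g = (LINT \<omega>|M. f \<omega> * cnj (g \<omega>))"

definition nrm :: "real measure \<Rightarrow> (real \<Rightarrow> complex) \<Rightarrow> real" where
  "nrm M f = sqrt (Re (ip M f f))"

abbreviation S_sp :: "real measure" where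
  "S_sp \<equiv> lebesgue"

definition W_sp :: "real measure" where
  "W_sp = density lebesgue (\<lambda>\<omega>. ennreal (1 / \<bar>\<omega>\<bar>))"

definition unit :: "real measure \<Rightarrow> (real \<Rightarrow> complex) \<Rightarrow> real \<Rightarrow> complex" where
  "unit M f = (\<lambda>\<omega>. f \<omega> / of_real (nrm M f))"


section \<open>Moments and the operators\<close>

type_synonym oper = "(real \<Rightarrow> complex) \<Rightarrow> real \<Rightarrow> complex"

definition expval :: "real measure \<Rightarrow> oper \<Rightarrow> (real \<Rightarrow> complex) \<Rightarrow> complex" where
  "expval M T f = ip M (T f) f"

definition var :: "real measure \<Rightarrow> oper \<Rightarrow> (real \<Rightarrow> complex) \<Rightarrow> real" where
  "var M T f = (nrm M (\<lambda>\<omega>. T f \<omega> - expval M T f * f \<omega>))\<^sup>2"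

definition D :: oper where
  "D f = (\<lambda>\<omega>. vector_derivative f (at \<omega>))"

definition mult_ln :: oper where
  "mult_ln f = (\<lambda>\<omega>. of_real (ln \<bar>\<omega>\<bar>) * f \<omega>)"

definition iD :: oper where
  "iD f = (\<lambda>\<omega>. \<i> * D f \<omega>)"

definition i\<omega>D :: oper where
  "i\<omega>D f = (\<lambda>\<omega>. \<i> * of_real \<omega> * D f \<omega>)"

definition mult_inv :: oper where
  "mult_inv f = (\<lambda>\<omega>. of_real (1 / \<omega>) * f \<omega>)"


section \<open>The functionals\<close>

definition LA :: "(real \<Rightarrow> complex) \<Rightarrow> real" where
  "LA f = var S_sp mult_ln (unit S_sp f) + var W_sp mult_ln (unit W_sp f)"

definition LB :: "(real \<Rightarrow> complex) \<Rightarrow> real" where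
  "LB f = var S_sp iD (unit S_sp f)
        + var W_sp i\<omega>D (unit W_sp f) * ((nrm S_sp (mult_inv f))\<^sup>2 / (nrm S_sp f)\<^sup>2)"

definition L :: "(real \<Rightarrow> complex) \<Rightarrow> real" where
  "L f = LA f + LB f"


section \<open>Domains\<close>

text \<open>The usual $\varepsilon$-$\delta$ notion; a finite family of non-overlapping compact
  subintervals is a division of its own union.  Degenerate members contribute nothing.\<close>

definition abs_cont_on :: "real \<Rightarrow> real \<Rightarrow> (real \<Rightarrow> complex) \<Rightarrow> bool" where
  "abs_cont_on a b f \<longleftrightarrow>
     (\<forall>\<epsilon>>0. \<exists>\<delta>>0. \<forall>\<D>. \<D> division_of \<Union>\<D> \<longrightarrow> \<Union>\<D> \<subseteq> {a..b} \<longrightarrow> (\<Sum>K\<in>\<D>. Sup K - Inf K) < \<delta>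
        \<longrightarrow> (\<Sum>K\<in>\<D>. cmod (f (Sup K) - f (Inf K))) < \<epsilon>)"

definition loc_abs_cont :: "(real \<Rightarrow> complex) \<Rightarrow> bool" where
  "loc_abs_cont f \<longleftrightarrow> (\<forall>a b. abs_cont_on a b f)"

text \<open>For members of both domains the function is the continuous representative of its class,
  so being nonzero in $L^2$ is being nonzero somewhere.  The derivative of a locally absolutely
  continuous function is only determined almost everywhere; the arbitrary value of
  \<^const>\<open>vector_derivative\<close> on the exceptional null set is irrelevant.\<close>

definition Dom_L :: "(real \<Rightarrow> complex) set" where
  "Dom_L = {f. f \<noteq> (\<lambda>_. 0) \<and> f \<in> L2 W_sp \<and> f \<in> L2 S_sp
      \<and> loc_abs_cont f
      \<and> D f \<in> L2 S_sp
      \<and> (\<lambda>\<omega>. of_real \<omega> * D f \<omega>) \<in> L2 W_sp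
      \<and> mult_inv f \<in> L2 S_sp
      \<and> mult_ln f \<in> L2 S_sp
      \<and> mult_ln f \<in> L2 W_sp}"

definition Dom_delta :: "(real \<Rightarrow> complex) set" where
  "Dom_delta = {f. f \<noteq> (\<lambda>_. 0) \<and> f \<in> L2 S_sp
      \<and> (\<forall>\<omega>. f differentiable (at \<omega>)) \<and> loc_abs_cont (D f)
      \<and> D (D f) \<in> L2 S_sp
      \<and> (\<lambda>\<omega>. of_real (sqrt \<bar>\<omega>\<bar>) * D (D f) \<omega>) \<in> L2 S_sp
      \<and> (\<lambda>\<omega>. of_real (\<bar>\<omega>\<bar> powr (3/2)) * D (D f) \<omega> + of_real (sqrt \<bar>\<omega>\<bar>) * D f \<omega>) \<in> L2 S_sp
      \<and> (\<lambda>\<omega>. of_real (1 / \<omega>\<^sup>2) * f \<omega>) \<in> L2 S_sp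
      \<and> (\<lambda>\<omega>. of_real (sqrt \<bar>\<omega>\<bar> * (ln \<bar>\<omega>\<bar>)\<^sup>2) * f \<omega>) \<in> L2 S_sp}"


section \<open>Variations in the realification of $L^2(\mu)$\<close>

definition dense_real_subspace :: "real measure \<Rightarrow> (real \<Rightarrow> complex) set \<Rightarrow> bool" where
  "dense_real_subspace M V \<longleftrightarrow>
     V \<subseteq> L2 M \<and> (\<lambda>_. 0) \<in> V
     \<and> (\<forall>f\<in>V. \<forall>g\<in>V. \<forall>a b :: real. (\<lambda>\<omega>. of_real a * f \<omega> + of_real b * g \<omega>) \<in> V)
     \<and> (\<forall>f\<in>L2 M. \<forall>\<epsilon>>0. \<exists>g\<in>V. nrm M (\<lambda>\<omega>. f \<omega> - g \<omega>) < \<epsilon>)"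

text \<open>By density, \<open>g\<close> is unique up to null sets.\<close>

definition has_variation ::
  "real measure \<Rightarrow> (real \<Rightarrow> complex) set \<Rightarrow> ((real \<Rightarrow> complex) \<Rightarrow> real)
     \<Rightarrow> (real \<Rightarrow> complex) \<Rightarrow> (real \<Rightarrow> complex) \<Rightarrow> bool" where
  "has_variation M Dom F f g \<longleftrightarrow>
     dense_real_subspace M (Dom \<union> {\<lambda>_. 0}) \<and> f \<in> Dom \<and> g \<in> L2 M
     \<and> (\<forall>h\<in>Dom. ((\<lambda>t :: real. (F (\<lambda>\<omega>. f \<omega> + of_real t * h \<omega>) - F f) / t)
                     \<longlongrightarrow> Re (ip M g h)) (at 0))"


section \<open>The formulas for the variation\<close>

text \<open>Formulas for signals supported on the positive frequencies.\<close>

definition grad_LA_pos :: oper where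
  "grad_LA_pos f = (\<lambda>\<omega>.
     2 * of_real \<omega> * (of_real ((ln \<bar>\<omega>\<bar>)\<^sup>2) - of_real (var S_sp mult_ln (unit S_sp f)))
       * (f \<omega> / of_real ((nrm S_sp f)\<^sup>2))
   + 2 * ((of_real (ln \<bar>\<omega>\<bar>) - expval W_sp mult_ln (unit W_sp f))\<^sup>2
            - of_real (var W_sp mult_ln (unit W_sp f)))
       * (f \<omega> / of_real ((nrm W_sp f)\<^sup>2)))"

definition grad_LB_pos :: oper where
  "grad_LB_pos f = (\<lambda>\<omega>.
     2 * of_real \<omega> * (- D (D f) \<omega> - of_real (var S_sp iD (unit S_sp f)) * f \<omega>)
       / of_real ((nrm S_sp f)\<^sup>2)
   + 2 * (- of_real (\<omega>\<^sup>2) * D (D f) \<omega> - of_real \<omega> * D f \<omega>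
            - of_real (var W_sp i\<omega>D (unit W_sp f)) * f \<omega>)
       * of_real ((nrm S_sp (mult_inv f))\<^sup>2 / (nrm S_sp f)\<^sup>2) / of_real ((nrm W_sp f)\<^sup>2)
   + 2 * of_real (var W_sp i\<omega>D (unit W_sp f))
       * (of_real (1 / \<omega>) * (f \<omega> / of_real ((nrm S_sp f)\<^sup>2))
          - of_real (\<omega> * ((nrm S_sp (mult_inv f))\<^sup>2 / (nrm S_sp f) ^ 4)) * f \<omega>))"

text \<open>Formulas for arbitrary, possibly two-sided signals.  Since $\langle g,h\rangle_{\mathcal S} =
  \langle |\omega| g,h\rangle_{\mathcal W}$, a gradient in $\mathcal S$ is turned into one in
  $\mathcal W$ by the factor $|\omega|$, not $\omega$.  Moreover
  $e^{\mathcal W}_f(i\omega\,\partial_\omega) = \int i\,\mathrm{sgn}(\omega) f' \bar f\,d\omega$ need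
  not vanish with $e^{\mathcal S}_f(i\,\partial_\omega) = \int i f'\bar f\,d\omega$ if both signs
  of $\omega$ occur, so that $(i\omega\,\partial_\omega)^2$ is replaced by
  $(i\omega\,\partial_\omega - e)^2 = -\omega^2\partial_\omega^2 - \omega\,\partial_\omega
  - 2 e\, i\omega\,\partial_\omega + e^2$.  Both changes disappear if $f$ vanishes for
  $\omega < 0$ and $e^{\mathcal S}_f(i\,\partial_\omega) = 0$.\<close>

definition grad_LA :: oper where
  "grad_LA f = (\<lambda>\<omega>.
     2 * of_real \<bar>\<omega>\<bar> * (of_real ((ln \<bar>\<omega>\<bar>)\<^sup>2) - of_real (var S_sp mult_ln (unit S_sp f)))
       * (f \<omega> / of_real ((nrm S_sp f)\<^sup>2))
   + 2 * ((of_real (ln \<bar>\<omega>\<bar>) - expval W_sp mult_ln (unit W_sp f))\<^sup>2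
            - of_real (var W_sp mult_ln (unit W_sp f)))
       * (f \<omega> / of_real ((nrm W_sp f)\<^sup>2)))"

definition grad_LB :: oper where
  "grad_LB f = (\<lambda>\<omega>. let e = expval W_sp i\<omega>D (unit W_sp f) in
     2 * of_real \<bar>\<omega>\<bar> * (- D (D f) \<omega> - of_real (var S_sp iD (unit S_sp f)) * f \<omega>)
       / of_real ((nrm S_sp f)\<^sup>2)
   + 2 * (- of_real (\<omega>\<^sup>2) * D (D f) \<omega> - of_real \<omega> * D f \<omega>
            - 2 * e * i\<omega>D f \<omega> + e\<^sup>2 * f \<omega>
            - of_real (var W_sp i\<omega>D (unit W_sp f)) * f \<omega>)
       * of_real ((nrm S_sp (mult_inv f))\<^sup>2 / (nrm S_sp f)\<^sup>2) / of_real ((nrm W_sp f)\<^sup>2)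
   + 2 * of_real (var W_sp i\<omega>D (unit W_sp f))
       * (of_real (1 / \<bar>\<omega>\<bar>) * (f \<omega> / of_real ((nrm S_sp f)\<^sup>2))
          - of_real (\<bar>\<omega>\<bar> * ((nrm S_sp (mult_inv f))\<^sup>2 / (nrm S_sp f) ^ 4)) * f \<omega>))"

end

theory Submission
  imports Defs
begin

text \<open>For a symmetric operator \<open>T\<close> the functional \<open>f \<mapsto> var M T (f / |f|)\<close> equals
  \<open>|T f|\<^sup>2 / |f|\<^sup>2 - \<langle>T f, f\<rangle>\<^sup>2 / |f|\<^sup>4\<close>, which is a rational function of \<open>t\<close> along every line
  \<open>f + t h\<close>; its derivative at \<open>0\<close> is the inner product of \<open>h\<close> with
  \<open>2 ((T - e)\<^sup>2 - v) f / |f|\<^sup>2\<close>.  The functional \<open>L\<close> is built from four such variances, and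
  \<open>\<langle>g, h\<rangle>\<close> in \<open>\<S>\<close> is \<open>\<langle>|\<omega>| g, h\<rangle>\<close> in \<open>\<W>\<close>.

  The analytic input is threefold.  Symmetry of the differential operators is an integration by
  parts on the whole line: a nonzero limit of the boundary terms \<open>G(\<plusminus>R)\<close> would make
  \<open>G(\<omega>) / (1 + |\<omega>|)\<close> non-integrable.  That the perturbations, which are only absolutely
  continuous, may be differentiated almost everywhere and recovered from their derivatives is
  Lebesgue's theorem, proved with Vitali coverings of the sets where the difference quotients
  oscillate.  Finally \<open>\<integral> (1 + |\<omega>|) |f'|\<^sup>2\<close> is finite on \<open>Dom_delta\<close> by interpolation between
  \<open>f\<close> and \<open>f''\<close>, and \<open>Dom_L\<close> is dense in \<open>\<W>\<close> because it contains the products of polynomials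
  with \<open>C\<^sup>1\<close> bumps supported away from \<open>0\<close>.\<close>

section \<open>Absolutely continuous functions\<close>

text \<open>Two features of the encoding shape the proof. \<open>D\<close> is
  \<open>vector_derivative\<close>, whose value at a point without derivative is arbitrary, so the
  differential operators are linear only almost everywhere, and only on absolutely continuous
  functions; the abstract variance lemmas therefore ask for linearity and scaling almost everywhere
  and for measurability separately. Moreover a perturbation h has one derivative while f has two:
  each inner product of T f with T h is rewritten as one of h with a vector standing for T applied
  twice to f, at the cost of a single integration by parts. The operator \<open>i\<omega>D\<close>
  is delicate because the density of \<W> turns \<omega> into sgn \<omega>, which jumps at 0. The
  jump is harmless since f / \<omega> in L2 forces f to vanish at 0. The derivatives are computed
  for every f in \<open>Dom_delta\<close> with all expectations present. The expected value
  conditions only simplify the result, which is how existence is obtained without them.\<close>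

definition abs_cont :: "real \<Rightarrow> real \<Rightarrow> (real \<Rightarrow> 'a::real_normed_vector) \<Rightarrow> bool" where
  "abs_cont a b f \<longleftrightarrow>
     (\<forall>\<epsilon>>0. \<exists>\<delta>>0. \<forall>\<D>. \<D> division_of \<Union>\<D> \<longrightarrow> \<Union>\<D> \<subseteq> {a..b} \<longrightarrow> (\<Sum>K\<in>\<D>. Sup K - Inf K) < \<delta>
        \<longrightarrow> (\<Sum>K\<in>\<D>. norm (f (Sup K) - f (Inf K))) < \<epsilon>)"

text \<open>The codomain is generalised because differentiability almost everywhere is proved for
  real functions and then applied to real and imaginary parts.\<close>

lemma abs_cont_on_eq: "abs_cont_on a b f \<longleftrightarrow> abs_cont a b f"
  by (simp add: abs_cont_on_def abs_cont_def)

lemma abs_contD: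
  assumes "abs_cont a b f" "0 < e"
  obtains d where "0 < d"
    "\<And>\<D>. \<D> division_of \<Union>\<D> \<Longrightarrow> \<Union>\<D> \<subseteq> {a..b} \<Longrightarrow> (\<Sum>K\<in>\<D>. Sup K - Inf K) < d
        \<Longrightarrow> (\<Sum>K\<in>\<D>. norm (f (Sup K) - f (Inf K))) < e"
  using assms unfolding abs_cont_def by meson

section \<open>Sums over interval divisions\<close>

lemma division_interval_cases:
  fixes K :: "real set"
  assumes "\<D> division_of S" "K \<in> \<D>"
  obtains u v where "u \<le> v" "K = {u..v}"
  using division_ofD(3,4)[OF assms] by (metis atLeastatMost_empty_iff2 cbox_interval)

lemma division_sum_telescope:
  fixes f :: "real \<Rightarrow> 'a::real_normed_vector"
  assumes "d division_of {a..b}" "a \<le> b"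
  shows "(\<Sum>K\<in>d. f (Sup K) - f (Inf K)) = f b - f a"
proof -
  \<comment> \<open>\<open>Sup {}\<close> and \<open>Inf {}\<close> carry no information, whereas
    the additive interval function must be 0 on empty intervals.\<close>
  let ?g = "\<lambda>K::real set. if K = {} then 0 else f (Sup K) - f (Inf K)"
  interpret operative_real plus 0 ?g
    rewrites "comm_monoid_set.F (+) 0 = sum"
    by standard[1] (auto simp: sum_def)
  have "sum ?g d = ?g {a..b}"
    using division[of d a b] assms by simp
  moreover have "sum ?g d = (\<Sum>K\<in>d. f (Sup K) - f (Inf K))"
    using division_ofD(3)[OF assms(1)] by (intro sum.cong) auto
  ultimately show ?thesis using assms by auto
qed

lemma measure_division:
  fixes D :: "real set set"
  assumes "D division_of S"
  shows "measure lebesgue S = (\<Sum>K\<in>D. Sup K - Inf K)"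
proof -
  have "measure lebesgue S = sum (measure lebesgue) D"
    using content_division[OF assms] by (rule sym)
  also have "\<dots> = (\<Sum>K\<in>D. Sup K - Inf K)"
  proof (intro sum.cong refl)
    fix K assume "K \<in> D"
    then obtain u v where "u \<le> v" "K = {u..v}" using division_interval_cases[OF assms] by blast
    then show "measure lebesgue K = Sup K - Inf K" by simp
  qed
  finally show ?thesis .
qed

lemma abs_cont_continuous_on:
  assumes "abs_cont a b f"
  shows "continuous_on {a..b} f"
proof (rule uniformly_continuous_imp_continuous)
  show "uniformly_continuous_on {a..b} f"
    unfolding uniformly_continuous_on_def
  proof (intro allI impI)
    fix e :: real assume "0 < e"
    obtain d where d: "0 < d"
      "\<And>\<D>. \<D> division_of \<Union>\<D> \<Longrightarrow> \<Union>\<D> \<subseteq> {a..b} \<Longrightarrow> (\<Sum>K\<in>\<D>. Sup K - Inf K) < d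
        \<Longrightarrow> (\<Sum>K\<in>\<D>. norm (f (Sup K) - f (Inf K))) < e"
      by (rule abs_contD[OF assms \<open>0 < e\<close>]) blast
    have *: "norm (f y - f x) < e" if "x \<in> {a..b}" "y \<in> {a..b}" "x \<le> y" "y - x < d" for x y
    proof -
      have "{{x..y}} division_of \<Union>{{x..y}}"
        using division_of_self[of x y] that by simp
      then show ?thesis
        using d(2)[of "{{x..y}}"] that by auto
    qed
    show "\<exists>d>0. \<forall>x\<in>{a..b}. \<forall>x'\<in>{a..b}. dist x' x < d \<longrightarrow> dist (f x') (f x) < e"
    proof (intro exI[of _ d] conjI d ballI impI)
      fix x x' assume "x \<in> {a..b}" "x' \<in> {a..b}" "dist x' x < d"
      then show "dist (f x') (f x) < e"
        using *[of x x'] *[of x' x]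
        by (cases "x \<le> x'") (auto simp: dist_norm norm_minus_commute)
    qed
  qed
qed

text \<open>Vitali's theorem gives countably many disjoint admissible intervals covering
  \<open>E\<close> up to a null set; continuity of the measure from below leaves a finite subfamily
  that misses less than \<open>e\<close>. Disjoint nondegenerate intervals form a division of their
  union, the shape in which absolute continuity is stated.\<close>

lemma Vitali_finite:
  fixes E U :: "real set"
  assumes E: "E \<in> lmeasurable" and U: "open U" "E \<subseteq> U" "bounded U" and "0 < e"
    and P: "\<And>x d. x \<in> E \<Longrightarrow> 0 < d \<Longrightarrow> \<exists>u v. u < v \<and> v - u < d \<and> x \<in> {u..v} \<and> P u v"
  obtains D where "D division_of \<Union>D" "\<Union>D \<subseteq> U" "measure lebesgue (E - \<Union>D) < e"
    "\<And>K. K \<in> D \<Longrightarrow> \<exists>u v. u < v \<and> K = {u..v} \<and> P u v"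
proof -
  \<comment> \<open>Intervals are coded by their pairs of endpoints; \<open>m\<close> and
    \<open>r\<close> are midpoint and half-length, so that the ball version of the covering theorem
    applies.\<close>
  define K where "K = {i. fst i < snd i \<and> {fst i..snd i} \<subseteq> U \<and> P (fst i) (snd i)}"
  define m where "m = (\<lambda>i::real\<times>real. (fst i + snd i) / 2)"
  define r where "r = (\<lambda>i::real\<times>real. (snd i - fst i) / 2)"
  have cb: "cball (m i) (r i) = {fst i..snd i}" for i
    unfolding cball_eq_atLeastAtMost m_def r_def by (auto simp: field_simps)
  have 1: "0 < r i" if "i \<in> K" for i using that by (simp add: K_def r_def)
  have 2: "\<exists>i. i \<in> K \<and> x \<in> cball (m i) (r i) \<and> r i < d" if x: "x \<in> E" "0 < d" for x d
  proof -
    obtain c where c: "c > 0" "ball x c \<subseteq> U"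
      using U x by (meson openE subset_eq)
    obtain u v where uv: "u < v" "v - u < min c d" "x \<in> {u..v}" "P u v"
      using P[of x "min c d"] x c by auto
    have "{u..v} \<subseteq> ball x c" using uv by (auto simp: dist_real_def)
    then have "(u,v) \<in> K" using uv(1,4) c(2) by (simp add: K_def)
    moreover have "r (u,v) < d" using uv by (auto simp: r_def)
    ultimately show ?thesis using uv cb[of "(u,v)"] by (metis fst_conv snd_conv)
  qed
  obtain C where C: "countable C" "C \<subseteq> K"
     "pairwise (\<lambda>i j. disjnt (cball (m i) (r i)) (cball (m j) (r j))) C"
     "negligible (E - (\<Union>i \<in> C. cball (m i) (r i)))"
  proof (rule Vitali_covering_theorem_cballs[of K r E m])
    show "\<And>i. i \<in> K \<Longrightarrow> 0 < r i" by (rule 1)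
    show "\<And>x d. x \<in> E \<Longrightarrow> 0 < d \<Longrightarrow> \<exists>i. i \<in> K \<and> x \<in> cball (m i) (r i) \<and> r i < d" by (rule 2)
  qed
  define F where "F = (\<lambda>i. {fst i..snd i :: real}) ` C"
  have cF: "countable F" using C by (simp add: F_def)
  have FU: "\<Union>F \<subseteq> U" using C by (auto simp: F_def K_def)
  have neg: "negligible (E - \<Union>F)" using C(4) by (simp add: cb F_def)
  have disj: "X \<inter> Y = {}" if "X \<in> F" "Y \<in> F" "X \<noteq> Y" for X Y
  proof -
    from that obtain i j where ij: "i \<in> C" "j \<in> C" "X = {fst i..snd i}" "Y = {fst j..snd j}"
      unfolding F_def by blast
    then have "i \<noteq> j" using that(3) by auto
    then have "disjnt (cball (m i) (r i)) (cball (m j) (r j))"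
      using pairwiseD[OF C(3) ij(1,2)] by blast
    then show ?thesis by (simp only: ij cb disjnt_def)
  qed
  have Fi: "\<exists>u v. u < v \<and> X = {u..v} \<and> P u v" if "X \<in> F" for X
    using that C(2) unfolding F_def K_def by blast
  have Fdiv: "G division_of \<Union>G" if G: "G \<subseteq> F" "finite G" for G
  proof (rule division_ofI)
    fix X assume "X \<in> G"
    then obtain u v where uv: "u < v" "X = {u..v}" using Fi G by blast
    show "X \<subseteq> \<Union>G" using \<open>X \<in> G\<close> by blast
    show "X \<noteq> {}" using uv by simp
    show "\<exists>a b. X = cbox a b" using uv by (intro exI[of _ u] exI[of _ v]) simp
  next
    fix X Y assume "X \<in> G" "Y \<in> G" "X \<noteq> Y"
    then have "X \<inter> Y = {}" using disj G by blast
    then show "interior X \<inter> interior Y = {}" using interior_subset by blast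
  qed (use G in auto)
  have mF: "X \<inter> E \<in> lmeasurable" if X: "X \<in> F" for X
  proof -
    obtain u v where "X = {u..v}" using Fi[OF X] by blast
    then show ?thesis using E by (intro fmeasurable.Int) simp_all
  qed
  \<comment> \<open>The traces on \<open>E\<close> are used, so that every finite union is bounded
    by the measure of \<open>E\<close> and the limit is the measure of the covered part of
    \<open>E\<close>.\<close>
  obtain F' where F': "F' \<subseteq> (\<lambda>X. X \<inter> E) ` F" "finite F'"
      "measure lebesgue (\<Union>((\<lambda>X. X \<inter> E) ` F)) - e < measure lebesgue (\<Union>F')"
  proof (rule measure_countable_Union_approachable[of "(\<lambda>X. X \<inter> E) ` F" e "measure lebesgue E"])
    show "measure lebesgue (\<Union>D') \<le> measure lebesgue E" if "D' \<subseteq> (\<lambda>X. X \<inter> E) ` F" "finite D'" for D'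
    proof (intro measure_mono_fmeasurable E)
      show "\<Union>D' \<subseteq> E" using that by blast
      show "\<Union>D' \<in> sets lebesgue"
        using that mF by (intro fmeasurableD fmeasurable.finite_Union) blast+
    qed
    show "countable ((\<lambda>X. X \<inter> E) ` F)" using cF by simp
    show "d \<in> lmeasurable" if "d \<in> (\<lambda>X. X \<inter> E) ` F" for d using that mF by blast
  qed (rule \<open>0 < e\<close>)
  obtain G where G: "G \<subseteq> F" "finite G" "F' = (\<lambda>X. X \<inter> E) ` G"
    using F' by (meson finite_subset_image)
  show thesis
  proof
    show dG: "G division_of \<Union>G" using Fdiv G by blast
    show "\<Union>G \<subseteq> U" using FU G by blast
    have mG: "\<Union>G \<in> lmeasurable" using lmeasurable_division[OF dG] .
    have "measure lebesgue (\<Union>((\<lambda>X. X \<inter> E) ` F)) = measure lebesgue E"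
    proof (rule measure_negligible_symdiff)
      have "(E - \<Union>((\<lambda>X. X \<inter> E) ` F)) \<union> (\<Union>((\<lambda>X. X \<inter> E) ` F) - E) = E - \<Union>F" by auto
      then show "negligible (sym_diff E (\<Union>X\<in>F. X \<inter> E))" using neg by simp
    qed (use E in auto)
    moreover have "\<Union>F' = \<Union>G \<inter> E" using G by auto
    moreover have "measure lebesgue (E - \<Union>G) = measure lebesgue E - measure lebesgue (E \<inter> \<Union>G)"
    proof -
      have "measure lebesgue (E - E \<inter> \<Union>G) = measure lebesgue E - measure lebesgue (E \<inter> \<Union>G)"
        using E mG by (intro measurable_measure_Diff) (auto intro: fmeasurable.Int fmeasurableD)
      then show ?thesis by (simp add: Diff_Int_distrib Diff_Int)
    qed
    ultimately show "measure lebesgue (E - \<Union>G) < e"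
      using F'(3) by (simp add: Int_commute)
  qed (use Fi G in auto)
qed

text \<open>Vitali's theorem inside each interval of \<open>D\<close> leaves gaps of small total length, over which an
  absolutely continuous function varies little.\<close>

lemma division_increment_ge:
  fixes g :: "real \<Rightarrow> real"
  assumes AC: "abs_cont a b g" and "0 < e"
  obtains d where "0 < d"
    "\<And>D E. D division_of \<Union>D \<Longrightarrow> \<Union>D \<subseteq> {a..b} \<Longrightarrow> E \<in> lmeasurable \<Longrightarrow> measure lebesgue (\<Union>D - E) < d
       \<Longrightarrow> (\<And>x d. x \<in> E \<Longrightarrow> 0 < d \<Longrightarrow> \<exists>u v. u < v \<and> v - u < d \<and> x \<in> {u..v} \<and> q * (v - u) < g v - g u)
       \<Longrightarrow> q * measure lebesgue (\<Union>D) - e \<le> (\<Sum>K\<in>D. g (Sup K) - g (Inf K))"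
proof -
  obtain d0 where d0: "0 < d0"
     "\<And>\<D>. \<D> division_of \<Union>\<D> \<Longrightarrow> \<Union>\<D> \<subseteq> {a..b} \<Longrightarrow> (\<Sum>K\<in>\<D>. Sup K - Inf K) < d0
        \<Longrightarrow> (\<Sum>K\<in>\<D>. norm (g (Sup K) - g (Inf K))) < e / 2"
    by (rule abs_contD[OF AC, of "e / 2"]) (use \<open>0 < e\<close> in auto)
  \<comment> \<open>The gaps will have total length at most \<open>d\<close>. Half of
    \<open>d0\<close> keeps this below the threshold for an increment of \<open>e / 2\<close>, and
    the second bound makes the loss of \<open>q\<close> times the gap length at most
    \<open>e / 2\<close>.\<close>
  define d where "d = min (d0 / 2) (e / (4 * (\<bar>q\<bar> + 1)))"
  have d: "0 < d" "2 * d \<le> d0" "2 * d * \<bar>q\<bar> \<le> e / 2"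
  proof -
    show "0 < d" using d0 \<open>0 < e\<close> by (simp add: d_def add_nonneg_pos)
    show "2 * d \<le> d0" by (simp add: d_def)
    have "2 * d * \<bar>q\<bar> \<le> 2 * (e / (4 * (\<bar>q\<bar> + 1))) * (\<bar>q\<bar> + 1)"
      using \<open>0 < d\<close> by (intro mult_mono) (auto simp: d_def)
    also have "\<dots> = e / 2" by (simp add: field_simps)
    finally show "2 * d * \<bar>q\<bar> \<le> e / 2" .
  qed
  show thesis
  proof (rule that[OF d(1)])
    fix D E
    assume D: "D division_of \<Union>D" "\<Union>D \<subseteq> {a..b}" and E: "E \<in> lmeasurable"
      and small: "measure lebesgue (\<Union>D - E) < d"
      and slope: "\<And>x d. x \<in> E \<Longrightarrow> 0 < d \<Longrightarrow> \<exists>u v. u < v \<and> v - u < d \<and> x \<in> {u..v} \<and> q * (v - u) < g v - g u"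
    note fD = division_ofD(1)[OF D(1)]
    \<comment> \<open>The slack between \<open>d\<close> and the part of the division outside
      \<open>E\<close> is shared among the intervals of \<open>D\<close>; the added 1 avoids
      division by zero for empty \<open>D\<close>.\<close>
    define \<eta> where "\<eta> = (d - measure lebesgue (\<Union>D - E)) / (card D + 1)"
    have eta: "0 < \<eta>" using small by (simp add: \<eta>_def)
    have "\<exists>F G. F \<subseteq> G \<and> G division_of K \<and> F division_of \<Union>F \<and> measure lebesgue (E \<inter> interior K - \<Union>F) < \<eta> \<and>
        (\<forall>J\<in>F. q * (Sup J - Inf J) \<le> g (Sup J) - g (Inf J))" if K: "K \<in> D" for K
    proof -
      obtain u v where uv: "u \<le> v" "K = {u..v}" using division_interval_cases[OF D(1) K] by blast
      obtain F where F: "F division_of \<Union>F" "\<Union>F \<subseteq> {u<..<v}" "measure lebesgue (E \<inter> {u<..<v} - \<Union>F) < \<eta>"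
        "\<And>J. J \<in> F \<Longrightarrow> \<exists>u v. u < v \<and> J = {u..v} \<and> q * (v - u) < g v - g u"
      proof (rule Vitali_finite[of "E \<inter> {u<..<v}" "{u<..<v}" \<eta> "\<lambda>u v. q * (v - u) < g v - g u"])
        show "E \<inter> {u<..<v} \<in> lmeasurable" using E by (intro fmeasurable.Int) simp_all
        show "\<exists>u v. u < v \<and> v - u < d \<and> x \<in> {u..v} \<and> q * (v - u) < g v - g u" if "x \<in> E \<inter> {u<..<v}" "0 < d" for x d
          using slope[of x d] that by blast
      qed (use eta in \<open>auto simp: bounded_subset[of "{u..v}"]\<close>)
      have "\<Union>F \<subseteq> cbox u v" using F(2) by fastforce
      then obtain G where G: "F \<subseteq> G" "G division_of cbox u v"
        using partial_division_extend_interval[OF F(1)] by blast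
      have "q * (Sup J - Inf J) \<le> g (Sup J) - g (Inf J)" if J: "J \<in> F" for J
      proof -
        obtain x y where "x < y" "J = {x..y}" "q * (y - x) < g y - g x" using F(4)[OF J] by blast
        then show ?thesis by simp
      qed
      then show ?thesis using F G uv by (intro exI[of _ F] exI[of _ G]) auto
    qed
    then obtain F G where FG: "\<And>K. K \<in> D \<Longrightarrow> F K \<subseteq> G K" "\<And>K. K \<in> D \<Longrightarrow> G K division_of K"
       "\<And>K. K \<in> D \<Longrightarrow> F K division_of \<Union>(F K)"
       "\<And>K. K \<in> D \<Longrightarrow> measure lebesgue (E \<inter> interior K - \<Union>(F K)) < \<eta>"
       "\<And>K J. K \<in> D \<Longrightarrow> J \<in> F K \<Longrightarrow> q * (Sup J - Inf J) \<le> g (Sup J) - g (Inf J)"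
      by metis
    \<comment> \<open>These are the gaps. Degenerate members are dropped: they contribute nothing,
      and a nonempty interior is what prevents one gap from lying in two intervals of
      \<open>D\<close>.\<close>
    define H where "H = (\<lambda>K. {J \<in> G K - F K. Inf J < Sup J})"
    define l where "l = (\<lambda>K::real set. Sup K - Inf K)"
    define \<phi> where "\<phi> = (\<lambda>K::real set. g (Sup K) - g (Inf K))"
    have finG: "finite (G K)" if "K \<in> D" for K using division_ofD(1)[OF FG(2)[OF that]] .
    have finF: "finite (F K)" if "K \<in> D" for K using division_ofD(1)[OF FG(3)[OF that]] .
    have finH: "finite (H K)" if "K \<in> D" for K using finG[OF that] by (auto simp: H_def)
    have HK: "J \<subseteq> K" "interior J \<noteq> {}" if J: "J \<in> H K" "K \<in> D" for J K
    proof -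
      have JG: "J \<in> G K" using J by (auto simp: H_def)
      then show "J \<subseteq> K" using division_ofD(2)[OF FG(2)[OF J(2)]] by blast
      obtain u v where "u \<le> v" "J = {u..v}" using division_interval_cases[OF FG(2)[OF J(2)] JG] by blast
      then show "interior J \<noteq> {}" using J(1) by (simp add: H_def)
    qed
    have split: "(\<Sum>J\<in>G K. \<psi> J) = (\<Sum>J\<in>F K. \<psi> J) + (\<Sum>J\<in>H K. \<psi> J)"
      if K: "K \<in> D" and \<psi>: "\<And>J. Inf J = Sup J \<Longrightarrow> \<psi> J = 0" for K and \<psi> :: "real set \<Rightarrow> real"
    proof -
      have "(\<Sum>J\<in>G K. \<psi> J) = (\<Sum>J\<in>G K - F K. \<psi> J) + (\<Sum>J\<in>F K. \<psi> J)"
        using FG(1)[OF K] finG[OF K] by (rule sum.subset_diff)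
      moreover have "(\<Sum>J\<in>G K - F K. \<psi> J) = (\<Sum>J\<in>H K. \<psi> J)"
      proof (rule sum.mono_neutral_right)
        show "\<forall>J\<in>G K - F K - H K. \<psi> J = 0"
        proof
          fix J assume J: "J \<in> G K - F K - H K"
          then have "J \<in> G K" by simp
          then obtain u v where "u \<le> v" "J = {u..v}"
            using division_interval_cases[OF FG(2)[OF K]] by blast
          with J show "\<psi> J = 0" by (intro \<psi>) (auto simp: H_def)
        qed
      qed (use finG[OF K] in \<open>auto simp: H_def\<close>)
      ultimately show ?thesis by simp
    qed
    have lK: "l K = (\<Sum>J\<in>F K. l J) + (\<Sum>J\<in>H K. l J)" and
         gK: "\<phi> K = (\<Sum>J\<in>F K. \<phi> J) + (\<Sum>J\<in>H K. \<phi> J)" if K: "K \<in> D" for K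
    proof -
      obtain u v where uv: "u \<le> v" "K = {u..v}" using division_interval_cases[OF D(1) K] by blast
      show "l K = (\<Sum>J\<in>F K. l J) + (\<Sum>J\<in>H K. l J)"
        using split[OF K, of l] division_sum_telescope[of "G K" u v "\<lambda>x. x"] FG(2)[OF K] uv
        by (simp add: l_def)
      show "\<phi> K = (\<Sum>J\<in>F K. \<phi> J) + (\<Sum>J\<in>H K. \<phi> J)"
        using split[OF K, of \<phi>] division_sum_telescope[of "G K" u v g] FG(2)[OF K] uv
        by (simp add: \<phi>_def)
    qed
    have lD: "(\<Sum>K\<in>D. l K) = measure lebesgue (\<Union>D)"
      using measure_division[OF D(1)] by (simp add: l_def)
    have mK: "K \<in> lmeasurable" if K: "K \<in> D" for K
    proof -
      obtain u v where uv: "u \<le> v" "K = {u..v}" using division_interval_cases[OF D(1) K] by blast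
      then show ?thesis by simp
    qed
    have lF: "measure lebesgue (K \<inter> E) - \<eta> \<le> (\<Sum>J\<in>F K. l J)" if K: "K \<in> D" for K
    proof -
      obtain u v where uv: "u \<le> v" "K = {u..v}" using division_interval_cases[OF D(1) K] by blast
      have mF: "\<Union>(F K) \<in> lmeasurable" using lmeasurable_division[OF FG(3)[OF K]] .
      have m1: "E \<inter> interior K \<in> lmeasurable" using E uv by (intro fmeasurable.Int) simp_all
      \<comment> \<open>Vitali was applied inside the open interval, so at most the two endpoints
        are lost.\<close>
      have "measure lebesgue (K \<inter> E) = measure lebesgue (E \<inter> interior K)"
      proof (rule measure_negligible_symdiff)
        show "E \<inter> interior K \<in> lmeasurable" by (rule m1)
        have "negligible {u,v}" by simp
        then show "negligible (sym_diff (E \<inter> interior K) (K \<inter> E))"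
          by (rule negligible_subset) (use uv in auto)
      qed
      also have "\<dots> \<le> measure lebesgue (\<Union>(F K) \<union> (E \<inter> interior K - \<Union>(F K)))"
        using m1 mF by (intro measure_mono_fmeasurable) (auto intro: fmeasurable.Un fmeasurable.Diff)
      also have "\<dots> \<le> measure lebesgue (\<Union>(F K)) + measure lebesgue (E \<inter> interior K - \<Union>(F K))"
        using m1 mF by (intro measure_Un_le) auto
      also have "measure lebesgue (\<Union>(F K)) = (\<Sum>J\<in>F K. l J)"
        using measure_division[OF FG(3)[OF K]] by (simp add: l_def)
      finally show ?thesis using FG(4)[OF K] by simp
    qed
    have mUD: "\<Union>D \<in> lmeasurable" using lmeasurable_division[OF D(1)] .
    have "measure lebesgue (\<Union>D \<inter> E) = measure lebesgue (\<Union>K\<in>D. K \<inter> E)"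
      by (rule arg_cong[of _ _ "measure lebesgue"]) blast
    also have "\<dots> \<le> (\<Sum>K\<in>D. measure lebesgue (K \<inter> E))"
      using fD mK E by (intro measure_UNION_le) (auto intro: fmeasurable.Int)
    also have "\<dots> \<le> (\<Sum>K\<in>D. (\<Sum>J\<in>F K. l J) + \<eta>)"
      using lF by (intro sum_mono) (simp add: algebra_simps)
    finally have "measure lebesgue (\<Union>D \<inter> E) \<le> (\<Sum>K\<in>D. \<Sum>J\<in>F K. l J) + card D * \<eta>"
      by (simp add: sum.distrib)
    moreover have "card D * \<eta> \<le> d - measure lebesgue (\<Union>D - E)"
      using small by (simp add: \<eta>_def field_simps)
    moreover have "measure lebesgue (\<Union>D) = measure lebesgue (\<Union>D \<inter> E) + measure lebesgue (\<Union>D - E)"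
    proof -
      have "measure lebesgue (\<Union>D - \<Union>D \<inter> E) = measure lebesgue (\<Union>D) - measure lebesgue (\<Union>D \<inter> E)"
        using mUD E by (intro measurable_measure_Diff) (auto intro: fmeasurable.Int fmeasurableD)
      then show ?thesis by (simp add: Diff_Int)
    qed
    ultimately have sF: "measure lebesgue (\<Union>D) - d \<le> (\<Sum>K\<in>D. \<Sum>J\<in>F K. l J)"
      by linarith
    have sH: "(\<Sum>K\<in>D. \<Sum>J\<in>H K. l J) = measure lebesgue (\<Union>D) - (\<Sum>K\<in>D. \<Sum>J\<in>F K. l J)"
      unfolding lD[symmetric] by (simp add: lK sum.distrib)
    have nnH: "0 \<le> (\<Sum>K\<in>D. \<Sum>J\<in>H K. l J)"
      by (intro sum_nonneg) (auto simp: H_def l_def)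
    \<comment> \<open>All gaps together form one division, so the absolute continuity estimate is
      spent only once rather than once per interval of \<open>D\<close>.\<close>
    define Q where "Q = (\<Union>K\<in>D. H K)"
    have sumQ: "(\<Sum>J\<in>Q. \<psi> J) = (\<Sum>K\<in>D. \<Sum>J\<in>H K. \<psi> J)" for \<psi> :: "real set \<Rightarrow> real"
      unfolding Q_def
    proof (rule sum.UNION_disjoint)
      show "\<forall>i\<in>D. \<forall>j\<in>D. i \<noteq> j \<longrightarrow> H i \<inter> H j = {}"
      proof (intro ballI impI, rule ccontr)
        fix K K' assume K: "K \<in> D" "K' \<in> D" "K \<noteq> K'" and "H K \<inter> H K' \<noteq> {}"
        then obtain J where "J \<in> H K" "J \<in> H K'" by blast
        then have "interior J \<subseteq> interior K \<inter> interior K'" "interior J \<noteq> {}"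
          using HK K by (auto dest: interior_mono[of J K] interior_mono[of J K'])
        then show False using division_ofD(5)[OF D(1) K] by blast
      qed
    qed (use fD finH in auto)
    have Qdiv: "Q division_of \<Union>Q"
    proof (rule division_ofI)
      show "finite Q" using fD finH by (auto simp: Q_def)
      fix J assume "J \<in> Q"
      then obtain K where K: "K \<in> D" "J \<in> H K" by (auto simp: Q_def)
      then have JG: "J \<in> G K" by (auto simp: H_def)
      show "J \<subseteq> \<Union>Q" using \<open>J \<in> Q\<close> by blast
      show "J \<noteq> {}" "\<exists>a b. J = cbox a b" using division_ofD(3,4)[OF FG(2)[OF K(1)] JG] .
      fix J' assume "J' \<in> Q" "J \<noteq> J'"
      then obtain K' where K': "K' \<in> D" "J' \<in> H K'" by (auto simp: Q_def)
      show "interior J \<inter> interior J' = {}"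
      proof (cases "K = K'")
        case True
        then have "J' \<in> G K" using K' by (auto simp: H_def)
        then show ?thesis using division_ofD(5)[OF FG(2)[OF K(1)] JG] \<open>J \<noteq> J'\<close> by blast
      next
        case False
        have "interior J \<subseteq> interior K" "interior J' \<subseteq> interior K'"
          using HK(1) K K' by (auto intro!: interior_mono)
        then show ?thesis using division_ofD(5)[OF D(1) K(1) K'(1) False] by blast
      qed
    qed simp
    have "\<Union>Q \<subseteq> {a..b}" using HK(1) D(2) by (fastforce simp: Q_def)
    moreover have "(\<Sum>J\<in>Q. Sup J - Inf J) < d0"
      using sumQ[of l] sH sF d by (simp add: l_def)
    ultimately have "(\<Sum>J\<in>Q. norm (\<phi> J)) < e / 2"
      using d0(2)[OF Qdiv] by (simp add: \<phi>_def)
    then have "- (e / 2) \<le> (\<Sum>J\<in>Q. \<phi> J)"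
      using norm_sum[of \<phi> Q] by (simp add: abs_le_iff)
    then have gH: "- (e / 2) \<le> (\<Sum>K\<in>D. \<Sum>J\<in>H K. \<phi> J)" by (simp add: sumQ)
    have gF: "q * (\<Sum>K\<in>D. \<Sum>J\<in>F K. l J) \<le> (\<Sum>K\<in>D. \<Sum>J\<in>F K. \<phi> J)"
      unfolding sum_distrib_left using FG(5) by (intro sum_mono) (simp add: l_def \<phi>_def)
    have "q * (measure lebesgue (\<Union>D) - (\<Sum>K\<in>D. \<Sum>J\<in>F K. l J)) \<le> \<bar>q\<bar> * d"
    proof -
      have "q * (measure lebesgue (\<Union>D) - (\<Sum>K\<in>D. \<Sum>J\<in>F K. l J))
          \<le> \<bar>q\<bar> * (measure lebesgue (\<Union>D) - (\<Sum>K\<in>D. \<Sum>J\<in>F K. l J))"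
        using nnH sH by (intro mult_right_mono) auto
      also have "\<dots> \<le> \<bar>q\<bar> * d" using sF by (intro mult_left_mono) auto
      finally show ?thesis .
    qed
    then have "q * measure lebesgue (\<Union>D) - e / 2 \<le> q * (\<Sum>K\<in>D. \<Sum>J\<in>F K. l J)"
      using d(3) d(1) \<open>0 < e\<close> by (simp add: algebra_simps)
    moreover have "(\<Sum>K\<in>D. \<phi> K) = (\<Sum>K\<in>D. \<Sum>J\<in>F K. \<phi> J) + (\<Sum>K\<in>D. \<Sum>J\<in>H K. \<phi> J)"
      by (simp add: gK sum.distrib)
    ultimately show "q * measure lebesgue (\<Union>D) - e \<le> (\<Sum>K\<in>D. g (Sup K) - g (Inf K))"
      using gF gH by (simp add: \<phi>_def)
  qed
qed

section \<open>Difference quotients and differentiability almost everywhere\<close>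

abbreviation slope :: "(real \<Rightarrow> real) \<Rightarrow> real \<Rightarrow> real \<Rightarrow> real" where
  "slope g x y \<equiv> (g y - g x) / (y - x)"

text \<open>Supplies the fine cover for Vitali: the interval has \<open>x\<close> as one endpoint
  and a nearby point as the other, on whichever side that point lies.\<close>

lemma frequently_slope_interval:
  assumes "\<exists>\<^sub>F y in at x. q < slope g x y" "0 < d"
  shows "\<exists>u v. u < v \<and> v - u < d \<and> x \<in> {u..v} \<and> q * (v - u) < g v - g u"
proof -
  have "\<forall>\<^sub>F y in at x. dist y x < d" using \<open>0 < d\<close> by (auto simp: eventually_at)
  moreover have "\<forall>\<^sub>F y in at x. y \<noteq> x" by (simp add: eventually_at_filter)
  ultimately have "\<exists>\<^sub>F y in at x. q < slope g x y \<and> dist y x < d \<and> y \<noteq> x"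
    using assms(1) by (intro frequently_eventually_frequently eventually_conj)
  then obtain y where y: "q < slope g x y" "\<bar>y - x\<bar> < d" "y \<noteq> x"
    by (auto dest: frequently_ex simp: dist_real_def)
  consider "x < y" | "y < x" using y(3) by linarith
  then show ?thesis
  proof cases
    case 1
    then show ?thesis using y by (intro exI[of _ x] exI[of _ y]) (auto simp: field_simps)
  next
    case 2
    have "slope g x y = (g x - g y) / (x - y)" by (metis minus_diff_eq minus_divide_divide)
    then have "q * (x - y) < g x - g y" using y(1) 2 by (simp add: field_simps)
    with 2 show ?thesis using y by (intro exI[of _ y] exI[of _ x]) auto
  qed
qed

text \<open>Small slopes of g are large slopes of its negative, so one lower estimate of increments
  serves both directions.\<close>

lemma frequently_slope_uminus:
  "(\<exists>\<^sub>F y in at x. slope g x y < p) \<longleftrightarrow> (\<exists>\<^sub>F y in at x. - p < slope (\<lambda>x. - g x) x y)"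
proof -
  have "slope g x y < p \<longleftrightarrow> - p < slope (\<lambda>x. - g x) x y" for y
    by (simp add: diff_divide_distrib) linarith
  then show ?thesis by presburger
qed

lemma abs_cont_uminus: "abs_cont a b g \<Longrightarrow> abs_cont a b (\<lambda>x. - g x)"
  unfolding abs_cont_def by (simp add: norm_minus_commute)

text \<open>A division that nearly fills \<open>E\<close> inside a slightly larger open set has an
  increment of g at least q times and at most p times its length, up to an error \<open>e\<close>
  each. Since p < q, its length is of the order of \<open>e\<close>.\<close>

lemma oscillating_slopes_null:
  assumes AC: "abs_cont a b g" and "p < q" and E: "E \<in> lmeasurable" "E \<subseteq> {a<..<b}"
    and p: "\<And>x. x \<in> E \<Longrightarrow> \<exists>\<^sub>F y in at x. slope g x y < p"
    and q: "\<And>x. x \<in> E \<Longrightarrow> \<exists>\<^sub>F y in at x. q < slope g x y"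
  shows "measure lebesgue E = 0"
proof -
  have le: "(q - p) * (measure lebesgue E - e) \<le> 2 * e" if e: "0 < e" for e
  proof -
    obtain d1 where d1: "0 < d1"
      "\<And>D E. D division_of \<Union>D \<Longrightarrow> \<Union>D \<subseteq> {a..b} \<Longrightarrow> E \<in> lmeasurable \<Longrightarrow> measure lebesgue (\<Union>D - E) < d1
         \<Longrightarrow> (\<And>x d. x \<in> E \<Longrightarrow> 0 < d \<Longrightarrow> \<exists>u v. u < v \<and> v - u < d \<and> x \<in> {u..v} \<and> q * (v - u) < g v - g u)
         \<Longrightarrow> q * measure lebesgue (\<Union>D) - e \<le> (\<Sum>K\<in>D. g (Sup K) - g (Inf K))"
      by (rule division_increment_ge[OF AC e, of q]) blast
    obtain d2 where d2: "0 < d2"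
      "\<And>D E. D division_of \<Union>D \<Longrightarrow> \<Union>D \<subseteq> {a..b} \<Longrightarrow> E \<in> lmeasurable \<Longrightarrow> measure lebesgue (\<Union>D - E) < d2
         \<Longrightarrow> (\<And>x d. x \<in> E \<Longrightarrow> 0 < d \<Longrightarrow> \<exists>u v. u < v \<and> v - u < d \<and> x \<in> {u..v} \<and> - p * (v - u) < - g v - - g u)
         \<Longrightarrow> - p * measure lebesgue (\<Union>D) - e \<le> (\<Sum>K\<in>D. - g (Sup K) - - g (Inf K))"
      by (rule division_increment_ge[OF abs_cont_uminus[OF AC] e, of "- p"]) blast
    \<comment> \<open>The neighbourhood bounds the part of the division outside \<open>E\<close>,
      which both increment estimates require to be small.\<close>
    obtain U where U: "open U" "E \<subseteq> U" "U - E \<in> lmeasurable" "measure lebesgue (U - E) < min d1 d2"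
    proof -
      obtain T where T: "open T" "E \<subseteq> T" "(T - E) \<in> lmeasurable" "emeasure lebesgue (T - E) < ennreal (min d1 d2)"
        using sets_lebesgue_outer_open[of E "min d1 d2"] E d1 d2 by (auto simp: fmeasurableD)
      have "measure lebesgue (T - E) < min d1 d2"
        using T d1(1) d2(1) by (subst (asm) emeasure_eq_measure2) (auto simp: ennreal_less_iff)
      with T that show ?thesis by blast
    qed
    \<comment> \<open>The trivial predicate is enough: \<open>D\<close> only has to fill
      \<open>E\<close>. The intervals of steep slope are found afterwards inside the members of
      \<open>D\<close>, once for each sign.\<close>
    obtain D where D: "D division_of \<Union>D" "\<Union>D \<subseteq> U \<inter> {a<..<b}" "measure lebesgue (E - \<Union>D) < e"
    proof (rule Vitali_finite[of E "U \<inter> {a<..<b}" e "\<lambda>_ _. True"])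
      show "\<exists>u v. u < v \<and> v - u < d \<and> x \<in> {u..v} \<and> True" if "0 < d" for x d :: real
        using that by (intro exI[of _ x] exI[of _ "x + d / 2"]) auto
      show "bounded (U \<inter> {a<..<b})" by (rule bounded_subset[of "{a..b}"]) auto
    qed (use E U e in auto)
    have mD: "\<Union>D \<in> lmeasurable" using lmeasurable_division[OF D(1)] .
    have "measure lebesgue (\<Union>D - E) \<le> measure lebesgue (U - E)"
      using D(2) U(3) mD E by (intro measure_mono_fmeasurable) (auto simp: fmeasurableD)
    then have sm: "measure lebesgue (\<Union>D - E) < d1" "measure lebesgue (\<Union>D - E) < d2"
      using U(4) by auto
    have Dab: "\<Union>D \<subseteq> {a..b}" using D(2) by fastforce
    have "q * measure lebesgue (\<Union>D) - e \<le> (\<Sum>K\<in>D. g (Sup K) - g (Inf K))"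
      using frequently_slope_interval[OF q] by (intro d1(2)[OF D(1) Dab E(1) sm(1)])
    moreover have "- p * measure lebesgue (\<Union>D) - e \<le> (\<Sum>K\<in>D. - g (Sup K) - - g (Inf K))"
      using frequently_slope_interval[OF p[unfolded frequently_slope_uminus]]
      by (intro d2(2)[OF D(1) Dab E(1) sm(2)])
    moreover have "(\<Sum>K\<in>D. - g (Sup K) - - g (Inf K)) = - (\<Sum>K\<in>D. g (Sup K) - g (Inf K))"
      by (simp flip: sum_negf)
    ultimately have *: "(q - p) * measure lebesgue (\<Union>D) \<le> 2 * e" by (simp add: algebra_simps)
    have "measure lebesgue E \<le> measure lebesgue (\<Union>D \<union> (E - \<Union>D))"
      using E mD by (intro measure_mono_fmeasurable) (auto intro: fmeasurable.Un fmeasurable.Diff simp: fmeasurableD)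
    also have "\<dots> \<le> measure lebesgue (\<Union>D) + measure lebesgue (E - \<Union>D)"
      using E mD by (intro measure_Un_le) (auto simp: fmeasurableD)
    finally have "(q - p) * (measure lebesgue E - e) \<le> (q - p) * measure lebesgue (\<Union>D)"
      using D(3) \<open>p < q\<close> by (intro mult_left_mono) auto
    with * show ?thesis by simp
  qed
  have "((\<lambda>e. 2 * e - (q - p) * (measure lebesgue E - e)) \<longlongrightarrow> 2 * 0 - (q - p) * (measure lebesgue E - 0)) (at_right 0)"
    by (intro tendsto_intros)
  then have "0 \<le> 2 * 0 - (q - p) * (measure lebesgue E - 0)"
    by (rule tendsto_lowerbound) (use le in \<open>auto simp: eventually_at_right_field intro: exI[of _ 1]\<close>)
  then show ?thesis using \<open>p < q\<close> measure_nonneg[of lebesgue E] by (simp add: mult_le_0_iff)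
qed

text \<open>Cover by intervals whose chord slope exceeds 1 / e in modulus. As long as their total
  length stays below the \<open>d\<close> that belongs to variation 1, that length is at most
  \<open>e\<close>.\<close>

lemma unbounded_slopes_null:
  assumes AC: "abs_cont a b g" and E: "E \<in> lmeasurable" "E \<subseteq> {a<..<b}"
    and ub: "\<And>x N. x \<in> E \<Longrightarrow> \<exists>\<^sub>F y in at x. N < \<bar>slope g x y\<bar>"
  shows "negligible E"
proof -
  obtain d where d: "0 < d"
    "\<And>\<D>. \<D> division_of \<Union>\<D> \<Longrightarrow> \<Union>\<D> \<subseteq> {a..b} \<Longrightarrow> (\<Sum>K\<in>\<D>. Sup K - Inf K) < d
        \<Longrightarrow> (\<Sum>K\<in>\<D>. norm (g (Sup K) - g (Inf K))) < 1"
    by (rule abs_contD[OF AC zero_less_one]) blast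
  \<comment> \<open>A ball of diameter \<open>d / 2\<close> keeps the total length of every division
    inside it below \<open>d\<close>.\<close>
  have loc: "negligible (E \<inter> ball z (d / 4))" for z
  proof -
    let ?E = "E \<inter> ball z (d / 4)"
    have mE: "?E \<in> lmeasurable" using E by (intro fmeasurable.Int) auto
    have le: "measure lebesgue ?E \<le> 2 * e" if e: "0 < e" for e
    proof -
      have "\<exists>u v. u < v \<and> v - u < c \<and> x \<in> {u..v} \<and> (1 / e) * (v - u) < \<bar>g v - g u\<bar>"
        if x: "x \<in> ?E" and c: "0 < c" for x c
      proof -
        have "\<exists>\<^sub>F y in at x. 1 / e < slope g x y \<or> slope g x y < - (1 / e)"
        proof -
          have *: "c < \<bar>s\<bar> \<longleftrightarrow> c < s \<or> s < - c" for c s :: real by linarith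
          show ?thesis using ub[of x "1 / e"] x unfolding * by blast
        qed
        then consider "\<exists>\<^sub>F y in at x. 1 / e < slope g x y" | "\<exists>\<^sub>F y in at x. slope g x y < - (1 / e)"
          unfolding frequently_disj_iff by blast
        then show ?thesis
        proof cases
          case 1
          show ?thesis using frequently_slope_interval[OF 1 c] by (metis abs_ge_self less_le_trans)
        next
          case 2
          have "\<exists>u v. u < v \<and> v - u < c \<and> x \<in> {u..v} \<and> - (- (1 / e)) * (v - u) < - g v - - g u"
            by (rule frequently_slope_interval[OF 2[unfolded frequently_slope_uminus] c])
          then show ?thesis by (metis abs_ge_minus_self add.inverse_inverse diff_minus_eq_add less_le_trans minus_diff_eq minus_add_distrib uminus_add_conv_diff)
        qed
      qed
      then obtain D where D: "D division_of \<Union>D" "\<Union>D \<subseteq> {a<..<b} \<inter> ball z (d / 4)"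
        "measure lebesgue (?E - \<Union>D) < e"
        "\<And>K. K \<in> D \<Longrightarrow> \<exists>u v. u < v \<and> K = {u..v} \<and> (1 / e) * (v - u) < \<bar>g v - g u\<bar>"
      proof (rule Vitali_finite[of ?E "{a<..<b} \<inter> ball z (d / 4)" e "\<lambda>u v. (1 / e) * (v - u) < \<bar>g v - g u\<bar>", rotated -2])
        show "bounded ({a<..<b} \<inter> ball z (d / 4))" by (rule bounded_subset[of "{a..b}"]) auto
      qed (use mE E e in auto)
      have mD: "\<Union>D \<in> lmeasurable" using lmeasurable_division[OF D(1)] .
      have "measure lebesgue (\<Union>D) \<le> measure lebesgue (ball z (d / 4))"
        using D(2) mD by (intro measure_mono_fmeasurable) auto
      also have "ball z (d / 4) = {z - d / 4 <..< z + d / 4}" by (rule ball_eq_greaterThanLessThan)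
      finally have "measure lebesgue (\<Union>D) < d" using d(1) by simp
      then have "(\<Sum>K\<in>D. Sup K - Inf K) < d" using measure_division[OF D(1)] by simp
      moreover have "\<Union>D \<subseteq> {a..b}" using D(2) by fastforce
      ultimately have "(\<Sum>K\<in>D. norm (g (Sup K) - g (Inf K))) < 1" using d(2)[OF D(1)] by blast
      moreover have "(1 / e) * (\<Sum>K\<in>D. Sup K - Inf K) \<le> (\<Sum>K\<in>D. norm (g (Sup K) - g (Inf K)))"
        unfolding sum_distrib_left
      proof (rule sum_mono)
        fix K assume "K \<in> D"
        then obtain u v where "u < v" "K = {u..v}" "(1 / e) * (v - u) < \<bar>g v - g u\<bar>" using D(4) by blast
        then show "(1 / e) * (Sup K - Inf K) \<le> norm (g (Sup K) - g (Inf K))" by simp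
      qed
      ultimately have "(1 / e) * (\<Sum>K\<in>D. Sup K - Inf K) < 1" by linarith
      then have "measure lebesgue (\<Union>D) \<le> e"
        unfolding measure_division[OF D(1)] using e by (simp add: field_simps)
      moreover have "measure lebesgue ?E \<le> measure lebesgue (\<Union>D \<union> (?E - \<Union>D))"
        using mE mD by (intro measure_mono_fmeasurable) (auto intro: fmeasurable.Un fmeasurable.Diff simp: fmeasurableD)
      moreover have "\<dots> \<le> measure lebesgue (\<Union>D) + measure lebesgue (?E - \<Union>D)"
        using mE mD by (intro measure_Un_le) (auto simp: fmeasurableD)
      ultimately show ?thesis using D(3) by linarith
    qed
    have "measure lebesgue ?E \<le> 0"
    proof (rule field_le_epsilon)
      fix e :: real assume "0 < e"
      then show "measure lebesgue ?E \<le> 0 + e" using le[of "e / 2"] by simp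
    qed
    then show ?thesis using mE by (simp add: negligible_iff_measure order_antisym)
  qed
  show ?thesis
    unfolding locally_negligible_alt[of E]
  proof
    fix x assume "x \<in> E"
    then show "\<exists>U. openin (top_of_set E) U \<and> x \<in> U \<and> negligible U"
      using loc[of x] d(1) by (intro exI[of _ "E \<inter> ball x (d / 4)"]) (auto intro: openin_open_Int)
  qed
qed

text \<open>For a fixed step \<open>s\<close> the set is open by continuity. The union over
  uncountably many \<open>s\<close> is still open, and only the intersection over the scales 1 / (n
  + 1) remains.\<close>

lemma borel_frequently_slope:
  assumes g: "continuous_on UNIV g" and S: "open S"
  shows "{x. \<exists>\<^sub>F y in at x. slope g x y \<in> S} \<in> sets borel"
proof -
  have "{x. \<exists>\<^sub>F y in at x. slope g x y \<in> S} =
    (\<Inter>n::nat. \<Union>s\<in>{s. s \<noteq> 0 \<and> \<bar>s\<bar> < 1 / Suc n}. {x. (g (x + s) - g x) / s \<in> S})" (is "?A = ?B")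
  proof (intro set_eqI iffI)
    fix x assume "x \<in> ?A"
    then have *: "\<forall>d>0. \<exists>y. y \<noteq> x \<and> dist y x < d \<and> slope g x y \<in> S" by (auto simp: frequently_at)
    show "x \<in> ?B"
    proof
      fix n :: nat
      obtain y where "y \<noteq> x" "dist y x < 1 / Suc n" "slope g x y \<in> S" using *[rule_format, of "1 / Suc n"] by auto
      then show "x \<in> (\<Union>s\<in>{s. s \<noteq> 0 \<and> \<bar>s\<bar> < 1 / Suc n}. {x. (g (x + s) - g x) / s \<in> S})"
        by (intro UN_I[of "y - x"]) (auto simp: dist_real_def)
    qed
  next
    fix x assume x: "x \<in> ?B"
    have "\<exists>y. y \<noteq> x \<and> dist y x < d \<and> slope g x y \<in> S" if d: "0 < d" for d
    proof -
      obtain n :: nat where n: "1 / Suc n < d" using nat_approx_posE[OF d] by metis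
      from x have "x \<in> (\<Union>s\<in>{s. s \<noteq> 0 \<and> \<bar>s\<bar> < 1 / Suc n}. {x. (g (x + s) - g x) / s \<in> S})" by blast
      then obtain s where "s \<noteq> 0" "\<bar>s\<bar> < 1 / Suc n" "(g (x + s) - g x) / s \<in> S" by blast
      then show ?thesis using n by (intro exI[of _ "x + s"]) (auto simp: dist_real_def)
    qed
    then show "x \<in> ?A" by (auto simp: frequently_at)
  qed
  also have "\<dots> \<in> sets borel"
  proof -
    have *: "open {x. (g (x + s) - g x) / s \<in> S}" if s: "s \<noteq> 0" for s
    proof -
    have "continuous_on UNIV (\<lambda>x. g (x + s))"
      by (rule continuous_on_compose2[OF g]) (auto intro!: continuous_intros)
    then have "continuous_on UNIV (\<lambda>x. (g (x + s) - g x) / s)"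
      using s g by (intro continuous_intros) auto
    from open_vimage[OF S this]
    show ?thesis by (simp add: vimage_def)
    qed
    have "(\<Union>s\<in>{s. s \<noteq> 0 \<and> \<bar>s\<bar> < 1 / Suc n}. {x. (g (x + s) - g x) / s \<in> S}) \<in> sets borel" for n
      by (intro borel_open open_UN ballI *) blast
    then show ?thesis by blast
  qed
  finally show ?thesis .
qed

text \<open>Bounded slopes have finite lower and upper limits; equal limits are the derivative,
  distinct ones leave room for two rationals. Rationals keep the family of exceptional sets
  countable.\<close>

lemma not_differentiable_slopes:
  fixes g :: "real \<Rightarrow> real"
  assumes "\<nexists>l. (g has_real_derivative l) (at x)"
  shows "(\<forall>N::nat. \<exists>\<^sub>F y in at x. real N < \<bar>slope g x y\<bar>)
    \<or> (\<exists>p q :: rat. p < q \<and> (\<exists>\<^sub>F y in at x. slope g x y < of_rat p) \<and> (\<exists>\<^sub>F y in at x. of_rat q < slope g x y))"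
proof (rule ccontr)
  assume neg: "\<not> ?thesis"
  let ?l = "Liminf (at x) (\<lambda>y. ereal (slope g x y))"
  let ?u = "Limsup (at x) (\<lambda>y. ereal (slope g x y))"
  from neg obtain N :: nat where "\<not> (\<exists>\<^sub>F y in at x. real N < \<bar>slope g x y\<bar>)" by blast
  then have "\<forall>\<^sub>F y in at x. \<bar>slope g x y\<bar> \<le> real N" by (simp add: not_frequently not_less)
  then have bd: "\<forall>\<^sub>F y in at x. - real N \<le> slope g x y \<and> slope g x y \<le> real N"
    by (rule eventually_mono) linarith
  have l: "ereal (- real N) \<le> ?l"
    by (intro Liminf_bounded eventually_mono[OF bd]) auto
  have u: "?u \<le> ereal (real N)"
    by (intro Limsup_bounded eventually_mono[OF bd]) auto
  have lu: "?l \<le> ?u" by (intro Liminf_le_Limsup) simp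
  have "?l = ?u"
  proof (rule ccontr)
    assume "?l \<noteq> ?u"
    then have "?l < ?u" using lu by simp
    then obtain q' where q': "?l < ereal q'" "ereal q' < ?u" using ereal_dense2 by blast
    then obtain p' where p': "?l < ereal p'" "ereal p' < ereal q'" using ereal_dense2 by blast
    obtain p where p: "p' < of_rat p" "of_rat p < q'" using of_rat_dense[of p' q'] p' by auto
    obtain q where q: "(of_rat p :: real) < of_rat q" "of_rat q < q'" using of_rat_dense[of "of_rat p" q'] p by auto
    have "\<exists>\<^sub>F y in at x. slope g x y < of_rat p"
    proof (rule ccontr)
      assume "\<not> ?thesis"
      then have "\<forall>\<^sub>F y in at x. of_rat p \<le> slope g x y" by (simp add: not_frequently not_less)
      then have "ereal (of_rat p) \<le> ?l" by (intro Liminf_bounded) (auto elim: eventually_mono)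
      then show False using p'(1) p(1) by (meson ereal_less_eq(3) leD less_imp_le order_le_less_trans order_trans)
    qed
    moreover have "\<exists>\<^sub>F y in at x. of_rat q < slope g x y"
    proof (rule ccontr)
      assume "\<not> ?thesis"
      then have "\<forall>\<^sub>F y in at x. slope g x y \<le> of_rat q" by (simp add: not_frequently not_less)
      then have "?u \<le> ereal (of_rat q)" by (intro Limsup_bounded) (auto elim: eventually_mono)
      then show False using q'(2) q(2) by (meson ereal_less_eq(3) leD less_imp_le order_less_le_trans order_trans)
    qed
    moreover have "p < q" using q(1) by (simp add: of_rat_less)
    ultimately show False using neg by blast
  qed
  moreover have "\<exists>r. L = ereal r" if "ereal a \<le> L" "L \<le> ereal b" for L a b
    using that by (cases L) auto
  then obtain r where "?l = ereal r" using l u lu by (meson order_trans)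
  ultimately have "((\<lambda>y. ereal (slope g x y)) \<longlongrightarrow> ereal r) (at x)"
    by (simp add: tendsto_iff_Liminf_eq_Limsup)
  then have "(g has_real_derivative r) (at x)"
    by (simp add: has_field_derivative_iff)
  then show False using assms by blast
qed

text \<open>The points without derivative lie in one set of unbounded slopes and countably many sets
  of oscillating slopes, each of them null.\<close>

lemma abs_cont_AE_differentiable_real:
  fixes g :: "real \<Rightarrow> real"
  assumes AC: "\<And>a b. abs_cont a b g"
  shows "AE x in lebesgue. \<exists>l. (g has_real_derivative l) (at x)"
proof -
  have cont: "continuous_on UNIV g"
  proof -
    have "continuous (at x) g" for x
    proof -
      have "continuous_on {x - 1<..<x + 1} g"
        using abs_cont_continuous_on[OF AC[of "x - 1" "x + 1"]] by (rule continuous_on_subset) auto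
      then show ?thesis by (subst (asm) continuous_on_eq_continuous_at) auto
    qed
    then show ?thesis by (simp add: continuous_at_imp_continuous_on)
  qed
  define A where "A = (\<lambda>p q :: rat. {x. \<exists>\<^sub>F y in at x. slope g x y \<in> {..<of_rat p}} \<inter> {x. \<exists>\<^sub>F y in at x. slope g x y \<in> {of_rat q<..}})"
  define B where "B = (\<Inter>N::nat. {x. \<exists>\<^sub>F y in at x. slope g x y \<in> {s. real N < \<bar>s\<bar>}})"
  have mA: "A p q \<in> sets lebesgue" for p q
    unfolding A_def
    by (intro sets_completionI_sets sets.Int; simp only: sets_lborel; intro borel_frequently_slope[OF cont] open_lessThan open_greaterThan)
  have op: "open {s::real. real N < \<bar>s\<bar>}" for N by (intro open_Collect_less continuous_intros)
  have mB: "B \<in> sets lebesgue"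
    unfolding B_def using borel_frequently_slope[OF cont op]
    by (intro sets_completionI_sets sets.countable_INT') auto
  \<comment> \<open>The null set lemmas speak of sets of finite measure inside an interval, so the
    line is exhausted by bounded windows.\<close>
  have cover: "negligible X" if X: "X \<in> sets lebesgue"
     "\<And>n::nat. negligible (X \<inter> {- real n <..< real n})" for X
  proof -
    have "X = (\<Union>n::nat. X \<inter> {- real n <..< real n})"
    proof (intro set_eqI iffI)
      fix x assume "x \<in> X"
      moreover obtain n :: nat where "\<bar>x\<bar> < real n" using reals_Archimedean2 by blast
      ultimately show "x \<in> (\<Union>n::nat. X \<inter> {- real n <..< real n})" by (intro UN_I[of n]) (auto simp: abs_less_iff)
    qed auto
    also have "negligible \<dots>" by (rule negligible_countable_Union) (use X(2) in auto)
    finally show ?thesis .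
  qed
  have nA: "negligible (A p q)" if "p < q" for p q
  proof (rule cover[OF mA])
    fix n :: nat
    let ?E = "A p q \<inter> {- real n<..<real n}"
    have mE: "?E \<in> lmeasurable"
      using fmeasurable_Int_fmeasurable[of "{- real n<..<real n}" lebesgue "A p q"] mA
      by (simp add: Int_commute)
    have "measure lebesgue ?E = 0"
    proof (rule oscillating_slopes_null[OF AC[of "- real n" "real n"] _ mE])
      show "(of_rat p :: real) < of_rat q" using \<open>p < q\<close> by (simp add: of_rat_less)
    qed (auto simp: A_def)
    then show "negligible ?E" using mE by (simp add: negligible_iff_measure)
  qed
  have nB: "negligible B"
  proof (rule cover[OF mB])
    fix n :: nat
    show "negligible (B \<inter> {- real n<..<real n})"
    proof (rule unbounded_slopes_null[OF AC[of "- real n" "real n"]])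
      show "B \<inter> {- real n<..<real n} \<in> lmeasurable"
        using fmeasurable_Int_fmeasurable[of "{- real n<..<real n}" lebesgue B] mB
        by (simp add: Int_commute)
      fix x N assume x: "x \<in> B \<inter> {- real n<..<real n}"
      obtain M :: nat where "N < real M" using reals_Archimedean2 by blast
      moreover have "x \<in> {x. \<exists>\<^sub>F y in at x. slope g x y \<in> {s. real M < \<bar>s\<bar>}}"
        using x unfolding B_def by (elim IntE INT_E[of _ _ _ M]) auto
      then have "\<exists>\<^sub>F y in at x. real M < \<bar>slope g x y\<bar>" unfolding mem_Collect_eq .
      ultimately show "\<exists>\<^sub>F y in at x. N < \<bar>slope g x y\<bar>"
        by (auto elim: frequently_elim1)
    qed auto
  qed
  have "{x. \<nexists>l. (g has_real_derivative l) (at x)} \<subseteq> B \<union> (\<Union>(p,q)\<in>{(p,q). p < q}. A p q)"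
  proof
    fix x assume "x \<in> {x. \<nexists>l. (g has_real_derivative l) (at x)}"
    from not_differentiable_slopes[OF this[unfolded mem_Collect_eq]]
    show "x \<in> B \<union> (\<Union>(p,q)\<in>{(p,q). p < q}. A p q)"
    proof
      assume "\<forall>N::nat. \<exists>\<^sub>F y in at x. real N < \<bar>slope g x y\<bar>"
      then show ?thesis by (simp add: B_def)
    next
      assume "\<exists>p q :: rat. p < q \<and> (\<exists>\<^sub>F y in at x. slope g x y < of_rat p) \<and> (\<exists>\<^sub>F y in at x. of_rat q < slope g x y)"
      then obtain p q :: rat where "p < q" "x \<in> A p q" by (auto simp: A_def)
      then show ?thesis by blast
    qed
  qed
  moreover have "negligible (B \<union> (\<Union>(p,q)\<in>{(p,q). p < q}. A p q))"
  proof (intro negligible_Un nB negligible_countable_Union)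
    show "countable ((\<lambda>(p,q). A p q) ` {(p,q). p < q})" by (rule countable_image) (rule countableI_type)
  qed (use nA in auto)
  ultimately have "negligible {x. \<nexists>l. (g has_real_derivative l) (at x)}" by (rule negligible_subset[rotated])
  then show ?thesis by (auto simp: negligible_iff_null_sets intro!: AE_I'[of "{x. \<nexists>l. (g has_real_derivative l) (at x)}"])
qed

section \<open>Closure properties of absolute continuity\<close>

lemma abs_cont_bounded_linear:
  assumes "abs_cont a b f" "bounded_linear T"
  shows "abs_cont a b (\<lambda>x. T (f x))"
  unfolding abs_cont_def
proof (intro allI impI)
  interpret bounded_linear T by fact
  fix e :: real assume e: "0 < e"
  obtain M where M: "0 < M" "\<And>x. norm (T x) \<le> norm x * M" using pos_bounded by blast
  obtain d where d: "0 < d"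
    "\<And>\<D>. \<D> division_of \<Union>\<D> \<Longrightarrow> \<Union>\<D> \<subseteq> {a..b} \<Longrightarrow> (\<Sum>K\<in>\<D>. Sup K - Inf K) < d
        \<Longrightarrow> (\<Sum>K\<in>\<D>. norm (f (Sup K) - f (Inf K))) < e / M"
    by (rule abs_contD[OF assms(1), of "e / M"]) (use M e in auto)
  show "\<exists>\<delta>>0. \<forall>\<D>. \<D> division_of \<Union>\<D> \<longrightarrow> \<Union>\<D> \<subseteq> {a..b} \<longrightarrow> (\<Sum>K\<in>\<D>. Sup K - Inf K) < \<delta>
        \<longrightarrow> (\<Sum>K\<in>\<D>. norm (T (f (Sup K)) - T (f (Inf K)))) < e"
  proof (intro exI[of _ d] conjI d allI impI)
    fix D assume D: "D division_of \<Union>D" "\<Union>D \<subseteq> {a..b}" "(\<Sum>K\<in>D. Sup K - Inf K) < d"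
    have "(\<Sum>K\<in>D. norm (T (f (Sup K)) - T (f (Inf K)))) \<le> (\<Sum>K\<in>D. norm (f (Sup K) - f (Inf K))) * M"
      unfolding sum_distrib_right using M(2) by (intro sum_mono) (simp flip: diff)
    also have "\<dots> < e" using d(2)[OF D] M(1) by (simp add: field_simps)
    finally show "(\<Sum>K\<in>D. norm (T (f (Sup K)) - T (f (Inf K)))) < e" .
  qed
qed

lemma abs_cont_add:
  assumes "abs_cont a b f" "abs_cont a b g"
  shows "abs_cont a b (\<lambda>x. f x + g x)"
  unfolding abs_cont_def
proof (intro allI impI)
  fix e :: real assume e: "0 < e"
  obtain d1 where d1: "0 < d1"
    "\<And>\<D>. \<D> division_of \<Union>\<D> \<Longrightarrow> \<Union>\<D> \<subseteq> {a..b} \<Longrightarrow> (\<Sum>K\<in>\<D>. Sup K - Inf K) < d1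
        \<Longrightarrow> (\<Sum>K\<in>\<D>. norm (f (Sup K) - f (Inf K))) < e / 2"
    by (rule abs_contD[OF assms(1), of "e / 2"]) (use e in auto)
  obtain d2 where d2: "0 < d2"
    "\<And>\<D>. \<D> division_of \<Union>\<D> \<Longrightarrow> \<Union>\<D> \<subseteq> {a..b} \<Longrightarrow> (\<Sum>K\<in>\<D>. Sup K - Inf K) < d2
        \<Longrightarrow> (\<Sum>K\<in>\<D>. norm (g (Sup K) - g (Inf K))) < e / 2"
    by (rule abs_contD[OF assms(2), of "e / 2"]) (use e in auto)
  show "\<exists>\<delta>>0. \<forall>\<D>. \<D> division_of \<Union>\<D> \<longrightarrow> \<Union>\<D> \<subseteq> {a..b} \<longrightarrow> (\<Sum>K\<in>\<D>. Sup K - Inf K) < \<delta>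
        \<longrightarrow> (\<Sum>K\<in>\<D>. norm (f (Sup K) + g (Sup K) - (f (Inf K) + g (Inf K)))) < e"
  proof (intro exI[of _ "min d1 d2"] conjI allI impI)
    show "0 < min d1 d2" using d1 d2 by simp
    fix D assume D: "D division_of \<Union>D" "\<Union>D \<subseteq> {a..b}" "(\<Sum>K\<in>D. Sup K - Inf K) < min d1 d2"
    have "(\<Sum>K\<in>D. norm (f (Sup K) + g (Sup K) - (f (Inf K) + g (Inf K))))
       \<le> (\<Sum>K\<in>D. norm (f (Sup K) - f (Inf K))) + (\<Sum>K\<in>D. norm (g (Sup K) - g (Inf K)))"
      unfolding sum.distrib[symmetric] by (intro sum_mono) (simp add: add_diff_add norm_triangle_ineq)
    then show "(\<Sum>K\<in>D. norm (f (Sup K) + g (Sup K) - (f (Inf K) + g (Inf K)))) < e"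
      using d1(2)[OF D(1,2)] d2(2)[OF D(1,2)] D(3) by simp
  qed
qed

lemma abs_cont_mult:
  fixes f g :: "real \<Rightarrow> 'a::real_normed_algebra"
  assumes "abs_cont a b f" "abs_cont a b g"
  shows "abs_cont a b (\<lambda>x. f x * g x)"
  unfolding abs_cont_def
proof (intro allI impI)
  fix e :: real assume e: "0 < e"
  \<comment> \<open>Absolute continuity gives continuity, hence a common bound for both factors on
    the compact interval.\<close>
  have "bounded (f ` {a..b} \<union> g ` {a..b})"
    using assms[THEN abs_cont_continuous_on] by (intro bounded_Un[THEN iffD2] conjI compact_imp_bounded compact_continuous_image) auto
  then obtain M where M: "0 < M" "\<And>x. x \<in> {a..b} \<Longrightarrow> norm (f x) \<le> M" "\<And>x. x \<in> {a..b} \<Longrightarrow> norm (g x) \<le> M"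
    unfolding bounded_pos by blast
  have e': "0 < e / (2 * M)" using e M by simp
  obtain d1 where d1: "0 < d1"
    "\<And>\<D>. \<D> division_of \<Union>\<D> \<Longrightarrow> \<Union>\<D> \<subseteq> {a..b} \<Longrightarrow> (\<Sum>K\<in>\<D>. Sup K - Inf K) < d1
        \<Longrightarrow> (\<Sum>K\<in>\<D>. norm (f (Sup K) - f (Inf K))) < e / (2 * M)"
    by (rule abs_contD[OF assms(1) e']) blast
  obtain d2 where d2: "0 < d2"
    "\<And>\<D>. \<D> division_of \<Union>\<D> \<Longrightarrow> \<Union>\<D> \<subseteq> {a..b} \<Longrightarrow> (\<Sum>K\<in>\<D>. Sup K - Inf K) < d2
        \<Longrightarrow> (\<Sum>K\<in>\<D>. norm (g (Sup K) - g (Inf K))) < e / (2 * M)"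
    by (rule abs_contD[OF assms(2) e']) blast
  show "\<exists>\<delta>>0. \<forall>\<D>. \<D> division_of \<Union>\<D> \<longrightarrow> \<Union>\<D> \<subseteq> {a..b} \<longrightarrow> (\<Sum>K\<in>\<D>. Sup K - Inf K) < \<delta>
        \<longrightarrow> (\<Sum>K\<in>\<D>. norm (f (Sup K) * g (Sup K) - f (Inf K) * g (Inf K))) < e"
  proof (intro exI[of _ "min d1 d2"] conjI allI impI)
    show "0 < min d1 d2" using d1 d2 by simp
    fix D assume D: "D division_of \<Union>D" "\<Union>D \<subseteq> {a..b}" "(\<Sum>K\<in>D. Sup K - Inf K) < min d1 d2"
    have "norm (f (Sup K) * g (Sup K) - f (Inf K) * g (Inf K))
        \<le> M * norm (f (Sup K) - f (Inf K)) + M * norm (g (Sup K) - g (Inf K))" if K: "K \<in> D" for K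
    proof -
      obtain u v where uv: "u \<le> v" "K = {u..v}" using division_interval_cases[OF D(1) K] by blast
      have "K \<subseteq> {a..b}" using K D(2) by blast
      then have "u \<in> {a..b}" "v \<in> {a..b}" using uv by auto
      have "f v * g v - f u * g u = (f v - f u) * g v + f u * (g v - g u)" by (simp add: algebra_simps)
      also have "norm \<dots> \<le> norm (f v - f u) * norm (g v) + norm (f u) * norm (g v - g u)"
        by (meson add_mono norm_mult_ineq norm_triangle_le)
      also have "\<dots> \<le> norm (f v - f u) * M + M * norm (g v - g u)"
        using M \<open>u \<in> {a..b}\<close> \<open>v \<in> {a..b}\<close> by (intro add_mono mult_mono) auto
      finally show ?thesis using uv by (simp add: mult.commute)
    qed
    then have "(\<Sum>K\<in>D. norm (f (Sup K) * g (Sup K) - f (Inf K) * g (Inf K)))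
       \<le> M * (\<Sum>K\<in>D. norm (f (Sup K) - f (Inf K))) + M * (\<Sum>K\<in>D. norm (g (Sup K) - g (Inf K)))"
      unfolding sum_distrib_left sum.distrib[symmetric] by (intro sum_mono)
    also have "\<dots> < M * (e / (2 * M)) + M * (e / (2 * M))"
      using d1(2)[OF D(1,2)] d2(2)[OF D(1,2)] D(3) M(1) by (intro add_strict_mono mult_strict_left_mono) auto
    also have "\<dots> = e" using M(1) by simp
    finally show "(\<Sum>K\<in>D. norm (f (Sup K) * g (Sup K) - f (Inf K) * g (Inf K))) < e" .
  qed
qed

lemma lipschitz_imp_abs_cont:
  assumes M: "\<And>x y. x \<in> {a..b} \<Longrightarrow> y \<in> {a..b} \<Longrightarrow> norm (f y - f x) \<le> M * \<bar>y - x\<bar>"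
  shows "abs_cont a b f"
  unfolding abs_cont_def
proof (intro allI impI)
  fix e :: real assume e: "0 < e"
  \<comment> \<open>The given \<open>M\<close> is not assumed positive, and \<open>e\<close> is
    divided by the constant.\<close>
  define M' where "M' = \<bar>M\<bar> + 1"
  have M': "0 < M'" by (simp add: M'_def)
  show "\<exists>\<delta>>0. \<forall>\<D>. \<D> division_of \<Union>\<D> \<longrightarrow> \<Union>\<D> \<subseteq> {a..b} \<longrightarrow> (\<Sum>K\<in>\<D>. Sup K - Inf K) < \<delta>
        \<longrightarrow> (\<Sum>K\<in>\<D>. norm (f (Sup K) - f (Inf K))) < e"
  proof (intro exI[of _ "e / M'"] conjI allI impI)
    show "0 < e / M'" using e M' by simp
    fix D assume D: "D division_of \<Union>D" "\<Union>D \<subseteq> {a..b}" "(\<Sum>K\<in>D. Sup K - Inf K) < e / M'"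
    have "norm (f (Sup K) - f (Inf K)) \<le> M' * (Sup K - Inf K)" if K: "K \<in> D" for K
    proof -
      obtain u v where uv: "u \<le> v" "K = {u..v}" using division_interval_cases[OF D(1) K] by blast
      have "K \<subseteq> {a..b}" using K D(2) by blast
      then have *: "u \<in> {a..b}" "v \<in> {a..b}" using uv by auto
      have "norm (f v - f u) \<le> M * (v - u)" using M[OF *] uv by simp
      also have "\<dots> \<le> M' * (v - u)" using uv by (intro mult_right_mono) (auto simp: M'_def)
      finally show ?thesis using uv by simp
    qed
    then have "(\<Sum>K\<in>D. norm (f (Sup K) - f (Inf K))) \<le> M' * (\<Sum>K\<in>D. Sup K - Inf K)"
      unfolding sum_distrib_left by (intro sum_mono)
    also have "\<dots> < e" using D(3) M' by (simp add: field_simps)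
    finally show "(\<Sum>K\<in>D. norm (f (Sup K) - f (Inf K))) < e" .
  qed
qed

lemma loc_abs_cont_iff: "loc_abs_cont f \<longleftrightarrow> (\<forall>a b. abs_cont a b f)"
  by (simp add: loc_abs_cont_def abs_cont_on_eq)

lemma loc_abs_cont_continuous:
  assumes "loc_abs_cont f"
  shows "continuous_on S f"
proof -
  have "continuous (at x) f" for x
  proof -
    have "continuous_on {x - 1<..<x + 1} f"
      using abs_cont_continuous_on[of "x - 1" "x + 1" f] assms
      by (auto simp: loc_abs_cont_iff intro: continuous_on_subset)
    then show ?thesis by (subst (asm) continuous_on_eq_continuous_at) auto
  qed
  then show ?thesis by (simp add: continuous_at_imp_continuous_on)
qed

lemma loc_abs_cont_add: "loc_abs_cont f \<Longrightarrow> loc_abs_cont g \<Longrightarrow> loc_abs_cont (\<lambda>x. f x + g x)"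
  by (simp add: loc_abs_cont_iff abs_cont_add)

lemma loc_abs_cont_mult: "loc_abs_cont f \<Longrightarrow> loc_abs_cont g \<Longrightarrow> loc_abs_cont (\<lambda>x. f x * g x)"
  by (simp add: loc_abs_cont_iff abs_cont_mult)

lemma loc_abs_cont_cnj: "loc_abs_cont f \<Longrightarrow> loc_abs_cont (\<lambda>x. cnj (f x))"
  by (simp add: loc_abs_cont_iff abs_cont_bounded_linear bounded_linear_cnj)

lemma loc_abs_cont_cmult: "loc_abs_cont f \<Longrightarrow> loc_abs_cont (\<lambda>x. c * f x)"
  by (simp add: loc_abs_cont_iff abs_cont_bounded_linear bounded_linear_mult_right)

lemma C1_imp_loc_abs_cont:
  assumes f: "\<And>x. (f has_vector_derivative f' x) (at x)" and c: "continuous_on UNIV f'"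
  shows "loc_abs_cont f"
  unfolding loc_abs_cont_iff
proof (intro allI)
  fix a b :: real
  have "bounded (f' ` {a..b})"
    using c by (intro compact_imp_bounded compact_continuous_image) (auto intro: continuous_on_subset)
  then obtain M where M: "\<And>x. x \<in> {a..b} \<Longrightarrow> norm (f' x) \<le> M" unfolding bounded_iff by blast
  show "abs_cont a b f"
  proof (rule lipschitz_imp_abs_cont)
    fix x y assume xy: "x \<in> {a..b}" "y \<in> {a..b}"
    show "norm (f y - f x) \<le> M * \<bar>y - x\<bar>"
      unfolding real_norm_def[symmetric]
    proof (rule differentiable_bound[where f'="\<lambda>z h. h *\<^sub>R f' z" and S="{a..b}"])
      show "(f has_derivative (\<lambda>h. h *\<^sub>R f' z)) (at z within {a..b})" for z
        using f[of z] by (simp add: has_vector_derivative_def has_derivative_at_withinI)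
      show "onorm (\<lambda>h. h *\<^sub>R f' z) \<le> M" if "z \<in> {a..b}" for z
      proof (rule onorm_bound)
        show "0 \<le> M" using M[OF that] norm_ge_zero[of "f' z"] by linarith
        show "norm (h *\<^sub>R f' z) \<le> M * norm h" for h
          using mult_left_mono[OF M[OF that] abs_ge_zero[of h]] by (simp add: mult.commute)
      qed
    qed (use xy in auto)
  qed
qed

text \<open>\<open>Re\<close> and \<open>Im\<close> preserve absolute continuity, and two real
  derivatives make a complex one.\<close>

lemma loc_abs_cont_AE_vector_derivative:
  assumes "loc_abs_cont f"
  shows "AE x in lebesgue. (f has_vector_derivative D f x) (at x)"
proof -
  have "AE x in lebesgue. \<exists>l. ((\<lambda>x. Re (f x)) has_real_derivative l) (at x)"
    by (rule abs_cont_AE_differentiable_real)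
      (use assms in \<open>simp add: loc_abs_cont_iff abs_cont_bounded_linear bounded_linear_Re\<close>)
  moreover have "AE x in lebesgue. \<exists>l. ((\<lambda>x. Im (f x)) has_real_derivative l) (at x)"
    by (rule abs_cont_AE_differentiable_real)
      (use assms in \<open>simp add: loc_abs_cont_iff abs_cont_bounded_linear bounded_linear_Im\<close>)
  ultimately show ?thesis
  proof eventually_elim
    case (elim x)
    then obtain k l where "((\<lambda>x. Re (f x)) has_real_derivative k) (at x)" "((\<lambda>x. Im (f x)) has_real_derivative l) (at x)"
      by blast
    then have "(f has_vector_derivative Complex k l) (at x)"
      by (simp add: has_vector_derivative_complex_iff has_real_derivative_iff_has_vector_derivative)
    then show ?case unfolding D_def by (rule differentiableI_vector[THEN vector_derivative_works[THEN iffD1]])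
  qed
qed

text \<open>Off the exceptional null set the gauge is chosen pointwise so that each increment is
  close to derivative times length. Tags in the null set are confined to an open set of small
  measure, where absolute continuity bounds the sum of the increments.\<close>

lemma loc_abs_cont_has_integral:
  fixes f :: "real \<Rightarrow> complex"
  assumes f: "loc_abs_cont f" and "a \<le> b"
    and ae: "AE x in lebesgue. (f has_vector_derivative f' x) (at x)"
  shows "(f' has_integral f b - f a) {a..b}"
proof -
  define N where "N = {x. \<not> (f has_vector_derivative f' x) (at x)}"
  have N: "negligible N"
    using ae unfolding N_def negligible_iff_null_sets by (simp add: AE_iff_null_sets eventually_ae_filter) (meson completion.complete2)
  \<comment> \<open>With the value 0 on \<open>N\<close>, tags there leave only increments of f to
    be estimated; the change on a null set is undone at the end.\<close>
  define f0 where "f0 = (\<lambda>x. if x \<in> N then 0 else f' x)"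
  have "(f0 has_integral f b - f a) (cbox a b)"
    unfolding has_integral
  proof (intro allI impI)
    fix e :: real assume e: "0 < e"
    \<comment> \<open>Half of \<open>e\<close> is spent on tags off \<open>N\<close>; the 1 keeps
      the quotient defined when a = b.\<close>
    define e' where "e' = e / (2 * (b - a + 1))"
    have e': "0 < e'" using e \<open>a \<le> b\<close> by (simp add: e'_def)
    have "abs_cont a b f" using f by (simp add: loc_abs_cont_iff)
    then obtain d where d: "0 < d"
      "\<And>\<D>. \<D> division_of \<Union>\<D> \<Longrightarrow> \<Union>\<D> \<subseteq> {a..b} \<Longrightarrow> (\<Sum>K\<in>\<D>. Sup K - Inf K) < d
        \<Longrightarrow> (\<Sum>K\<in>\<D>. norm (f (Sup K) - f (Inf K))) < e / 2"
      by (rule abs_contD[of a b f "e / 2"]) (use e in auto)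
    obtain U where U: "open U" "N \<subseteq> U" "U \<in> lmeasurable" "measure lebesgue U < d"
    proof -
      have "N \<in> sets lebesgue" using N by (simp add: negligible_imp_sets)
      then obtain T where T: "open T" "N \<subseteq> T" "(T - N) \<in> lmeasurable" "emeasure lebesgue (T - N) < ennreal d"
        using sets_lebesgue_outer_open[of N d] d(1) by blast
      have "measure lebesgue (T - N) < d"
        using T d(1) by (subst (asm) emeasure_eq_measure2) (auto simp: ennreal_less_iff)
      moreover have "negligible (sym_diff (T - N) T)"
        by (rule negligible_subset[OF N]) blast
      then have "measure lebesgue T = measure lebesgue (T - N)"
        by (rule measure_negligible_symdiff[OF T(3)])
      ultimately have "measure lebesgue T < d" by simp
      moreover have "T - N \<union> N \<in> lmeasurable"
        by (rule fmeasurable.Un[OF T(3) negligible_imp_measurable[OF N]])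
      then have "T \<in> lmeasurable" using T(2) by (simp add: Un_absorb2)
      ultimately have "T \<in> lmeasurable" "measure lebesgue T < d" by simp_all
      then show ?thesis using that T by blast
    qed
    have "\<exists>r>0. \<forall>y. \<bar>y - x\<bar> < r \<longrightarrow> norm (f y - f x - (y - x) *\<^sub>R f' x) \<le> e' * \<bar>y - x\<bar>" if "x \<notin> N" for x
    proof -
      have "(f has_derivative (\<lambda>h. h *\<^sub>R f' x)) (at x)" using that by (simp add: N_def has_vector_derivative_def)
      then show ?thesis unfolding has_derivative_at_alt using e' by auto
    qed
    then obtain r where r: "\<And>x. x \<notin> N \<Longrightarrow> 0 < r x"
      "\<And>x y. x \<notin> N \<Longrightarrow> \<bar>y - x\<bar> < r x \<Longrightarrow> norm (f y - f x - (y - x) *\<^sub>R f' x) \<le> e' * \<bar>y - x\<bar>"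
      by metis
    define \<gamma> where "\<gamma> = (\<lambda>x. if x \<in> N then U else ball x (r x))"
    have g: "gauge \<gamma>" unfolding gauge_def \<gamma>_def using U r(1) by auto
    show "\<exists>\<gamma>. gauge \<gamma> \<and> (\<forall>\<D>. \<D> tagged_division_of cbox a b \<and> \<gamma> fine \<D> \<longrightarrow>
       norm ((\<Sum>(x, K)\<in>\<D>. Henstock_Kurzweil_Integration.content K *\<^sub>R f0 x) - (f b - f a)) < e)"
    proof (intro exI[of _ \<gamma>] conjI g allI impI)
      fix p assume p: "p tagged_division_of cbox a b \<and> \<gamma> fine p"
      then have p1: "p tagged_division_of {a..b}" by simp
      note fp = tagged_division_ofD(1)[OF p1]
      define p1 where "p1 = {(x,K) \<in> p. x \<in> N}"
      have pp: "p1 \<subseteq> p" by (auto simp: p1_def)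
      let ?T = "\<lambda>(x, K). Henstock_Kurzweil_Integration.content K *\<^sub>R f0 x - (f (Sup K) - f (Inf K))"
      have pK: "\<exists>u v. u \<le> v \<and> K = {u..v} \<and> x \<in> {u..v}" if xK: "(x,K) \<in> p" for x K
        using tagged_division_ofD(2,4)[OF p1 xK] by fastforce
      have "(\<Sum>(x, K)\<in>p. Henstock_Kurzweil_Integration.content K *\<^sub>R f0 x) - (f b - f a) = (\<Sum>z\<in>p. ?T z)"
        using additive_tagged_division_1[OF \<open>a \<le> b\<close> p1, of f] by (simp add: case_prod_unfold sum_subtractf)
      also have "\<dots> = (\<Sum>z\<in>p - p1. ?T z) + (\<Sum>z\<in>p1. ?T z)"
        by (rule sum.subset_diff[OF pp fp])
      also have "norm \<dots> \<le> norm (\<Sum>z\<in>p - p1. ?T z) + norm (\<Sum>z\<in>p1. ?T z)" by (rule norm_triangle_ineq)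
      also have "norm (\<Sum>z\<in>p - p1. ?T z) \<le> e / 2"
      proof -
        have "norm (\<Sum>z\<in>p - p1. ?T z) \<le> (\<Sum>z\<in>p - p1. e' * Henstock_Kurzweil_Integration.content (snd z))"
        proof (rule sum_norm_le)
          fix z assume z: "z \<in> p - p1"
          obtain x K where xK: "z = (x,K)" by fastforce
          then have "(x,K) \<in> p" "x \<notin> N" using z by (auto simp: p1_def)
          obtain u v where uv: "u \<le> v" "K = {u..v}" "x \<in> {u..v}" using pK[OF \<open>(x,K) \<in> p\<close>] by blast
          have "K \<subseteq> \<gamma> x" using p \<open>(x,K) \<in> p\<close> unfolding fine_def by blast
          then have "K \<subseteq> ball x (r x)" using \<open>x \<notin> N\<close> by (simp add: \<gamma>_def)
          moreover have "u \<in> K" "v \<in> K" using uv by auto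
          ultimately have "u \<in> ball x (r x)" "v \<in> ball x (r x)" by blast+
          then have "\<bar>u - x\<bar> < r x" "\<bar>v - x\<bar> < r x" by (auto simp: dist_real_def abs_minus_commute)
          then have "norm (f u - f x - (u - x) *\<^sub>R f' x) \<le> e' * (x - u)" "norm (f v - f x - (v - x) *\<^sub>R f' x) \<le> e' * (v - x)"
            using r(2)[OF \<open>x \<notin> N\<close>, of u] r(2)[OF \<open>x \<notin> N\<close>, of v] uv(3) by auto
          \<comment> \<open>The chord is split at the tag, which lies between the endpoints, so the
            two errors add up to \<open>e'\<close> times the length.\<close>
          moreover have "(v - u) *\<^sub>R f' x - (f v - f u) = (f u - f x - (u - x) *\<^sub>R f' x) - (f v - f x - (v - x) *\<^sub>R f' x)"
            by (simp add: algebra_simps)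
          moreover have "norm ((f u - f x - (u - x) *\<^sub>R f' x) - (f v - f x - (v - x) *\<^sub>R f' x))
             \<le> norm (f u - f x - (u - x) *\<^sub>R f' x) + norm (f v - f x - (v - x) *\<^sub>R f' x)" by (rule norm_triangle_ineq4)
          ultimately have "norm ((v - u) *\<^sub>R f' x - (f v - f u)) \<le> e' * (v - u)"
            by (simp add: algebra_simps)
          then show "norm (?T z) \<le> e' * Henstock_Kurzweil_Integration.content (snd z)"
            using uv \<open>x \<notin> N\<close> by (simp add: xK f0_def)
        qed
        also have "\<dots> \<le> (\<Sum>z\<in>p. e' * Henstock_Kurzweil_Integration.content (snd z))"
          using fp e' by (intro sum_mono2) auto
        also have "\<dots> = e' * (b - a)"
          using additive_content_tagged_division[of p a b] p \<open>a \<le> b\<close>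
          by (simp add: case_prod_unfold flip: sum_distrib_left)
        also have "\<dots> \<le> e / 2" using e \<open>a \<le> b\<close> by (simp add: e'_def field_simps)
        finally show ?thesis .
      qed
      also have "norm (\<Sum>z\<in>p1. ?T z) < e / 2"
      proof -
        have td: "p1 tagged_partial_division_of {a..b}"
          using tagged_partial_division_subset[OF _ pp] p1 by (auto simp: tagged_division_of_def)
        have dv: "snd ` p1 division_of \<Union>(snd ` p1)"
          by (rule partial_division_of_tagged_division[OF td])
        have "norm (\<Sum>z\<in>p1. ?T z) \<le> (\<Sum>z\<in>p1. norm (f (Sup (snd z)) - f (Inf (snd z))))"
          by (rule sum_norm_le) (auto simp: p1_def f0_def norm_minus_commute)
        also have "\<dots> = (\<Sum>(x,K)\<in>p1. if K = {} then 0 else norm (f (Sup K) - f (Inf K)))"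
        proof (rule sum.cong[OF refl])
          fix z assume "z \<in> p1"
          then obtain u v where "u \<le> v" "snd z = {u..v}" using pK[of "fst z" "snd z"] pp by auto
          then show "norm (f (Sup (snd z)) - f (Inf (snd z))) =
              (case z of (x, K) \<Rightarrow> if K = {} then 0 else norm (f (Sup K) - f (Inf K)))"
            by (simp add: case_prod_unfold)
        qed
        \<comment> \<open>Distinct tags can share only a degenerate interval, where the summand is
          0, so passing from tagged pairs to intervals changes nothing.\<close>
        also have "\<dots> = (\<Sum>K\<in>snd ` p1. if K = {} then 0 else norm (f (Sup K) - f (Inf K)))"
        proof (rule sum.over_tagged_division_lemma[OF tagged_partial_division_of_Union_self[OF td]])
          fix u v :: real assume "box u v = {}"
          then have "v \<le> u" by simp
          then show "(if cbox u v = {} then 0 else norm (f (Sup (cbox u v)) - f (Inf (cbox u v)))) = 0"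
            by (cases "u = v") auto
        qed
        also have "\<dots> = (\<Sum>K\<in>snd ` p1. norm (f (Sup K) - f (Inf K)))"
          using division_ofD(3)[OF dv] by (intro sum.cong) auto
        also have "\<dots> < e / 2"
        proof (rule d(2)[OF dv])
          show "\<Union>(snd ` p1) \<subseteq> {a..b}" using td unfolding tagged_partial_division_of_def by fastforce
          have "K \<subseteq> U" if "(x, K) \<in> p" "x \<in> N" for x K
          proof -
            have "K \<subseteq> \<gamma> x" using p that(1) unfolding fine_def by blast
            then show ?thesis using that(2) by (simp add: \<gamma>_def)
          qed
          then have "\<Union>(snd ` p1) \<subseteq> U" unfolding p1_def by fastforce
          then have "measure lebesgue (\<Union>(snd ` p1)) \<le> measure lebesgue U"
            using U(3) lmeasurable_division[OF dv] by (intro measure_mono_fmeasurable) auto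
          then show "(\<Sum>K\<in>snd ` p1. Sup K - Inf K) < d"
            using U(4) measure_division[OF dv] by simp
        qed
        finally show ?thesis .
      qed
      finally show "norm ((\<Sum>(x, K)\<in>p. Henstock_Kurzweil_Integration.content K *\<^sub>R f0 x) - (f b - f a)) < e" by simp
    qed
  qed
  then have "(f0 has_integral f b - f a) {a..b}" by simp
  then show ?thesis
    by (rule has_integral_spike[OF N, rotated]) (simp add: f0_def)
qed

section \<open>Integration by parts on the line\<close>

text \<open>Comparison with the logarithm, the unbounded primitive of 1 / (1 + x).\<close>

lemma not_integrable_above_inverse:
  fixes H :: "real \<Rightarrow> real"
  assumes H: "integrable lebesgue H" and "0 < c" and le: "\<And>x. M \<le> x \<Longrightarrow> c / (1 + \<bar>x\<bar>) \<le> H x"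
  shows False
proof -
  \<comment> \<open>Starting at a nonnegative point removes the absolute value from the comparison
    function.\<close>
  define m where "m = max M 0"
  have m: "0 \<le> m" "M \<le> m" by (auto simp: m_def)
  have HI: "(\<lambda>x. norm (H x)) integrable_on UNIV"
    using integrable_norm[OF H] integrable_on_lebesgue by blast
  define I where "I = integral UNIV (\<lambda>x. norm (H x))"
  have bd: "c * (ln (1 + y) - ln (1 + m)) \<le> I" if y: "m \<le> y" for y
  proof -
    have "((\<lambda>x. c / (1 + x)) has_integral c * ln (1 + y) - c * ln (1 + m)) {m..y}"
      by (rule fundamental_theorem_of_calculus[OF y])
        (use m in \<open>auto intro!: derivative_eq_intros simp flip: has_real_derivative_iff_has_vector_derivative\<close>)
    moreover have "((\<lambda>x. norm (H x)) has_integral integral {m..y} (\<lambda>x. norm (H x))) {m..y}"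
      using integrable_on_subinterval[OF HI] by (simp add: integrable_integral)
    moreover have "c / (1 + x) \<le> norm (H x)" if "x \<in> {m..y}" for x
      using le[of x] that m by auto
    ultimately have "c * ln (1 + y) - c * ln (1 + m) \<le> integral {m..y} (\<lambda>x. norm (H x))"
      by (rule has_integral_le)
    also have "\<dots> \<le> I"
      unfolding I_def using HI integrable_on_subinterval[OF HI] by (intro integral_subset_le) auto
    finally show ?thesis by (simp add: right_diff_distrib)
  qed
  have "LIM y at_top. c * (ln (1 + y) - ln (1 + m)) :> at_top"
    using \<open>0 < c\<close> by real_asymp
  then have "\<forall>\<^sub>F y in at_top. I < c * (ln (1 + y) - ln (1 + m))" by (simp add: filterlim_at_top_dense)
  moreover have "\<forall>\<^sub>F y in at_top. m \<le> y" by (rule eventually_ge_at_top)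
  ultimately have "\<forall>\<^sub>F y :: real in at_top. False"
    by eventually_elim (use bd in force)
  then show False by simp
qed

text \<open>A nonzero limit of the boundary terms would contradict the integrability of
  \<open>G(\<omega>) / (1 + |\<omega>|)\<close>.\<close>

lemma boundary_terms_vanish:
  fixes G F :: "real \<Rightarrow> complex"
  assumes F: "integrable lebesgue F"
    and G: "integrable lebesgue (\<lambda>x. G x / of_real (1 + \<bar>x\<bar>))"
    and FT: "\<And>R. 0 < R \<Longrightarrow> (F has_integral K R) {-R..R}"
    and K: "\<And>R. 0 < R \<Longrightarrow> norm (K R) \<le> norm (G R) + norm (G (- R))"
  shows "(LINT x|lebesgue. F x) = 0"
proof (rule ccontr)
  define I where "I = (LINT x|lebesgue. F x)"
  assume "(LINT x|lebesgue. F x) \<noteq> 0"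
  then have I: "I \<noteq> 0" by (simp add: I_def)
  have "(F has_integral I) UNIV" unfolding I_def by (rule has_integral_integral_lebesgue[OF F])
  \<comment> \<open>The integrals over [-R, R] tend to \<open>I\<close>, so their modulus stays
    above half of that of \<open>I\<close> once \<open>R\<close> is at least
    \<open>B\<close>.\<close>
  then obtain B where B: "B > 0" "\<forall>a b. ball 0 B \<subseteq> cbox a b \<longrightarrow>
      (\<exists>z. ((\<lambda>x. if x \<in> UNIV then F x else 0) has_integral z) (cbox a b) \<and> norm (z - I) < norm I / 2)"
    by (rule has_integral_altD[where e="norm I / 2"]) (use I in auto)
  \<comment> \<open>Both ends are folded onto positive R, since only the sum of the two boundary
    values is bounded below.\<close>
  define H where "H = (\<lambda>x. norm (G x / of_real (1 + \<bar>x\<bar>)) + norm (G (- x) / of_real (1 + \<bar>x\<bar>)))"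
  have G': "integrable lebesgue (\<lambda>x. G (- x) / of_real (1 + \<bar>x\<bar>))"
    using lebesgue_integrable_real_affine[OF G, of "- 1" 0] by simp
  have "integrable lebesgue H"
    unfolding H_def by (intro Bochner_Integration.integrable_add integrable_norm G G')
  moreover have "(norm I / 2) / (1 + \<bar>R\<bar>) \<le> H R" if R: "B \<le> R" for R
  proof -
    have "0 < R" using B R by simp
    have "ball 0 B \<subseteq> cbox (- R) R" using R by (auto simp: dist_real_def)
    then obtain z where z: "(F has_integral z) {- R..R}" "norm (z - I) < norm I / 2"
      using B(2)[rule_format, of "- R" R] by auto
    have "z = K R" using has_integral_unique[OF z(1) FT[OF \<open>0 < R\<close>]] .
    have "norm I \<le> norm z + norm (z - I)"
      using norm_triangle_ineq[of z "I - z"] by (simp add: norm_minus_commute)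
    then have "norm I / 2 \<le> norm (G R) + norm (G (- R))"
      using z(2) K[OF \<open>0 < R\<close>] \<open>z = K R\<close> by simp
    then have "(norm I / 2) / (1 + \<bar>R\<bar>) \<le> (norm (G R) + norm (G (- R))) / (1 + \<bar>R\<bar>)"
      by (rule divide_right_mono) simp
    also have "\<dots> = H R"
    proof -
      have "norm (complex_of_real (1 + \<bar>R\<bar>)) = 1 + \<bar>R\<bar>" by (simp only: norm_of_real)
      then show ?thesis by (simp only: H_def norm_divide add_divide_distrib)
    qed
    finally show ?thesis .
  qed
  ultimately show False
    using not_integrable_above_inverse[of H "norm I / 2" B] I by simp
qed

lemma integral_derivative_eq_0:
  assumes G: "loc_abs_cont G" "AE x in lebesgue. (G has_vector_derivative G' x) (at x)"
    and int: "integrable lebesgue G'" "integrable lebesgue (\<lambda>x. G x / of_real (1 + \<bar>x\<bar>))"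
  shows "(LINT x|lebesgue. G' x) = 0"
proof (rule boundary_terms_vanish[OF int])
  show "(G' has_integral G R - G (- R)) {- R..R}" if "0 < R" for R
    using loc_abs_cont_has_integral[OF G(1) _ G(2), of "- R" R] that by simp
qed (rule norm_triangle_ineq4)

text \<open>The two half lines contribute G R + G (-R) - 2 G 0: at the jump of sgn the values at 0
  add up instead of cancelling, hence the condition at 0.\<close>

lemma integral_sgn_derivative_eq_0:
  assumes G: "loc_abs_cont G" "AE x in lebesgue. (G has_vector_derivative G' x) (at x)" "G 0 = 0"
    and int: "integrable lebesgue (\<lambda>x. of_real (sgn x) * G' x)" "integrable lebesgue (\<lambda>x. G x / of_real (1 + \<bar>x\<bar>))"
  shows "(LINT x|lebesgue. of_real (sgn x) * G' x) = 0"
proof (rule boundary_terms_vanish[OF int])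
  fix R :: real assume R: "0 < R"
  have "((\<lambda>x. - G' x) has_integral - (G 0 - G (- R))) {- R..0}"
    using loc_abs_cont_has_integral[OF G(1) _ G(2), of "- R" 0] R by (intro has_integral_neg) simp
  then have 1: "((\<lambda>x. of_real (sgn x) * G' x) has_integral - (G 0 - G (- R))) {- R..0}"
    by (rule has_integral_spike[of "{0}", rotated 2]) auto
  have "(G' has_integral G R - G 0) {0..R}"
    using loc_abs_cont_has_integral[OF G(1) _ G(2), of 0 R] R by simp
  then have 2: "((\<lambda>x. of_real (sgn x) * G' x) has_integral G R - G 0) {0..R}"
    by (rule has_integral_spike[of "{0}", rotated 2]) auto
  show "((\<lambda>x. of_real (sgn x) * G' x) has_integral - (G 0 - G (- R)) + (G R - G 0)) {- R..R}"
    by (rule has_integral_combine[OF _ _ 1 2]) (use R in auto)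
  show "norm (- (G 0 - G (- R)) + (G R - G 0)) \<le> norm (G R) + norm (G (- R))"
    using norm_triangle_ineq[of "G R" "G (- R)"] by (simp add: G(3) add.commute)
qed

section \<open>Calculus in \<open>L\<^sup>2\<close>\<close>

lemma L2_measurable [measurable_dest]: "f \<in> L2 M \<Longrightarrow> f \<in> borel_measurable M"
  by (simp add: L2_def)

lemma borel_measurable_cnj [measurable]:
  "f \<in> borel_measurable M \<Longrightarrow> (\<lambda>x. cnj (f x)) \<in> borel_measurable M"
  by (rule measurable_compose[OF _ borel_measurable_continuous_onI]) (auto intro: continuous_intros)

lemma L2_dominated:
  assumes "g \<in> L2 M" "f \<in> borel_measurable M" "AE x in M. cmod (f x) \<le> cmod (g x)"
  shows "f \<in> L2 M"
proof -
  have "integrable M (\<lambda>x. (cmod (f x))\<^sup>2)"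
  proof (rule Bochner_Integration.integrable_bound[of M "\<lambda>x. (cmod (g x))\<^sup>2"])
    show "AE x in M. norm ((cmod (f x))\<^sup>2) \<le> norm ((cmod (g x))\<^sup>2)"
      using assms(3) by eventually_elim (simp add: power_mono)
  qed (use assms in \<open>auto simp: L2_def\<close>)
  then show ?thesis using assms by (simp add: L2_def)
qed

lemma L2_cong_AE:
  assumes "g \<in> L2 M" "f \<in> borel_measurable M" "AE x in M. f x = g x"
  shows "f \<in> L2 M"
  by (rule L2_dominated[OF assms(1,2)]) (use assms(3) in eventually_elim, simp)

lemma L2_cmult: "f \<in> L2 M \<Longrightarrow> (\<lambda>x. c * f x) \<in> L2 M"
  by (auto simp: L2_def norm_mult power_mult_distrib)

lemma L2_add:
  assumes "f \<in> L2 M" "g \<in> L2 M"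
  shows "(\<lambda>x. f x + g x) \<in> L2 M"
proof -
  have "integrable M (\<lambda>x. (cmod (f x + g x))\<^sup>2)"
  proof (rule Bochner_Integration.integrable_bound[of M "\<lambda>x. 2 * (cmod (f x))\<^sup>2 + 2 * (cmod (g x))\<^sup>2"])
    show "AE x in M. norm ((cmod (f x + g x))\<^sup>2) \<le> norm (2 * (cmod (f x))\<^sup>2 + 2 * (cmod (g x))\<^sup>2)"
    proof (rule AE_I2)
      fix x
      have "(cmod (f x + g x))\<^sup>2 \<le> (cmod (f x) + cmod (g x))\<^sup>2"
        by (intro power_mono norm_triangle_ineq norm_ge_zero)
      also have "\<dots> \<le> 2 * (cmod (f x))\<^sup>2 + 2 * (cmod (g x))\<^sup>2"
        using sum_squares_bound[of "cmod (f x)" "cmod (g x)"] by (simp add: power2_sum)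
      finally show "norm ((cmod (f x + g x))\<^sup>2) \<le> norm (2 * (cmod (f x))\<^sup>2 + 2 * (cmod (g x))\<^sup>2)" by simp
    qed
  qed (use assms in \<open>auto simp: L2_def\<close>)
  moreover have "(\<lambda>x. f x + g x) \<in> borel_measurable M" using assms by measurable
  ultimately show ?thesis by (simp add: L2_def)
qed

lemma L2_diff: "f \<in> L2 M \<Longrightarrow> g \<in> L2 M \<Longrightarrow> (\<lambda>x. f x - g x) \<in> L2 M"
  using L2_add[of f M "\<lambda>x. - 1 * g x"] L2_cmult[of g M "- 1"] by simp

lemma L2_divide: "f \<in> L2 M \<Longrightarrow> (\<lambda>x. f x / c) \<in> L2 M"
  using L2_cmult[of f M "1 / c"] by simp

lemma L2_mult_integrable:
  assumes "f \<in> L2 M" "g \<in> L2 M"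
  shows "integrable M (\<lambda>x. f x * g x)"
proof (rule Bochner_Integration.integrable_bound[of M "\<lambda>x. (cmod (f x))\<^sup>2 + (cmod (g x))\<^sup>2"])
  show "AE x in M. norm (f x * g x) \<le> norm ((cmod (f x))\<^sup>2 + (cmod (g x))\<^sup>2)"
  proof (rule AE_I2)
    fix x
    have "cmod (f x) * cmod (g x) \<le> (cmod (f x))\<^sup>2 + (cmod (g x))\<^sup>2"
    proof -
      have "0 \<le> cmod (f x) * cmod (g x)" by simp
      then show ?thesis using sum_squares_bound[of "cmod (f x)" "cmod (g x)"] by linarith
    qed
    then show "norm (f x * g x) \<le> norm ((cmod (f x))\<^sup>2 + (cmod (g x))\<^sup>2)" by (simp add: norm_mult)
  qed
qed (use assms in \<open>auto simp: L2_def intro: borel_measurable_times\<close>)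

lemma L2_cnj: "f \<in> L2 M \<Longrightarrow> (\<lambda>x. cnj (f x)) \<in> L2 M"
  by (auto simp: L2_def)

lemma ip_integrable: "f \<in> L2 M \<Longrightarrow> g \<in> L2 M \<Longrightarrow> integrable M (\<lambda>x. f x * cnj (g x))"
  by (rule L2_mult_integrable[OF _ L2_cnj])

lemma ip_add_left: "f \<in> L2 M \<Longrightarrow> g \<in> L2 M \<Longrightarrow> h \<in> L2 M \<Longrightarrow> ip M (\<lambda>x. f x + g x) h = ip M f h + ip M g h"
  by (simp add: ip_def distrib_right ip_integrable)

lemma ip_diff_left: "f \<in> L2 M \<Longrightarrow> g \<in> L2 M \<Longrightarrow> h \<in> L2 M \<Longrightarrow> ip M (\<lambda>x. f x - g x) h = ip M f h - ip M g h"
  by (simp add: ip_def left_diff_distrib ip_integrable)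

lemma ip_cmult_left: "ip M (\<lambda>x. c * f x) h = c * ip M f h"
  by (simp add: ip_def mult.assoc)

lemma ip_commute: "ip M g f = cnj (ip M f g)"
  unfolding ip_def by (subst Bochner_Integration.integral_cnj[symmetric]) (simp add: mult.commute)

lemma ip_add_right: "f \<in> L2 M \<Longrightarrow> g \<in> L2 M \<Longrightarrow> h \<in> L2 M \<Longrightarrow> ip M h (\<lambda>x. f x + g x) = ip M h f + ip M h g"
  by (simp add: ip_def distrib_left ip_integrable)

lemma ip_diff_right: "f \<in> L2 M \<Longrightarrow> g \<in> L2 M \<Longrightarrow> h \<in> L2 M \<Longrightarrow> ip M h (\<lambda>x. f x - g x) = ip M h f - ip M h g"
  by (simp add: ip_def right_diff_distrib ip_integrable)

lemma ip_cmult_right: "ip M h (\<lambda>x. c * f x) = cnj c * ip M h f"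
  by (simp add: ip_def mult.left_commute)

lemma ip_cong_AE:
  assumes "f \<in> borel_measurable M" "f' \<in> borel_measurable M" "g \<in> borel_measurable M" "g' \<in> borel_measurable M"
    "AE x in M. f x = f' x" "AE x in M. g x = g' x"
  shows "ip M f g = ip M f' g'"
  unfolding ip_def using assms(1-4)
  by (intro integral_cong_AE) (use assms(5,6) in \<open>auto\<close>)

lemma ip_self: "ip M f f = of_real (LINT x|M. (cmod (f x))\<^sup>2)"
  by (simp add: ip_def complex_norm_square[symmetric] flip: integral_complex_of_real)

lemma nrm_square: "(nrm M f)\<^sup>2 = Re (ip M f f)"
  by (simp add: nrm_def ip_self)

lemma ip_self_nrm: "ip M f f = of_real ((nrm M f)\<^sup>2)"
  by (simp add: nrm_square ip_self)

lemma nrm_nonneg: "0 \<le> nrm M f"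
  by (simp add: nrm_def ip_self)

lemma nrm_pos_iff:
  assumes "f \<in> L2 M"
  shows "0 < nrm M f \<longleftrightarrow> \<not> (AE x in M. f x = 0)"
proof -
  have "integrable M (\<lambda>x. (cmod (f x))\<^sup>2)" using assms by (simp add: L2_def)
  then have "(LINT x|M. (cmod (f x))\<^sup>2) = 0 \<longleftrightarrow> (AE x in M. f x = 0)"
    by (subst integral_nonneg_eq_0_iff_AE) auto
  moreover have "0 \<le> (LINT x|M. (cmod (f x))\<^sup>2)" by simp
  ultimately show ?thesis by (auto simp: nrm_def ip_self less_le)
qed

text \<open>The operator is required to commute with normalisation only almost everywhere, because
  \<open>D\<close> has arbitrary values where the function is not differentiable.\<close>

lemma expval_unit:
  assumes "T f \<in> L2 M" "T (unit M f) \<in> borel_measurable M" "f \<in> L2 M"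
    and "AE x in M. T (unit M f) x = T f x / of_real (nrm M f)"
  shows "expval M T (unit M f) = ip M (T f) f / of_real ((nrm M f)\<^sup>2)"
proof -
  have "expval M T (unit M f) = ip M (\<lambda>x. T f x / of_real (nrm M f)) (\<lambda>x. f x / of_real (nrm M f))"
    unfolding expval_def unit_def[of M f, symmetric] using assms
    by (intro ip_cong_AE) (auto simp: unit_def)
  also have "\<dots> = ip M (T f) f / of_real ((nrm M f)\<^sup>2)"
    using ip_cmult_left[of M "1 / of_real (nrm M f)" "T f" "\<lambda>x. (1 / of_real (nrm M f)) * f x"]
      ip_cmult_right[of M "T f" "1 / of_real (nrm M f)" f] by (simp add: power2_eq_square)
  finally show ?thesis .
qed

text \<open>With e the normalised expectation, the two mixed terms and the quadratic term of the
  expanded square agree up to sign, so one copy survives. The modulus keeps the formula valid for a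
  complex expectation.\<close>

lemma var_unit:
  assumes T: "T f \<in> L2 M" "T (unit M f) \<in> borel_measurable M" and f: "f \<in> L2 M" "0 < nrm M f"
    and ae: "AE x in M. T (unit M f) x = T f x / of_real (nrm M f)"
  shows "var M T (unit M f) = (nrm M (T f))\<^sup>2 / (nrm M f)\<^sup>2 - (cmod (ip M (T f) f))\<^sup>2 / ((nrm M f)\<^sup>2)\<^sup>2"
proof -
  define n where "n = nrm M f"
  define E where "E = ip M (T f) f"
  define e where "e = E / of_real (n\<^sup>2)"
  have n: "n > 0" using f by (simp add: n_def)
  have e: "expval M T (unit M f) = e" unfolding e_def E_def n_def by (rule expval_unit[OF T f(1) ae])
  define g where "g = (\<lambda>x. (1 / of_real n) * (T f x - e * f x))"
  have gL: "g \<in> L2 M" unfolding g_def by (intro L2_cmult L2_diff T f)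
  have "var M T (unit M f) = Re (ip M (\<lambda>x. T (unit M f) x - e * unit M f x) (\<lambda>x. T (unit M f) x - e * unit M f x))"
    by (simp add: var_def nrm_square e)
  also have "\<dots> = Re (ip M g g)"
  proof -
    have "AE x in M. T (unit M f) x - e * unit M f x = g x"
      using ae by eventually_elim (simp add: g_def unit_def n_def diff_divide_distrib)
    moreover have "(\<lambda>x. T (unit M f) x - e * unit M f x) \<in> borel_measurable M"
      using T f by (auto simp: unit_def)
    ultimately have "ip M (\<lambda>x. T (unit M f) x - e * unit M f x) (\<lambda>x. T (unit M f) x - e * unit M f x) = ip M g g"
      using gL by (intro ip_cong_AE) auto
    then show ?thesis by simp
  qed
  also have "ip M g g = (1 / of_real n) * (1 / of_real n) * ip M (\<lambda>x. T f x - e * f x) (\<lambda>x. T f x - e * f x)"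
    by (simp add: g_def ip_cmult_left ip_cmult_right del: times_divide_eq_left)
  also have "ip M (\<lambda>x. T f x - e * f x) (\<lambda>x. T f x - e * f x)
     = ip M (T f) (T f) - cnj e * E - e * cnj E + e * cnj e * ip M f f"
    using T f L2_cmult[OF f(1), of e] L2_diff[OF T(1) L2_cmult[OF f(1), of e]]
    by (simp add: ip_diff_left ip_diff_right ip_cmult_left ip_cmult_right E_def ip_commute[of M f "T f"] algebra_simps)
  also have "\<dots> = of_real ((nrm M (T f))\<^sup>2 - (cmod E)\<^sup>2 / n\<^sup>2)"
  proof -
    have "E * cnj E = of_real ((cmod E)\<^sup>2)" by (simp only: complex_norm_square)
    moreover have "ip M f f = of_real (n\<^sup>2)" "ip M (T f) (T f) = of_real ((nrm M (T f))\<^sup>2)" by (simp_all add: ip_self_nrm n_def)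
    moreover have "cnj e * E = E * cnj E / of_real (n\<^sup>2)" "e * cnj E = E * cnj E / of_real (n\<^sup>2)"
      "e * cnj e * of_real (n\<^sup>2) = E * cnj E / of_real (n\<^sup>2)"
      using n by (simp_all add: e_def power2_eq_square)
    ultimately show ?thesis by simp
  qed
  finally have "var M T (unit M f) = ((nrm M (T f))\<^sup>2 - (cmod E)\<^sup>2 / n\<^sup>2) / n\<^sup>2"
    by (simp add: power2_eq_square flip: of_real_divide of_real_mult)
  then show ?thesis using n by (simp add: E_def n_def diff_divide_distrib power2_eq_square)
qed

lemma ip_line:
  assumes "f \<in> L2 M" "h \<in> L2 M" "a \<in> L2 M" "b \<in> L2 M"
  shows "ip M (\<lambda>x. a x + of_real t * b x) (\<lambda>x. f x + of_real t * h x)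
     = ip M a f + of_real t * (ip M a h + ip M b f) + of_real (t\<^sup>2) * ip M b h"
  using assms L2_cmult[of h M "of_real t"] L2_cmult[of b M "of_real t"] L2_add[OF assms(3) L2_cmult[OF assms(4), of "of_real t"]]
    L2_add[OF assms(1) L2_cmult[OF assms(2), of "of_real t"]]
  by (simp add: ip_add_left ip_add_right ip_cmult_left ip_cmult_right algebra_simps power2_eq_square)

lemma nrm_square_line:
  assumes "f \<in> L2 M" "h \<in> L2 M"
  shows "(nrm M (\<lambda>x. f x + of_real t * h x))\<^sup>2 = (nrm M f)\<^sup>2 + 2 * t * Re (ip M f h) + t\<^sup>2 * (nrm M h)\<^sup>2"
proof -
  have "(nrm M (\<lambda>x. f x + of_real t * h x))\<^sup>2
    = Re (ip M f f + of_real t * (ip M f h + ip M h f) + of_real (t\<^sup>2) * ip M h h)"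
    unfolding nrm_square ip_line[OF assms assms] ..
  also have "\<dots> = (nrm M f)\<^sup>2 + 2 * t * Re (ip M f h) + t\<^sup>2 * (nrm M h)\<^sup>2"
    by (simp add: ip_commute[of M h f] nrm_square flip: of_real_power)
  finally show ?thesis .
qed

lemma nrm_square_line_deriv:
  assumes "f \<in> L2 M" "h \<in> L2 M"
  shows "((\<lambda>t. (nrm M (\<lambda>x. f x + of_real t * h x))\<^sup>2) has_real_derivative 2 * Re (ip M f h)) (at 0)"
  unfolding nrm_square_line[OF assms] by (auto intro!: derivative_eq_intros)

text \<open>\<open>A\<close> stands for T applied twice to f, but enters only through its inner
  product with h. Squared norms and the expectation are quadratic polynomials in t, so the quotient
  rule gives the derivative, which is then matched with the claimed inner product.\<close>

lemma var_unit_line_deriv: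
  assumes f: "f \<in> L2 M" "0 < nrm M f" and h: "h \<in> L2 M" and T: "T f \<in> L2 M" "T h \<in> L2 M"
    and Tm: "\<And>t. T (unit M (\<lambda>x. f x + of_real t * h x)) \<in> borel_measurable M"
    and lin: "\<And>t. AE x in M. T (\<lambda>x. f x + of_real t * h x) x = T f x + of_real t * T h x"
      "\<And>t. T (\<lambda>x. f x + of_real t * h x) \<in> L2 M"
      "\<And>t. AE x in M. T (unit M (\<lambda>x. f x + of_real t * h x)) x
          = T (\<lambda>x. f x + of_real t * h x) x / of_real (nrm M (\<lambda>x. f x + of_real t * h x))"
    and sym: "ip M (T h) f = ip M h (T f)" "Im (ip M (T f) f) = 0"
    and A: "A \<in> L2 M" "ip M (T f) (T h) = ip M A h"
  defines "e \<equiv> expval M T (unit M f)" and "v \<equiv> var M T (unit M f)"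
  shows "((\<lambda>t. var M T (unit M (\<lambda>x. f x + of_real t * h x))) has_real_derivative
    Re (ip M (\<lambda>x. 2 * (A x - 2 * e * T f x + e\<^sup>2 * f x - of_real v * f x) / of_real ((nrm M f)\<^sup>2)) h)) (at 0)"
proof -
  define ft where "ft = (\<lambda>t::real. \<lambda>x. f x + of_real t * h x)"
  have f0: "f = ft 0" by (simp add: ft_def)
  have ftL: "ft t \<in> L2 M" for t unfolding ft_def by (intro L2_add f L2_cmult h)
  define N where "N = (nrm M f)\<^sup>2"
  define Q where "Q = (nrm M (T f))\<^sup>2"
  define E where "E = Re (ip M (T f) f)"
  define n1 where "n1 = Re (ip M f h)"
  define e1 where "e1 = Re (ip M (T f) h)"
  define q1 where "q1 = Re (ip M (T f) (T h))"
  have N: "N > 0" using f by (simp add: N_def)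
  have ipE: "ip M (T f) f = of_real E" using sym(2) by (simp add: E_def complex_eq_iff)
  have nT: "(nrm M (T (ft t)))\<^sup>2 = (nrm M (\<lambda>x. T f x + of_real t * T h x))\<^sup>2" for t
    unfolding nrm_square ft_def using lin(1)[of t] lin(2)[of t] T
    by (intro arg_cong[of _ _ Re] ip_cong_AE) auto
  have ipT: "ip M (T (ft t)) (ft t) = ip M (T f) f + of_real t * (ip M (T f) h + ip M (T h) f) + of_real (t\<^sup>2) * ip M (T h) h" for t
  proof -
    have "ip M (T (ft t)) (ft t) = ip M (\<lambda>x. T f x + of_real t * T h x) (\<lambda>x. f x + of_real t * h x)"
      unfolding ft_def using lin(1)[of t] lin(2)[of t] T f h by (intro ip_cong_AE) auto
    then show ?thesis using ip_line[OF f(1) h T] by simp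
  qed
  define \<nu> where "\<nu> = (\<lambda>t. (nrm M (ft t))\<^sup>2)"
  define \<rho> where "\<rho> = (\<lambda>t. (nrm M (T (ft t)))\<^sup>2)"
  define R where "R = (\<lambda>t. Re (ip M (T (ft t)) (ft t)))"
  \<comment> \<open>The expectation along the line is treated as complex: the hypotheses make its
    imaginary part vanish to first order at 0, so its square contributes nothing to the
    derivative.\<close>
  define J where "J = (\<lambda>t. Im (ip M (T (ft t)) (ft t)))"
  have d\<nu>: "(\<nu> has_real_derivative 2 * n1) (at 0)"
    unfolding \<nu>_def ft_def n1_def by (rule nrm_square_line_deriv[OF f(1) h])
  have d\<rho>: "(\<rho> has_real_derivative 2 * q1) (at 0)"
    unfolding \<rho>_def nT q1_def by (rule nrm_square_line_deriv[OF T])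
  have "Re (ip M (T h) f) = e1" unfolding sym(1) e1_def by (subst ip_commute) simp
  then have dR: "(R has_real_derivative 2 * e1) (at 0)"
    unfolding R_def ipT e1_def by (auto intro!: derivative_eq_intros)
  have dJ: "(J has_real_derivative 0) (at 0)"
  proof -
    have "Im (ip M (T h) f) = - Im (ip M (T f) h)" unfolding sym(1) by (subst ip_commute) simp
    then show ?thesis unfolding J_def ipT by (auto intro!: derivative_eq_intros)
  qed
  have at0: "\<nu> 0 = N" "\<rho> 0 = Q" "R 0 = E" "J 0 = 0"
    using sym(2) by (simp_all add: \<nu>_def \<rho>_def R_def J_def N_def Q_def E_def flip: f0)
  have D: "((\<lambda>t. \<rho> t / \<nu> t - ((R t)\<^sup>2 + (J t)\<^sup>2) / (\<nu> t)\<^sup>2) has_real_derivative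
      (2 * q1 * N - Q * (2 * n1)) / (N * N) - ((2 * E * (2 * e1)) * N\<^sup>2 - E\<^sup>2 * (2 * N * (2 * n1))) / (N\<^sup>2 * N\<^sup>2)) (at 0)"
    using N by (auto intro!: derivative_eq_intros d\<nu> d\<rho> dR dJ simp: at0)
  \<comment> \<open>The closed formula needs a nonzero norm, which along the line is guaranteed only
    near t = 0.\<close>
  have ev: "\<forall>\<^sub>F t in nhds 0. 0 < \<nu> t"
  proof -
    have "isCont \<nu> 0" using d\<nu> by (rule DERIV_isCont)
    then have "(\<nu> \<longlongrightarrow> \<nu> 0) (nhds 0)" by (rule isCont_tendsto_compose[where f="\<lambda>x. x", simplified, OF _ filterlim_ident])
    then show ?thesis using N by (intro order_tendstoD(1)) (auto simp: at0)
  qed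
  have eq: "var M T (unit M (ft t)) = \<rho> t / \<nu> t - ((R t)\<^sup>2 + (J t)\<^sup>2) / (\<nu> t)\<^sup>2" if "0 < \<nu> t" for t
  proof -
    have "0 < nrm M (ft t)" using that nrm_nonneg[of M "ft t"] by (auto simp: \<nu>_def less_le)
    moreover have "T (ft t) \<in> L2 M" "T (unit M (ft t)) \<in> borel_measurable M"
      "AE x in M. T (unit M (ft t)) x = T (ft t) x / of_real (nrm M (ft t))"
      unfolding ft_def by (rule lin(2) Tm lin(3))+
    ultimately show ?thesis
      unfolding \<rho>_def \<nu>_def R_def J_def cmod_power2[symmetric] by (intro var_unit ftL)
  qed
  have D': "((\<lambda>t. var M T (unit M (ft t))) has_real_derivative
      (2 * q1 * N - Q * (2 * n1)) / (N * N) - ((2 * E * (2 * e1)) * N\<^sup>2 - E\<^sup>2 * (2 * N * (2 * n1))) / (N\<^sup>2 * N\<^sup>2)) (at 0)"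
    by (rule DERIV_cong_ev[THEN iffD2, OF refl _ refl D]) (use ev eq in \<open>auto elim: eventually_mono\<close>)
  have e: "e = of_real (E / N)"
    unfolding e_def using expval_unit[of T f M] T(1) Tm[of 0] f(1) lin(3)[of 0]
    by (simp add: ipE N_def)
  have v: "v = Q / N - E\<^sup>2 / N\<^sup>2"
    unfolding v_def using eq[of 0] N by (simp add: at0 flip: f0)
  have "Re (ip M (\<lambda>x. 2 * (A x - 2 * e * T f x + e\<^sup>2 * f x - of_real v * f x) / of_real ((nrm M f)\<^sup>2)) h)
    = (2 / N) * (q1 - 2 * (E / N) * e1 + (E / N)\<^sup>2 * n1 - v * n1)"
  proof -
    have "(\<lambda>x. 2 * (A x - 2 * e * T f x + e\<^sup>2 * f x - of_real v * f x) / of_real ((nrm M f)\<^sup>2))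
      = (\<lambda>x. of_real (2 / N) * (A x - (of_real (2 * (E / N)) * T f x) + of_real ((E / N)\<^sup>2) * f x - of_real v * f x))"
      by (simp add: e N_def)
    moreover have "ip M \<dots> h = of_real (2 / N) * (ip M (T f) (T h) - of_real (2 * (E / N)) * ip M (T f) h
        + of_real ((E / N)\<^sup>2) * ip M f h - of_real v * ip M f h)"
      unfolding ip_cmult_left A(2)
      by (subst ip_diff_left ip_add_left; (intro L2_diff L2_add L2_cmult A f T h)?)+ 
        (simp only: ip_cmult_left)
    moreover have "Re (of_real c * z) = c * Re z" for c z by simp
    ultimately show ?thesis by (simp only: n1_def e1_def q1_def minus_complex.sel plus_complex.sel)
  qed
  also have "\<dots> = (2 * q1 * N - Q * (2 * n1)) / (N * N) - ((2 * E * (2 * e1)) * N\<^sup>2 - E\<^sup>2 * (2 * N * (2 * n1))) / (N\<^sup>2 * N\<^sup>2)"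
    using N by (simp add: v field_simps power2_eq_square)
  finally show ?thesis using D' by (simp add: ft_def)
qed

section \<open>The spaces \<open>\<S>\<close> and \<open>\<W>\<close>\<close>

lemma borel_measurable_lebesgueI: "f \<in> borel_measurable borel \<Longrightarrow> f \<in> borel_measurable lebesgue"
  by (simp add: measurable_completion)

lemma AE_nonzero: "AE x::real in lebesgue. x \<noteq> 0"
  by (rule AE_completion) (rule AE_lborel_singleton)

lemma weight_measurable: "(\<lambda>\<omega>::real. ennreal (1 / \<bar>\<omega>\<bar>)) \<in> borel_measurable lebesgue"
  by (rule borel_measurable_lebesgueI) measurable

lemma sets_W_sp [measurable_cong, simp]: "sets W_sp = sets lebesgue"
  by (simp add: W_sp_def)

lemma borel_measurable_W_sp [simp]: "borel_measurable W_sp = borel_measurable lebesgue"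
  by (rule measurable_cong_sets) simp_all

lemma AE_W_sp: "AE x in lebesgue. P x \<Longrightarrow> AE x in W_sp. P x"
  unfolding W_sp_def AE_density[OF weight_measurable] by (erule eventually_mono) simp

lemma ip_W:
  assumes "f \<in> borel_measurable lebesgue" "g \<in> borel_measurable lebesgue"
  shows "ip W_sp f g = (LINT x|lebesgue. of_real (1 / \<bar>x\<bar>) * (f x * cnj (g x)))"
proof -
  have m: "(\<lambda>x::real. 1 / \<bar>x\<bar>) \<in> borel_measurable lebesgue" by (rule borel_measurable_lebesgueI) measurable
  show ?thesis
    unfolding ip_def W_sp_def using assms m
    by (subst integral_density) (auto simp: scaleR_conv_of_real)
qed

text \<open>Multiplication by the square root of the density is an isometry from \<W> to \<S>;
  weighted membership in \<W> is checked through it.\<close>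

lemma L2_W_iff: "f \<in> L2 W_sp \<longleftrightarrow> (\<lambda>x. of_real (1 / sqrt \<bar>x\<bar>) * f x) \<in> L2 S_sp"
proof -
  have m: "(\<lambda>x::real. 1 / \<bar>x\<bar>) \<in> borel_measurable lebesgue"
    "(\<lambda>x::real. complex_of_real (1 / sqrt \<bar>x\<bar>)) \<in> borel_measurable lebesgue"
    "(\<lambda>x::real. complex_of_real (sqrt \<bar>x\<bar>)) \<in> borel_measurable lebesgue"
    by (rule borel_measurable_lebesgueI; measurable)+
  have meas: "f \<in> borel_measurable lebesgue \<longleftrightarrow> (\<lambda>x. of_real (1 / sqrt \<bar>x\<bar>) * f x) \<in> borel_measurable lebesgue"
  proof
    assume h: "(\<lambda>x. of_real (1 / sqrt \<bar>x\<bar>) * f x) \<in> borel_measurable lebesgue"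
    \<comment> \<open>At 0 the factor \<open>1 / sqrt 0\<close> is 0 and erases the value of f,
      which is therefore put back separately.\<close>
    have "(\<lambda>x. if x \<in> {0} then f 0 else of_real (sqrt \<bar>x\<bar>) * (of_real (1 / sqrt \<bar>x\<bar>) * f x)) \<in> borel_measurable lebesgue"
      by (intro measurable_If_set borel_measurable_times m h) auto
    also have "(\<lambda>x. if x \<in> {0} then f 0 else of_real (sqrt \<bar>x\<bar>) * (of_real (1 / sqrt \<bar>x\<bar>) * f x)) = f"
      by (auto simp: fun_eq_iff simp flip: of_real_mult)
    finally show "f \<in> borel_measurable lebesgue" .
  qed (intro borel_measurable_times m)
  have "integrable W_sp (\<lambda>x. (cmod (f x))\<^sup>2) \<longleftrightarrow> integrable lebesgue (\<lambda>x. (cmod (of_real (1 / sqrt \<bar>x\<bar>) * f x))\<^sup>2)"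
    if "f \<in> borel_measurable lebesgue"
  proof -
    have "(cmod (of_real (1 / sqrt \<bar>x\<bar>) * f x))\<^sup>2 = (1 / \<bar>x\<bar>) *\<^sub>R (cmod (f x))\<^sup>2" for x :: real
      by (simp only: norm_mult norm_of_real power_mult_distrib) (simp add: power_divide)
    then show ?thesis
      unfolding W_sp_def using that m by (subst integrable_density) auto
  qed
  with meas show ?thesis by (auto simp: L2_def)
qed

text \<open>This is the source of the factor |x| in every gradient that comes from \<S>: it cancels
  the density away from the null set {0}.\<close>

lemma ip_S_eq_ip_W:
  assumes "f \<in> borel_measurable lebesgue" "g \<in> borel_measurable lebesgue"
  shows "ip S_sp f g = ip W_sp (\<lambda>x. of_real \<bar>x\<bar> * f x) g"
proof -
  have m: "(\<lambda>x::real. complex_of_real \<bar>x\<bar>) \<in> borel_measurable lebesgue"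
    "(\<lambda>x::real. complex_of_real (1 / \<bar>x\<bar>)) \<in> borel_measurable lebesgue"
    by (rule borel_measurable_lebesgueI; measurable)+
  have m2: "(\<lambda>x. of_real \<bar>x\<bar> * f x) \<in> borel_measurable lebesgue" by (intro borel_measurable_times m assms)
  show ?thesis
    unfolding ip_W[OF m2 assms(2)] unfolding ip_def
  proof (rule integral_cong_AE)
    show "(\<lambda>x. of_real (1 / \<bar>x\<bar>) * (of_real \<bar>x\<bar> * f x * cnj (g x))) \<in> borel_measurable lebesgue"
      by (intro borel_measurable_times borel_measurable_cnj m assms)
    show "(\<lambda>x. f x * cnj (g x)) \<in> borel_measurable lebesgue"
      by (intro borel_measurable_times borel_measurable_cnj assms)
    show "AE x in lebesgue. f x * cnj (g x) = of_real (1 / \<bar>x\<bar>) * (of_real \<bar>x\<bar> * f x * cnj (g x))"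
      using AE_nonzero by eventually_elim (simp add: mult.assoc)
  qed
qed

section \<open>Interpolation\<close>

lemma has_vector_derivative_mult_cnj:
  assumes "(f has_vector_derivative f') (at x)" "(g has_vector_derivative g') (at x)"
  shows "((\<lambda>x. f x * cnj (g x)) has_vector_derivative f x * cnj g' + f' * cnj (g x)) (at x)"
  by (intro has_vector_derivative_mult assms bounded_linear.has_vector_derivative[OF bounded_linear_cnj])

text \<open>The identity \<open>\<integral> \<rho> |f'|\<^sup>2 = - \<integral> \<rho>' f' cnj f - \<integral> \<rho> f'' cnj f\<close>, where the
  weight \<open>\<rho>(x) = \<surd>(1 + x\<^sup>2) (1 - x\<^sup>2 / R\<^sup>2)\<^sup>2\<close> vanishes at \<open>\<plusminus>R\<close> and satisfies
  \<open>\<rho>'\<^sup>2 \<le> \<rho> (2 + 32 \<surd>(1 + x\<^sup>2))\<close>; the latter makes the first term on the right absorbable.\<close>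

lemma weighted_energy_bound:
  fixes f :: "real \<Rightarrow> complex"
  assumes f: "\<And>x. (f has_vector_derivative g x) (at x)" and g: "loc_abs_cont g"
    and I: "integrable lebesgue (\<lambda>x. sqrt (1 + x\<^sup>2) * (cmod (f x))\<^sup>2)"
      "integrable lebesgue (\<lambda>x. sqrt (1 + x\<^sup>2) * (cmod (D g x))\<^sup>2)"
    and R: "1 \<le> R"
  shows "integral {-R/2..R/2} (\<lambda>x. sqrt (1 + x\<^sup>2) * (cmod (g x))\<^sup>2)
     \<le> 4 * (LINT x|lebesgue. sqrt (1 + x\<^sup>2) * (cmod (D g x))\<^sup>2 + 18 * (sqrt (1 + x\<^sup>2) * (cmod (f x))\<^sup>2))"
proof -
  define \<phi> where "\<phi> = (\<lambda>x::real. sqrt (1 + x\<^sup>2))"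
  define u where "u = (\<lambda>x::real. 1 - x\<^sup>2 / R\<^sup>2)"
  define \<rho> where "\<rho> = (\<lambda>x. \<phi> x * (u x)\<^sup>2)"
  define \<rho>' where "\<rho>' = (\<lambda>x. x / \<phi> x * (u x)\<^sup>2 - 4 * x / R\<^sup>2 * \<phi> x * u x)"
  have \<phi>1: "1 \<le> \<phi> x" for x by (simp add: \<phi>_def)
  have pos: "0 < 1 + x\<^sup>2" for x :: real by (rule add_pos_nonneg) auto
  have \<phi>2: "(\<phi> x)\<^sup>2 = 1 + x\<^sup>2" for x using pos[of x] by (simp add: \<phi>_def)
  have d\<phi>: "(\<phi> has_real_derivative x / \<phi> x) (at x)" for x
    unfolding \<phi>_def using pos[of x] by (auto intro!: derivative_eq_intros simp: field_simps)
  have du: "(u has_real_derivative - 2 * x / R\<^sup>2) (at x)" for x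
    unfolding u_def
    by (rule DERIV_cong[OF DERIV_diff[OF DERIV_const DERIV_cdivide[OF DERIV_power[OF DERIV_ident]]]]) simp
  have d\<rho>: "(\<rho> has_real_derivative \<rho>' x) (at x)" for x
    unfolding \<rho>_def \<rho>'_def by (rule derivative_eq_intros d\<phi> du refl)+ (simp add: power2_eq_square)
  have c\<phi>: "continuous_on A \<phi>" for A unfolding \<phi>_def by (intro continuous_intros)
  have cu: "continuous_on A u" for A unfolding u_def using R by (intro continuous_intros) auto
  have c\<rho>: "continuous_on A \<rho>" for A unfolding \<rho>_def by (intro continuous_intros c\<phi> cu)
  have c\<rho>': "continuous_on A \<rho>'" for A
    unfolding \<rho>'_def using R \<phi>1 by (intro continuous_intros c\<phi> cu) (auto, metis not_one_le_zero)
  have cg: "continuous_on A g" for A by (rule loc_abs_cont_continuous[OF g])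
  have u01: "(u x)\<^sup>2 \<le> 1" if x: "x \<in> {-R..R}" for x
  proof -
    have "x\<^sup>2 \<le> R\<^sup>2" using x by (intro abs_le_square_iff[THEN iffD1]) auto
    moreover have "0 < R\<^sup>2" using R by simp
    ultimately have "x\<^sup>2 / R\<^sup>2 \<le> 1" by simp
    moreover have "0 \<le> x\<^sup>2 / R\<^sup>2" by simp
    ultimately show ?thesis by (intro power_le_one) (auto simp: u_def)
  qed
  \<comment> \<open>The square of the two-term derivative is at most twice the sum of the squares.
    The first square is at most \<rho>; the second is at most 16 \<phi> \<rho>, because x^2 / R^4 is
    at most 1 for |x| \<le> R and R \<ge> 1.\<close>
  have key: "(\<rho>' x)\<^sup>2 \<le> \<rho> x * (2 + 32 * \<phi> x)" if x: "x \<in> {-R..R}" for x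
  proof -
    have xR: "x\<^sup>2 \<le> R\<^sup>2" using x by (intro abs_le_square_iff[THEN iffD1]) auto
    have R2: "1 \<le> R\<^sup>2" using R by simp
    note u01 = u01[OF x]
    have "(\<rho>' x)\<^sup>2 \<le> 2 * (x / \<phi> x * (u x)\<^sup>2)\<^sup>2 + 2 * (4 * x / R\<^sup>2 * \<phi> x * u x)\<^sup>2"
      using sum_squares_bound[of "x / \<phi> x * (u x)\<^sup>2" "- (4 * x / R\<^sup>2 * \<phi> x * u x)"]
      unfolding \<rho>'_def by (simp add: power2_diff)
    also have "(x / \<phi> x * (u x)\<^sup>2)\<^sup>2 \<le> \<rho> x"
    proof -
      have "(x / \<phi> x * (u x)\<^sup>2)\<^sup>2 = (x\<^sup>2 / (\<phi> x)\<^sup>2) * (u x)\<^sup>2 * (u x)\<^sup>2"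
        by (simp add: power_mult_distrib power_divide power2_eq_square)
      also have "\<dots> \<le> 1 * (u x)\<^sup>2 * 1"
        using u01 pos[of x] by (intro mult_mono) (auto simp: \<phi>2)
      also have "\<dots> \<le> \<phi> x * (u x)\<^sup>2" using mult_right_mono[OF \<phi>1[of x], of "(u x)\<^sup>2"] by simp
      finally show ?thesis by (simp add: \<rho>_def)
    qed
    also have "(4 * x / R\<^sup>2 * \<phi> x * u x)\<^sup>2 \<le> 16 * \<phi> x * \<rho> x"
    proof -
      have le1: "x\<^sup>2 / (R\<^sup>2)\<^sup>2 \<le> 1"
      proof -
        have "x\<^sup>2 \<le> R\<^sup>2 * R\<^sup>2" using xR R2 mult_left_mono[of 1 "R\<^sup>2" "R\<^sup>2"] by simp
        moreover have "0 < R\<^sup>2 * R\<^sup>2" using R by simp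
        ultimately show ?thesis unfolding power2_eq_square[of "R\<^sup>2"] by (rule divide_le_eq_1_pos[THEN iffD2, rotated])
      qed
      have "(4 * x / R\<^sup>2 * \<phi> x * u x)\<^sup>2 = 16 * \<phi> x * \<rho> x * (x\<^sup>2 / (R\<^sup>2)\<^sup>2)"
        by (simp add: \<rho>_def power_mult_distrib power_divide power2_eq_square)
      also have "\<dots> \<le> 16 * \<phi> x * \<rho> x * 1"
        using \<phi>1[of x] by (intro mult_left_mono le1 mult_nonneg_nonneg) (auto simp: \<rho>_def)
      finally show ?thesis by simp
    qed
    finally show ?thesis by (simp add: algebra_simps)
  qed
  have \<rho>0: "0 \<le> \<rho> x" for x using \<phi>1[of x] by (simp add: \<rho>_def)
  define G where "G = (\<lambda>x. complex_of_real (\<rho> x) * (g x * cnj (f x)))"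
  define G' where "G' = (\<lambda>x. of_real (\<rho> x) * (g x * cnj (g x) + D g x * cnj (f x)) + of_real (\<rho>' x) * (g x * cnj (f x)))"
  have d\<rho>c: "((\<lambda>x. complex_of_real (\<rho> x)) has_vector_derivative of_real (\<rho>' x)) (at x)" for x
    using d\<rho>[of x] by (simp add: has_vector_derivative_of_real has_real_derivative_iff_has_vector_derivative)
  have lacf: "loc_abs_cont f" by (rule C1_imp_loc_abs_cont[OF f cg])
  have "loc_abs_cont G"
    unfolding G_def
    by (intro loc_abs_cont_mult loc_abs_cont_cnj lacf g C1_imp_loc_abs_cont[OF d\<rho>c] continuous_intros c\<rho>')
  moreover have "AE x in lebesgue. (G has_vector_derivative G' x) (at x)"
    using loc_abs_cont_AE_vector_derivative[OF g]
    unfolding G_def G'_def by eventually_elim (intro has_vector_derivative_mult d\<rho>c has_vector_derivative_mult_cnj f)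
  ultimately have "(G' has_integral G R - G (- R)) {-R..R}"
    by (intro loc_abs_cont_has_integral) (use R in auto)
  moreover have "G R = 0" "G (- R) = 0" using R by (simp_all add: G_def \<rho>_def u_def)
  ultimately have G'0: "((\<lambda>x. Re (G' x)) has_integral 0) {-R..R}"
    using has_integral_Re[of G' 0] by simp
  \<comment> \<open>By \<open>key\<close>, half of \<rho> |g|^2 absorbs the term with \<rho>' and
    leaves (1 + 16 \<phi>) |f|^2; splitting the term with \<open>D g\<close> evenly adds \<phi>
    |f|^2 / 2. As \<phi> \<ge> 1 the sum is at most 17.5 \<phi> |f|^2, rounded up to 18.\<close>
  define M where "M = (\<lambda>x. \<phi> x * (cmod (D g x))\<^sup>2 + 18 * (\<phi> x * (cmod (f x))\<^sup>2))"
  have M: "integrable lebesgue M"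
    unfolding M_def \<phi>_def using I by (intro Bochner_Integration.integrable_add integrable_mult_right)
  have M0: "0 \<le> M x" for x using \<phi>1[of x] by (simp add: M_def)
  have MI: "M integrable_on UNIV" using integrable_on_lebesgue[OF M] .
  have MI': "M integrable_on {a..b}" for a b using integrable_on_subinterval[OF MI] by simp
  have pw: "\<rho> x * (cmod (g x))\<^sup>2 / 2 \<le> Re (G' x) + M x" if x: "x \<in> {-R..R}" for x
  proof -
    have "\<bar>\<rho>' x\<bar> \<le> sqrt (\<rho> x) * sqrt (2 + 32 * \<phi> x)"
      using key[OF x] by (simp add: real_le_rsqrt flip: real_sqrt_mult)
    from mult_right_mono[OF this, of "cmod (g x) * cmod (f x)"]
    have "\<bar>\<rho>' x\<bar> * (cmod (g x) * cmod (f x)) \<le> (sqrt (\<rho> x) * cmod (g x)) * (sqrt (2 + 32 * \<phi> x) * cmod (f x))"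
      by (simp add: mult_ac)
    also have "\<dots> \<le> ((sqrt (\<rho> x) * cmod (g x))\<^sup>2 + (sqrt (2 + 32 * \<phi> x) * cmod (f x))\<^sup>2) / 2"
      using sum_squares_bound[of "sqrt (\<rho> x) * cmod (g x)" "sqrt (2 + 32 * \<phi> x) * cmod (f x)"] by simp
    also have "\<dots> = (\<rho> x * (cmod (g x))\<^sup>2 + (2 + 32 * \<phi> x) * (cmod (f x))\<^sup>2) / 2"
      using \<rho>0[of x] \<phi>1[of x] by (simp add: power_mult_distrib)
    finally have 1: "\<bar>\<rho>' x\<bar> * (cmod (g x) * cmod (f x)) \<le> (\<rho> x * (cmod (g x))\<^sup>2 + (2 + 32 * \<phi> x) * (cmod (f x))\<^sup>2) / 2" .
    have "\<bar>Re (of_real (\<rho>' x) * (g x * cnj (f x)))\<bar> \<le> cmod (of_real (\<rho>' x) * (g x * cnj (f x)))"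
      by (rule abs_Re_le_cmod)
    then have a: "- (\<bar>\<rho>' x\<bar> * (cmod (g x) * cmod (f x))) \<le> Re (of_real (\<rho>' x) * (g x * cnj (f x)))"
      by (simp only: norm_mult norm_of_real complex_mod_cnj)
    have \<rho>\<phi>: "\<rho> x \<le> \<phi> x"
    proof -
      show ?thesis using u01[OF x] \<phi>1[of x] by (simp add: \<rho>_def mult_left_le)
    qed
    have "\<bar>Re (of_real (\<rho> x) * (D g x * cnj (f x)))\<bar> \<le> cmod (of_real (\<rho> x) * (D g x * cnj (f x)))"
      by (rule abs_Re_le_cmod)
    also have "\<dots> = \<rho> x * (cmod (D g x) * cmod (f x))"
      using \<rho>0[of x] by (simp only: norm_mult norm_of_real complex_mod_cnj abs_of_nonneg)
    also have "\<dots> \<le> \<phi> x * (((cmod (D g x))\<^sup>2 + (cmod (f x))\<^sup>2) / 2)"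
      using \<rho>\<phi> \<rho>0[of x] \<phi>1[of x] sum_squares_bound[of "cmod (D g x)" "cmod (f x)"]
      by (intro mult_mono) auto
    finally have b: "- (\<phi> x * (((cmod (D g x))\<^sup>2 + (cmod (f x))\<^sup>2) / 2)) \<le> Re (of_real (\<rho> x) * (D g x * cnj (f x)))"
      by linarith
    have c: "Re (of_real (\<rho> x) * (g x * cnj (g x))) = \<rho> x * (cmod (g x))\<^sup>2"
      by (simp add: complex_norm_square[symmetric] flip: of_real_mult of_real_power)
    have Re: "Re (G' x) = \<rho> x * (cmod (g x))\<^sup>2 + Re (of_real (\<rho> x) * (D g x * cnj (f x))) + Re (of_real (\<rho>' x) * (g x * cnj (f x)))"
      unfolding G'_def distrib_left plus_complex.sel c ..
    have "(cmod (f x))\<^sup>2 \<le> \<phi> x * (cmod (f x))\<^sup>2" using \<phi>1[of x] mult_right_mono[of 1 "\<phi> x" "(cmod (f x))\<^sup>2"] by simp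
    moreover have "0 \<le> \<phi> x * (cmod (D g x))\<^sup>2" using \<phi>1[of x] by simp
    moreover have "0 \<le> \<phi> x * (cmod (f x))\<^sup>2" using \<phi>1[of x] by simp
    moreover have "(2 + 32 * \<phi> x) * (cmod (f x))\<^sup>2 = 2 * (cmod (f x))\<^sup>2 + 32 * (\<phi> x * (cmod (f x))\<^sup>2)" by (simp add: algebra_simps)
    moreover have "\<phi> x * (((cmod (D g x))\<^sup>2 + (cmod (f x))\<^sup>2) / 2) = \<phi> x * (cmod (D g x))\<^sup>2 / 2 + \<phi> x * (cmod (f x))\<^sup>2 / 2"
      by (simp add: algebra_simps)
    moreover have "X / 2 \<le> X + r1 + r2 + (d + 18 * p)"
      if "F \<le> p" "0 \<le> d" "0 \<le> p" "m = 2 * F + 32 * p" "y = d / 2 + p / 2" "k \<le> (X + m) / 2" "- k \<le> r2" "- y \<le> r1"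
      for X r1 r2 d p F m y k :: real
      using that by argo
    ultimately show ?thesis
      using 1 a b unfolding Re M_def by blast
  qed
  have E1: "integral {-R..R} (\<lambda>x. \<rho> x * (cmod (g x))\<^sup>2 / 2) \<le> integral {-R..R} M"
  proof -
    have "(\<lambda>x. \<rho> x * (cmod (g x))\<^sup>2 / 2) integrable_on {-R..R}"
      by (intro integrable_continuous_interval continuous_intros c\<rho> cg) auto
    then have "((\<lambda>x. \<rho> x * (cmod (g x))\<^sup>2 / 2) has_integral integral {-R..R} (\<lambda>x. \<rho> x * (cmod (g x))\<^sup>2 / 2)) {-R..R}"
      by (rule integrable_integral)
    moreover have "((\<lambda>x. Re (G' x) + M x) has_integral 0 + integral {-R..R} M) {-R..R}"
      by (intro has_integral_add G'0 integrable_integral MI')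
    ultimately show ?thesis using pw by (auto dest: has_integral_le)
  qed
  also have "integral {-R..R} M \<le> integral UNIV M"
    using MI MI' M0 by (intro integral_subset_le) auto
  also have "integral UNIV M = (LINT x|lebesgue. M x)"
    using has_integral_integral_lebesgue[OF M] by (rule integral_unique)
  finally have E2: "integral {-R..R} (\<lambda>x. \<rho> x * (cmod (g x))\<^sup>2 / 2) \<le> (LINT x|lebesgue. M x)" .
  \<comment> \<open>On the inner half u is at least 3 / 4, so 2 u^2 is at least 1 and \<phi> is at
    most 4 times \<rho> / 2; this is the 4 in the bound.\<close>
  have "integral {-R/2..R/2} (\<lambda>x. \<phi> x * (cmod (g x))\<^sup>2) \<le> integral {-R/2..R/2} (\<lambda>x. 4 * (\<rho> x * (cmod (g x))\<^sup>2 / 2))"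
  proof (rule integral_le)
    fix x assume x: "x \<in> {-R/2..R/2}"
    have "x\<^sup>2 \<le> (R / 2)\<^sup>2" using x by (intro abs_le_square_iff[THEN iffD1]) auto
    then have "3 / 4 \<le> u x" using R by (simp add: u_def field_simps)
    then have "(3 / 4)\<^sup>2 \<le> (u x)\<^sup>2" by (rule power_mono) simp
    then have "1 \<le> 2 * (u x)\<^sup>2" by (simp add: power2_eq_square)
    then have "\<phi> x * 1 \<le> \<phi> x * (2 * (u x)\<^sup>2)" using \<phi>1[of x] by (intro mult_left_mono) auto
    then have "\<phi> x * (cmod (g x))\<^sup>2 \<le> 2 * \<rho> x * (cmod (g x))\<^sup>2"
      by (intro mult_right_mono) (auto simp: \<rho>_def)
    then show "\<phi> x * (cmod (g x))\<^sup>2 \<le> 4 * (\<rho> x * (cmod (g x))\<^sup>2 / 2)" by simp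
  qed (intro integrable_continuous_interval continuous_intros c\<rho> c\<phi> cg; simp)+
  also have "\<dots> = 4 * integral {-R/2..R/2} (\<lambda>x. \<rho> x * (cmod (g x))\<^sup>2 / 2)" by (rule integral_mult_right)
  also have "integral {-R/2..R/2} (\<lambda>x. \<rho> x * (cmod (g x))\<^sup>2 / 2) \<le> integral {-R..R} (\<lambda>x. \<rho> x * (cmod (g x))\<^sup>2 / 2)"
    using R \<rho>0 by (intro integral_subset_le integrable_continuous_interval continuous_intros c\<rho> cg) auto
  finally show ?thesis using E2 by (simp add: \<phi>_def M_def)
qed

text \<open>The preceding bound does not depend on R, so monotone convergence over growing intervals
  applies.\<close>

lemma weighted_energy_integrable:
  fixes f :: "real \<Rightarrow> complex"
  assumes f: "\<And>x. (f has_vector_derivative g x) (at x)" and g: "loc_abs_cont g"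
    and I: "integrable lebesgue (\<lambda>x. sqrt (1 + x\<^sup>2) * (cmod (f x))\<^sup>2)"
      "integrable lebesgue (\<lambda>x. sqrt (1 + x\<^sup>2) * (cmod (D g x))\<^sup>2)"
  shows "integrable lebesgue (\<lambda>x. sqrt (1 + x\<^sup>2) * (cmod (g x))\<^sup>2)"
proof -
  let ?h = "\<lambda>x. sqrt (1 + x\<^sup>2) * (cmod (g x))\<^sup>2"
  define C where "C = 4 * (LINT x|lebesgue. sqrt (1 + x\<^sup>2) * (cmod (D g x))\<^sup>2 + 18 * (sqrt (1 + x\<^sup>2) * (cmod (f x))\<^sup>2))"
  let ?hn = "\<lambda>(n::nat) x. if x \<in> {- real n..real n} then ?h x else 0"
  have ci: "?h integrable_on {a..b}" for a b
    by (intro integrable_continuous_interval continuous_intros loc_abs_cont_continuous[OF g])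
  have le: "integral {- real n..real n} ?h \<le> C" for n :: nat
  \<comment> \<open>Half-width n corresponds to R = 2 n, which is at least 1 only for positive
    n.\<close>
  proof (cases "n = 0")
    case True
    have "0 \<le> C" unfolding C_def by (intro mult_nonneg_nonneg integral_nonneg_AE) auto
    then show ?thesis using True by simp
  next
    case False
    then show ?thesis using weighted_energy_bound[OF f g I, of "2 * real n"] unfolding C_def by simp
  qed
  have int: "integral UNIV (?hn n) = integral {- real n..real n} ?h" for n by (rule integral_restrict_UNIV)
  have "?h integrable_on UNIV \<and> (\<lambda>n. integral UNIV (?hn n)) \<longlonglongrightarrow> integral UNIV ?h"
  proof (rule monotone_convergence_increasing)
    show "?hn n integrable_on UNIV" for n by (simp only: integrable_restrict_UNIV ci)
    show "?hn n x \<le> ?hn (Suc n) x" for n x by auto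
    show "(\<lambda>n. ?hn n x) \<longlonglongrightarrow> ?h x" for x
    proof (rule tendsto_eventually)
      obtain N :: nat where "\<bar>x\<bar> \<le> real N" using real_arch_simple by blast
      then show "\<forall>\<^sub>F n in sequentially. ?hn n x = ?h x"
        by (intro eventually_sequentiallyI[of N]) auto
    qed
    show "bounded (range (\<lambda>n. integral UNIV (?hn n)))"
    proof (rule boundedI[of _ C])
      fix y assume "y \<in> range (\<lambda>n. integral UNIV (?hn n))"
      then obtain n where "y = integral {- real n..real n} ?h" unfolding int by blast
      moreover have "0 \<le> integral {- real n..real n} ?h" by (rule integral_nonneg[OF ci]) simp
      ultimately show "norm y \<le> C" using le[of n] by simp
    qed
  qed
  then have "?h absolutely_integrable_on UNIV"
    by (intro nonnegative_absolutely_integrable_1) auto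
  then show ?thesis by (simp add: set_integrable_def)
qed

section \<open>The domains\<close>

lemma D_eq: "(f has_vector_derivative f') (at x) \<Longrightarrow> D f x = f'"
  by (simp add: D_def vector_derivative_at)

text \<open>The identity is obtained where both functions are differentiable; elsewhere the values
  of \<open>D\<close> are unrelated.\<close>

lemma AE_D_linear:
  assumes "loc_abs_cont f" "loc_abs_cont h"
  shows "AE x in lebesgue. D (\<lambda>x. a * f x + b * h x) x = a * D f x + b * D h x"
  using loc_abs_cont_AE_vector_derivative[OF assms(1)] loc_abs_cont_AE_vector_derivative[OF assms(2)]
proof eventually_elim
  case (elim x)
  show ?case
    by (rule D_eq) (intro has_vector_derivative_add has_vector_derivative_mult_right elim)
qed

lemma loc_abs_cont_measurable: "loc_abs_cont f \<Longrightarrow> f \<in> borel_measurable lebesgue"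
  by (intro borel_measurable_lebesgueI borel_measurable_continuous_onI loc_abs_cont_continuous)

text \<open>If \<open>f 0 \<noteq> 0\<close> then \<open>|f(\<omega>) / \<omega>|\<^sup>2\<close> is at least a multiple of \<open>1 / \<omega>\<^sup>2\<close> near \<open>0\<close>.\<close>

lemma mult_inv_L2_imp_zero:
  assumes f: "continuous_on UNIV f" and "mult_inv f \<in> L2 S_sp"
  shows "f 0 = 0"
proof (rule ccontr)
  assume "f 0 \<noteq> 0"
  define c where "c = cmod (f 0) / 2"
  have c: "c > 0" using \<open>f 0 \<noteq> 0\<close> by (simp add: c_def)
  have "isCont f 0" using f by (simp add: continuous_on_eq_continuous_at)
  then obtain d where d: "d > 0" "\<And>x. dist x 0 < d \<Longrightarrow> dist (f x) (f 0) < c"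
    using c by (metis continuous_at_eps_delta)
  have fc: "c \<le> cmod (f x)" if "\<bar>x\<bar> < d" for x
  proof -
    have "cmod (f x - f 0) < c" using d(2)[of x] that by (simp add: dist_norm)
    moreover have "cmod (f 0) \<le> cmod (f x) + cmod (f x - f 0)"
      using norm_triangle_ineq[of "f x" "f 0 - f x"] by (simp add: norm_minus_commute)
    ultimately show ?thesis by (simp add: c_def)
  qed
  define H where "H = (\<lambda>x. (cmod (mult_inv f x))\<^sup>2)"
  have "integrable lebesgue H" using assms(2) by (simp add: L2_def H_def)
  then have HI: "H integrable_on UNIV" by (rule integrable_on_lebesgue)
  have HI': "H integrable_on {a..b}" for a b using integrable_on_subinterval[OF HI] by simp
  define r where "r = d / 2"
  have r: "0 < r" "r < d" using d by (auto simp: r_def)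
  have bd: "c\<^sup>2 * (1 / e - 1 / r) \<le> integral UNIV H" if e: "0 < e" "e \<le> r" for e
  proof -
    have "((\<lambda>x. c\<^sup>2 / x\<^sup>2) has_integral (- c\<^sup>2 / r) - (- c\<^sup>2 / e)) {e..r}"
      by (rule fundamental_theorem_of_calculus[OF e(2)])
        (use e in \<open>auto intro!: derivative_eq_intros simp: power2_eq_square simp flip: has_real_derivative_iff_has_vector_derivative\<close>)
    moreover have "c\<^sup>2 / x\<^sup>2 \<le> H x" if x: "x \<in> {e..r}" for x
    proof -
      have "c \<le> cmod (f x)" using x e r by (intro fc) auto
      then have "(c / x)\<^sup>2 \<le> (cmod (f x) / x)\<^sup>2" using c x e by (intro power_mono divide_right_mono) auto
      then show ?thesis using x e by (simp add: H_def mult_inv_def norm_divide power_divide)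
    qed
    ultimately have "(- c\<^sup>2 / r) - (- c\<^sup>2 / e) \<le> integral {e..r} H"
      using has_integral_le integrable_integral[OF HI'] by blast
    also have "\<dots> \<le> integral UNIV H"
      by (intro integral_subset_le HI HI') (auto simp: H_def)
    finally show ?thesis by (simp add: right_diff_distrib)
  qed
  have "LIM e at_right 0. c\<^sup>2 * (1 / e - 1 / r) :> at_top"
    using c by real_asymp
  then have "\<forall>\<^sub>F e in at_right 0. integral UNIV H < c\<^sup>2 * (1 / e - 1 / r)"
    by (simp add: filterlim_at_top_dense)
  moreover have "\<forall>\<^sub>F e in at_right 0. 0 < e \<and> e \<le> r"
    using r by (auto simp: eventually_at_right_field intro: exI[of _ r])
  ultimately have "\<forall>\<^sub>F e :: real in at_right 0. False"
    by eventually_elim (use bd in force)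
  then show False by simp
qed

lemma integrable_divide_weight:
  assumes "integrable lebesgue k"
  shows "integrable lebesgue (\<lambda>x. k x / complex_of_real (1 + \<bar>x\<bar>))"
proof (rule Bochner_Integration.integrable_bound[OF assms])
  have m: "(\<lambda>x::real. complex_of_real (1 + \<bar>x\<bar>)) \<in> borel_measurable lebesgue"
    by (rule borel_measurable_lebesgueI) measurable
  show "(\<lambda>x. k x / complex_of_real (1 + \<bar>x\<bar>)) \<in> borel_measurable lebesgue"
    using assms by (intro borel_measurable_divide m) auto
  have "norm (k x / complex_of_real (1 + \<bar>x\<bar>)) \<le> norm (k x)" for x
  proof -
    have "norm (complex_of_real (1 + \<bar>x\<bar>)) = 1 + \<bar>x\<bar>" by (simp only: norm_of_real)
    moreover have "norm (k x) / (1 + \<bar>x\<bar>) \<le> norm (k x) / 1" by (intro divide_left_mono) auto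
    ultimately show ?thesis by (simp only: norm_divide)
  qed
  then show "AE x in lebesgue. norm (k x / complex_of_real (1 + \<bar>x\<bar>)) \<le> norm (k x)" by simp
qed

text \<open>Beyond unfolding: the value 0 at the origin is forced by \<open>mult_inv f\<close> in
  L2, and both norms are positive because the zero set of a continuous function that vanishes almost
  everywhere has an open null complement, which is empty.\<close>

lemma Dom_L_facts:
  assumes "f \<in> Dom_L"
  shows "loc_abs_cont f" "f \<in> L2 S_sp" "f \<in> L2 W_sp" "D f \<in> L2 S_sp" "iD f \<in> L2 S_sp" "i\<omega>D f \<in> L2 W_sp"
    "mult_inv f \<in> L2 S_sp" "mult_ln f \<in> L2 S_sp" "mult_ln f \<in> L2 W_sp" "f 0 = 0"
    "0 < nrm S_sp f" "0 < nrm W_sp f"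
proof -
  note * = assms[unfolded Dom_L_def mem_Collect_eq]
  show f: "loc_abs_cont f" "f \<in> L2 S_sp" "f \<in> L2 W_sp" "D f \<in> L2 S_sp"
    "mult_inv f \<in> L2 S_sp" "mult_ln f \<in> L2 S_sp" "mult_ln f \<in> L2 W_sp" using * by blast+
  show "iD f \<in> L2 S_sp" unfolding iD_def using f by (intro L2_cmult) simp
  show "i\<omega>D f \<in> L2 W_sp"
    using L2_cmult[of "\<lambda>\<omega>. of_real \<omega> * D f \<omega>" W_sp \<i>] * by (simp add: i\<omega>D_def mult.assoc)
  show "f 0 = 0" by (intro mult_inv_L2_imp_zero loc_abs_cont_continuous f)
  have nz: "\<not> (AE x in lebesgue. f x = 0)"
  proof
    assume ae: "AE x in lebesgue. f x = 0"
    have "f = (\<lambda>x. 0)"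
    proof
      fix x
      have "closed {x. f x = 0}"
        using loc_abs_cont_continuous[OF f(1), of UNIV] by (intro closed_Collect_eq) auto
      moreover have "negligible (- {x. f x = 0})"
        using ae by (simp add: negligible_iff_null_sets completion.AE_iff_null_sets Collect_neg_eq)
      ultimately have "- {x. f x = 0} = {}" using open_not_negligible by (metis open_Compl)
      then show "f x = 0" by blast
    qed
    then show False using * by blast
  qed
  then show "0 < nrm S_sp f" using f by (simp add: nrm_pos_iff)
  have "\<not> (AE x in W_sp. f x = 0)"
  proof
    assume "AE x in W_sp. f x = 0"
    then have "AE x in lebesgue. 0 < ennreal (1 / \<bar>x\<bar>) \<longrightarrow> f x = 0"
      unfolding W_sp_def AE_density[OF weight_measurable] .
    then have "AE x in lebesgue. f x = 0"
      using AE_nonzero by eventually_elim (simp add: ennreal_less_zero_iff)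
    then show False using nz by blast
  qed
  then show "0 < nrm W_sp f" using f by (simp add: nrm_pos_iff)
qed

text \<open>Integration by parts changes the sign, and so does moving the factor i across the
  conjugation.\<close>

lemma iD_symmetric:
  assumes f: "f \<in> Dom_L" and h: "h \<in> Dom_L"
  shows "ip S_sp (iD h) f = ip S_sp h (iD f)"
proof -
  note F = Dom_L_facts[OF f] and H = Dom_L_facts[OF h]
  have i: "integrable lebesgue (\<lambda>x. h x * cnj (D f x))" "integrable lebesgue (\<lambda>x. D h x * cnj (f x))"
    "integrable lebesgue (\<lambda>x. h x * cnj (f x))"
    using F H by (auto intro: ip_integrable)
  have "(LINT x|lebesgue. h x * cnj (D f x) + D h x * cnj (f x)) = 0"
  proof (rule integral_derivative_eq_0)
    show "loc_abs_cont (\<lambda>x. h x * cnj (f x))" by (intro loc_abs_cont_mult loc_abs_cont_cnj F H)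
    show "AE x in lebesgue. ((\<lambda>x. h x * cnj (f x)) has_vector_derivative h x * cnj (D f x) + D h x * cnj (f x)) (at x)"
      using loc_abs_cont_AE_vector_derivative[OF F(1)] loc_abs_cont_AE_vector_derivative[OF H(1)]
      by eventually_elim (rule has_vector_derivative_mult_cnj)
    show "integrable lebesgue (\<lambda>x. h x * cnj (f x) / of_real (1 + \<bar>x\<bar>))"
      by (rule integrable_divide_weight[OF i(3)])
  qed (use i in auto)
  then have "(LINT x|lebesgue. D h x * cnj (f x)) = - (LINT x|lebesgue. h x * cnj (D f x))"
    using i by (simp add: add_eq_0_iff)
  moreover have "ip S_sp (iD h) f = \<i> * (LINT x|lebesgue. D h x * cnj (f x))"
    by (simp add: ip_def iD_def mult.assoc)
  moreover have "ip S_sp h (iD f) = - \<i> * (LINT x|lebesgue. h x * cnj (D f x))"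
    by (simp add: ip_def iD_def mult.left_commute)
  ultimately show ?thesis by simp
qed

text \<open>The density times \<omega> is sgn \<omega>, also at 0 where both are 0. This reduces the
  \<W> inner product to a Lebesgue integral with a jump at 0.\<close>

lemma ip_W_i\<omega>D:
  assumes "loc_abs_cont f" "D h \<in> borel_measurable lebesgue"
  shows "ip W_sp (i\<omega>D h) f = \<i> * (LINT x|lebesgue. of_real (sgn x) * (D h x * cnj (f x)))"
proof -
  have m: "(\<lambda>x::real. complex_of_real x) \<in> borel_measurable lebesgue" by (rule borel_measurable_lebesgueI) measurable
  have "ip W_sp (i\<omega>D h) f = (LINT x|lebesgue. of_real (1 / \<bar>x\<bar>) * (i\<omega>D h x * cnj (f x)))"
    unfolding i\<omega>D_def by (intro ip_W borel_measurable_times m assms loc_abs_cont_measurable borel_measurable_const)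
  also have "(\<lambda>x. of_real (1 / \<bar>x\<bar>) * (i\<omega>D h x * cnj (f x))) = (\<lambda>x. \<i> * (of_real (sgn x) * (D h x * cnj (f x))))"
  proof
    fix x :: real
    have "complex_of_real (sgn x) = of_real (1 / \<bar>x\<bar>) * of_real x"
      by (simp add: sgn_if abs_if flip: of_real_mult of_real_divide)
    then show "of_real (1 / \<bar>x\<bar>) * (i\<omega>D h x * cnj (f x)) = \<i> * (of_real (sgn x) * (D h x * cnj (f x)))"
      by (simp only: i\<omega>D_def mult_ac)
  qed
  finally show ?thesis by simp
qed

text \<open>Integration by parts on each half line; the boundary term at the jump of sgn disappears
  since h vanishes at 0.\<close>

lemma i\<omega>D_symmetric:
  assumes f: "f \<in> Dom_L" and h: "h \<in> Dom_L"
  shows "ip W_sp (i\<omega>D h) f = ip W_sp h (i\<omega>D f)"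
proof -
  note F = Dom_L_facts[OF f] and H = Dom_L_facts[OF h]
  have i: "integrable lebesgue (\<lambda>x. h x * cnj (D f x))" "integrable lebesgue (\<lambda>x. D h x * cnj (f x))"
    "integrable lebesgue (\<lambda>x. h x * cnj (f x))"
    using F H by (auto intro: ip_integrable)
  have s: "integrable lebesgue (\<lambda>x. of_real (sgn x) * k x)" if "integrable lebesgue k" for k :: "real \<Rightarrow> complex"
  proof (rule Bochner_Integration.integrable_bound[OF that])
    have "(\<lambda>x::real. complex_of_real (sgn x)) \<in> borel_measurable lebesgue"
      by (rule borel_measurable_lebesgueI) measurable
    then show "(\<lambda>x. of_real (sgn x) * k x) \<in> borel_measurable lebesgue"
      using that by (intro borel_measurable_times) auto
    have "\<bar>sgn x\<bar> \<le> 1" for x :: real by (simp add: sgn_if)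
    then show "AE x in lebesgue. norm (of_real (sgn x) * k x) \<le> norm (k x)"
      by (intro AE_I2) (simp add: norm_mult mult_left_le_one_le)
  qed
  have "(LINT x|lebesgue. of_real (sgn x) * (h x * cnj (D f x) + D h x * cnj (f x))) = 0"
  proof (rule integral_sgn_derivative_eq_0)
    show "loc_abs_cont (\<lambda>x. h x * cnj (f x))" by (intro loc_abs_cont_mult loc_abs_cont_cnj F H)
    show "AE x in lebesgue. ((\<lambda>x. h x * cnj (f x)) has_vector_derivative h x * cnj (D f x) + D h x * cnj (f x)) (at x)"
      using loc_abs_cont_AE_vector_derivative[OF F(1)] loc_abs_cont_AE_vector_derivative[OF H(1)]
      by eventually_elim (rule has_vector_derivative_mult_cnj)
    show "integrable lebesgue (\<lambda>x. h x * cnj (f x) / of_real (1 + \<bar>x\<bar>))"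
      by (rule integrable_divide_weight[OF i(3)])
    show "h 0 * cnj (f 0) = 0" by (simp add: H(10))
  qed (intro s Bochner_Integration.integrable_add i)
  then have "(LINT x|lebesgue. of_real (sgn x) * (D h x * cnj (f x))) = - (LINT x|lebesgue. of_real (sgn x) * (h x * cnj (D f x)))"
    using s[OF i(1)] s[OF i(2)] by (simp add: distrib_left add_eq_0_iff)
  moreover have "ip W_sp (i\<omega>D h) f = \<i> * (LINT x|lebesgue. of_real (sgn x) * (D h x * cnj (f x)))"
    using F H by (intro ip_W_i\<omega>D) auto
  moreover have "ip W_sp h (i\<omega>D f) = - \<i> * (LINT x|lebesgue. of_real (sgn x) * (h x * cnj (D f x)))"
  proof -
    have "ip W_sp h (i\<omega>D f) = cnj (\<i> * (LINT x|lebesgue. of_real (sgn x) * (D f x * cnj (h x))))"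
      using ip_W_i\<omega>D[of h f] ip_commute[of W_sp h "i\<omega>D f"] F H by simp
    also have "\<dots> = - \<i> * (LINT x|lebesgue. cnj (of_real (sgn x) * (D f x * cnj (h x))))"
      by (subst Bochner_Integration.integral_cnj) simp
    finally show ?thesis by (simp add: mult.commute)
  qed
  ultimately show ?thesis by simp
qed

text \<open>The inequality ln y \<le> y - 1 is used at y = a^(-1/4); the factor 4 in ln a = 4 ln s
  becomes 16 after squaring.\<close>

lemma ln_bound:
  fixes a :: real
  assumes a: "0 < a" "a \<le> 1"
  shows "(ln a)\<^sup>2 \<le> 16 / sqrt a"
proof -
  define s where "s = sqrt (sqrt a)"
  have s4: "s ^ 4 = (s\<^sup>2)\<^sup>2" by simp
  have s: "0 < s" "s \<le> 1" "a = s ^ 4" "sqrt a = s\<^sup>2"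
    using a unfolding s4 by (simp_all add: s_def)
  have "ln (1 / s) \<le> 1 / s - 1" using s by (intro ln_le_minus_one) auto
  then have "- ln s \<le> 1 / s" using s(1) by (simp add: ln_div)
  moreover have "0 \<le> - ln s" using s by (simp add: ln_le_zero_iff)
  ultimately have "(- ln s)\<^sup>2 \<le> (1 / s)\<^sup>2" by (rule power_mono)
  moreover have "ln a = 4 * ln s" using s by (simp add: ln_realpow)
  ultimately show ?thesis using s by (simp add: power_mult_distrib power_divide)
qed

text \<open>\<open>B\<close> is the sum of the three weights whose product with f is square
  integrable by the definition of \<open>Dom_delta\<close>. Near 0 the term 1 / x^2 dominates the
  negative powers and, through \<open>ln_bound\<close>, the logarithms; at infinity the last term
  takes over. The constants 17 = 16 + 1 and 4 = 3 + 1 come from l \<le> 1 + l^2.\<close>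

lemma weight_bounds:
  fixes x :: real
  assumes "x \<noteq> 0"
  defines "B \<equiv> 1 + 1 / x\<^sup>2 + sqrt \<bar>x\<bar> * (ln \<bar>x\<bar>)\<^sup>2"
  shows "1 \<le> B" "\<bar>1 / x\<bar> \<le> B" "\<bar>1 / sqrt \<bar>x\<bar>\<bar> \<le> B" "\<bar>1 / \<bar>x\<bar> / sqrt \<bar>x\<bar>\<bar> \<le> B"
    "\<bar>sqrt \<bar>x\<bar>\<bar> \<le> 3 * B" "\<bar>(ln \<bar>x\<bar>)\<^sup>2\<bar> \<le> 16 * B" "\<bar>(ln \<bar>x\<bar>)\<^sup>2 / sqrt \<bar>x\<bar>\<bar> \<le> 16 * B"
    "\<bar>ln \<bar>x\<bar>\<bar> \<le> 17 * B" "\<bar>ln \<bar>x\<bar> / sqrt \<bar>x\<bar>\<bar> \<le> 17 * B" "\<bar>sqrt \<bar>x\<bar> * ln \<bar>x\<bar>\<bar> \<le> 4 * B"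
    "\<bar>sqrt \<bar>x\<bar> * (ln \<bar>x\<bar>)\<^sup>2\<bar> \<le> B"
proof -
  define a where "a = \<bar>x\<bar>"
  define s where "s = sqrt a"
  define l where "l = \<bar>ln a\<bar>"
  have a: "0 < a" using assms by (simp add: a_def)
  have s: "0 < s" "a = s * s" using a by (simp_all add: s_def)
  have B: "B = 1 + 1 / a\<^sup>2 + s * l\<^sup>2" by (simp add: B_def s_def l_def a_def)
  have nn: "0 \<le> 1 / a\<^sup>2" "0 \<le> s * l\<^sup>2" "0 \<le> l" "0 \<le> l\<^sup>2" using s by (simp_all add: l_def)
  have s1: "a \<le> 1 \<Longrightarrow> s \<le> 1" "1 \<le> a \<Longrightarrow> 1 \<le> s" by (simp_all add: s_def)
  \<comment> \<open>Since s^4 = a^2, the fourth power is the largest power of 1 / s that the term 1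
    / a^2 controls near 0.\<close>
  have inv: "1 / s ^ k \<le> 1 + 1 / a\<^sup>2" if k: "k \<le> 4" for k
  proof (cases "a \<le> 1")
    case True
    have "s ^ 4 \<le> s ^ k" using True s s1 k by (intro power_decreasing) auto
    then have "1 / s ^ k \<le> 1 / s ^ 4" using s by (intro divide_left_mono) auto
    also have "s ^ 4 = a\<^sup>2" by (simp add: s(2) power2_eq_square power4_eq_xxxx)
    finally show ?thesis by simp
  next
    case False
    then have "1 \<le> s ^ k" using s1 by (intro one_le_power) auto
    then have "1 / s ^ k \<le> 1" by (simp add: divide_le_eq_1)
    then show ?thesis using nn(1) by linarith
  qed
  show B1: "1 \<le> B" using nn by (simp add: B)
  have i1: "1 / s \<le> B" and i2: "1 / a \<le> B" and i3: "1 / a / s \<le> B"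
    using inv[of 1] inv[of 2] inv[of 3] nn(2) by (simp_all add: B s(2) power2_eq_square power3_eq_cube)
  show "\<bar>1 / x\<bar> \<le> B" using i2 by (simp add: a_def)
  show "\<bar>1 / sqrt \<bar>x\<bar>\<bar> \<le> B" using i1 s(1) by (simp add: s_def a_def)
  show "\<bar>1 / \<bar>x\<bar> / sqrt \<bar>x\<bar>\<bar> \<le> B" using i3 s(1) a by (simp add: s_def a_def)
  \<comment> \<open>Above 3, an upper bound of exp 1, the logarithm is at least 1 and the last term
    of \<open>B\<close> dominates s; below, s itself is at most 3.\<close>
  have sB: "s \<le> 3 * B"
  proof (cases "a \<le> 3")
    case True
    then have "s \<le> sqrt 9" unfolding s_def by (intro real_sqrt_le_mono) auto
    then show ?thesis using B1 by simp
  next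
    case False
    have "1 \<le> l"
    proof -
      have "exp 1 \<le> a" using False exp_le by linarith
      then have "1 \<le> ln a" using a by (simp add: ln_ge_iff)
      then show ?thesis by (simp add: l_def)
    qed
    then have "s * 1 \<le> s * l\<^sup>2" using s by (intro mult_left_mono one_le_power) auto
    then show ?thesis using B nn B1 by linarith
  qed
  then show "\<bar>sqrt \<bar>x\<bar>\<bar> \<le> 3 * B" using s by (simp add: s_def a_def)
  have l2: "l\<^sup>2 \<le> 16 * B \<and> l\<^sup>2 / s \<le> 16 * B"
  proof (cases "a \<le> 1")
    case True
    have "l\<^sup>2 \<le> 16 / s" using ln_bound[OF a True] by (simp add: l_def s_def)
    moreover have "l\<^sup>2 / s \<le> 16 / s / s" using \<open>l\<^sup>2 \<le> 16 / s\<close> s by (intro divide_right_mono) auto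
    moreover have "16 / s / s = 16 * (1 / a)" by (simp add: s(2))
    ultimately show ?thesis using i1 i2 by simp
  next
    case False
    then have "1 \<le> s" using s1 by simp
    then have "1 * l\<^sup>2 \<le> s * l\<^sup>2" by (intro mult_right_mono) auto
    moreover have "l\<^sup>2 / s \<le> l\<^sup>2 / 1" using \<open>1 \<le> s\<close> by (intro divide_left_mono) auto
    moreover have "s * l\<^sup>2 \<le> B" using B nn by linarith
    ultimately show ?thesis using B1 by auto
  qed
  then show "\<bar>(ln \<bar>x\<bar>)\<^sup>2\<bar> \<le> 16 * B" "\<bar>(ln \<bar>x\<bar>)\<^sup>2 / sqrt \<bar>x\<bar>\<bar> \<le> 16 * B"
    using s by (simp_all add: l_def s_def a_def)
  have ll: "l \<le> 1 + l\<^sup>2" using sum_squares_bound[of l 1] nn by simp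
  then have "l \<le> 17 * B" using l2 B1 by linarith
  then show "\<bar>ln \<bar>x\<bar>\<bar> \<le> 17 * B" by (simp add: l_def a_def)
  have "l / s \<le> (1 + l\<^sup>2) / s" using ll s by (intro divide_right_mono) auto
  then have "l / s \<le> 17 * B" using l2 i1 by (simp add: add_divide_distrib)
  then show "\<bar>ln \<bar>x\<bar> / sqrt \<bar>x\<bar>\<bar> \<le> 17 * B" using s by (simp add: l_def a_def s_def)
  have "s * l \<le> s * (1 + l\<^sup>2)" using ll s by (intro mult_left_mono) auto
  moreover have "s * l\<^sup>2 \<le> B" using B nn by linarith
  ultimately have "s * l \<le> 4 * B" using sB unfolding distrib_left by linarith
  then show "\<bar>sqrt \<bar>x\<bar> * ln \<bar>x\<bar>\<bar> \<le> 4 * B" using s by (simp add: l_def a_def s_def abs_mult)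
  show "\<bar>sqrt \<bar>x\<bar> * (ln \<bar>x\<bar>)\<^sup>2\<bar> \<le> B" using nn s B by (simp add: l_def a_def s_def abs_mult)
qed

section \<open>Integrability on \<open>Dom_delta\<close>\<close>

lemma Dom_delta_D:
  assumes "f \<in> Dom_delta"
  shows "(f has_vector_derivative D f x) (at x)" "loc_abs_cont (D f)" "loc_abs_cont f"
    "f \<in> L2 S_sp" "D (D f) \<in> L2 S_sp"
proof -
  note * = assms[unfolded Dom_delta_def mem_Collect_eq]
  show d: "(f has_vector_derivative D f x) (at x)" for x
    using * unfolding D_def by (simp add: vector_derivative_works)
  show l: "loc_abs_cont (D f)" using * by blast
  show "loc_abs_cont f" by (rule C1_imp_loc_abs_cont[OF d loc_abs_cont_continuous[OF l]])
  show "f \<in> L2 S_sp" "D (D f) \<in> L2 S_sp" using * by blast+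
qed

lemma Dom_delta_weight:
  assumes f: "f \<in> Dom_delta" and m: "m \<in> borel_measurable borel"
    and b: "\<And>x. x \<noteq> 0 \<Longrightarrow> \<bar>m x\<bar> \<le> C * (1 + 1 / x\<^sup>2 + sqrt \<bar>x\<bar> * (ln \<bar>x\<bar>)\<^sup>2)"
  shows "(\<lambda>x. of_real (m x) * f x) \<in> L2 S_sp"
proof (rule L2_dominated)
  note * = f[unfolded Dom_delta_def mem_Collect_eq]
  show "(\<lambda>x. of_real C * (f x + of_real (1 / x\<^sup>2) * f x + of_real (sqrt \<bar>x\<bar> * (ln \<bar>x\<bar>)\<^sup>2) * f x)) \<in> L2 S_sp"
    using * by (intro L2_cmult L2_add) blast+
  show "(\<lambda>x. of_real (m x) * f x) \<in> borel_measurable lebesgue"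
    using m by (intro borel_measurable_times borel_measurable_lebesgueI[where f="\<lambda>x. complex_of_real (m x)"] loc_abs_cont_measurable Dom_delta_D[OF f]) measurable
  show "AE x in lebesgue. cmod (of_real (m x) * f x)
      \<le> cmod (of_real C * (f x + of_real (1 / x\<^sup>2) * f x + of_real (sqrt \<bar>x\<bar> * (ln \<bar>x\<bar>)\<^sup>2) * f x))"
    using AE_nonzero
  proof eventually_elim
    case (elim x)
    have "cmod (of_real (m x) * f x) = \<bar>m x\<bar> * cmod (f x)" by (simp only: norm_mult norm_of_real)
    also have "\<dots> \<le> \<bar>C * (1 + 1 / x\<^sup>2 + sqrt \<bar>x\<bar> * (ln \<bar>x\<bar>)\<^sup>2)\<bar> * cmod (f x)"
      using b[OF elim] by (intro mult_right_mono) auto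
    also have "\<dots> = cmod (of_real (C * (1 + 1 / x\<^sup>2 + sqrt \<bar>x\<bar> * (ln \<bar>x\<bar>)\<^sup>2)) * f x)"
      by (simp only: norm_mult norm_of_real)
    also have "of_real (C * (1 + 1 / x\<^sup>2 + sqrt \<bar>x\<bar> * (ln \<bar>x\<bar>)\<^sup>2)) * f x
      = of_real C * (f x + of_real (1 / x\<^sup>2) * f x + of_real (sqrt \<bar>x\<bar> * (ln \<bar>x\<bar>)\<^sup>2) * f x)"
      by (simp only: of_real_mult of_real_add of_real_1 distrib_right distrib_left mult_1 mult.assoc)
    finally show ?case .
  qed
qed

lemma Dom_delta_weights:
  assumes f: "f \<in> Dom_delta"
  shows "(\<lambda>x. of_real (1 / x) * f x) \<in> L2 S_sp" "(\<lambda>x. of_real (1 / sqrt \<bar>x\<bar>) * f x) \<in> L2 S_sp"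
    "(\<lambda>x. of_real (1 / \<bar>x\<bar> / sqrt \<bar>x\<bar>) * f x) \<in> L2 S_sp" "(\<lambda>x. of_real (sqrt \<bar>x\<bar>) * f x) \<in> L2 S_sp"
    "(\<lambda>x. of_real ((ln \<bar>x\<bar>)\<^sup>2) * f x) \<in> L2 S_sp" "(\<lambda>x. of_real ((ln \<bar>x\<bar>)\<^sup>2 / sqrt \<bar>x\<bar>) * f x) \<in> L2 S_sp"
    "(\<lambda>x. of_real (ln \<bar>x\<bar>) * f x) \<in> L2 S_sp" "(\<lambda>x. of_real (ln \<bar>x\<bar> / sqrt \<bar>x\<bar>) * f x) \<in> L2 S_sp"
    "(\<lambda>x. of_real (sqrt \<bar>x\<bar> * ln \<bar>x\<bar>) * f x) \<in> L2 S_sp" "(\<lambda>x. of_real (sqrt \<bar>x\<bar> * (ln \<bar>x\<bar>)\<^sup>2) * f x) \<in> L2 S_sp"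
  \<comment> \<open>\<open>mult_1\<close> inserts the constant 1 where the weight bound has
    none.\<close>
  by (rule Dom_delta_weight[OF f _ order_trans[OF weight_bounds(2) mult_1[THEN eq_refl[OF sym]]]], measurable)
     (rule Dom_delta_weight[OF f _ order_trans[OF weight_bounds(3) mult_1[THEN eq_refl[OF sym]]]], measurable,
      rule Dom_delta_weight[OF f _ order_trans[OF weight_bounds(4) mult_1[THEN eq_refl[OF sym]]]], measurable,
      rule Dom_delta_weight[OF f _ weight_bounds(5)], measurable,
      rule Dom_delta_weight[OF f _ weight_bounds(6)], measurable,
      rule Dom_delta_weight[OF f _ weight_bounds(7)], measurable,
      rule Dom_delta_weight[OF f _ weight_bounds(8)], measurable,
      rule Dom_delta_weight[OF f _ weight_bounds(9)], measurable,
      rule Dom_delta_weight[OF f _ weight_bounds(10)], measurable,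
      rule Dom_delta_weight[OF f _ order_trans[OF weight_bounds(11) mult_1[THEN eq_refl[OF sym]]]], measurable)

text \<open>The weight sqrt (1 + x^2) is at most 1 + |x|, so its hypotheses hold for f and the
  second derivative; it is at least 1 and at least |x|, so the interpolated energy yields both
  weights for \<open>D f\<close>. Then the combined condition in \<open>Dom_delta\<close> releases
  its second-order term by subtraction.\<close>

lemma Dom_delta_deriv:
  assumes f: "f \<in> Dom_delta"
  shows "D f \<in> L2 S_sp" "(\<lambda>x. of_real (sqrt \<bar>x\<bar>) * D f x) \<in> L2 S_sp"
    "(\<lambda>x. of_real (sqrt \<bar>x\<bar>) * D (D f) x) \<in> L2 S_sp"
    "(\<lambda>x. of_real (\<bar>x\<bar> powr (3/2)) * D (D f) x) \<in> L2 S_sp"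
proof -
  note * = f[unfolded Dom_delta_def mem_Collect_eq]
  note F = Dom_delta_D[OF f]
  have i: "integrable lebesgue (\<lambda>x. sqrt (1 + x\<^sup>2) * (cmod (k x))\<^sup>2)"
    if k: "k \<in> L2 S_sp" "(\<lambda>x. of_real (sqrt \<bar>x\<bar>) * k x) \<in> L2 S_sp" for k
  proof (rule Bochner_Integration.integrable_bound[of _ "\<lambda>x. (cmod (k x))\<^sup>2 + (cmod (of_real (sqrt \<bar>x\<bar>) * k x))\<^sup>2"])
    show "integrable lebesgue (\<lambda>x. (cmod (k x))\<^sup>2 + (cmod (of_real (sqrt \<bar>x\<bar>) * k x))\<^sup>2)"
      using k unfolding L2_def by (intro Bochner_Integration.integrable_add) auto
    have m: "(\<lambda>x::real. sqrt (1 + x\<^sup>2)) \<in> borel_measurable lebesgue" by (rule borel_measurable_lebesgueI) measurable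
    show "(\<lambda>x. sqrt (1 + x\<^sup>2) * (cmod (k x))\<^sup>2) \<in> borel_measurable lebesgue"
      using k m by (intro borel_measurable_times borel_measurable_power) (auto simp: L2_def)
    show "AE x in lebesgue. norm (sqrt (1 + x\<^sup>2) * (cmod (k x))\<^sup>2) \<le> norm ((cmod (k x))\<^sup>2 + (cmod (of_real (sqrt \<bar>x\<bar>) * k x))\<^sup>2)"
    proof (rule AE_I2)
      fix x :: real
      have "sqrt (1 + x\<^sup>2) \<le> 1 + \<bar>x\<bar>" by (rule real_le_lsqrt) (auto simp: power2_eq_square algebra_simps)
      then have "sqrt (1 + x\<^sup>2) * (cmod (k x))\<^sup>2 \<le> (1 + \<bar>x\<bar>) * (cmod (k x))\<^sup>2" by (rule mult_right_mono) simp
      then show "norm (sqrt (1 + x\<^sup>2) * (cmod (k x))\<^sup>2) \<le> norm ((cmod (k x))\<^sup>2 + (cmod (of_real (sqrt \<bar>x\<bar>) * k x))\<^sup>2)"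
        by (simp add: norm_mult power_mult_distrib algebra_simps)
    qed
  qed
  show dd: "(\<lambda>x. of_real (sqrt \<bar>x\<bar>) * D (D f) x) \<in> L2 S_sp" using * by blast
  have I: "integrable lebesgue (\<lambda>x. sqrt (1 + x\<^sup>2) * (cmod (D f x))\<^sup>2)"
    by (rule weighted_energy_integrable[OF F(1,2) i[OF F(4) Dom_delta_weights(4)[OF f]] i[OF F(5) dd]])
  have *: "(\<lambda>x. of_real (m x) * D f x) \<in> L2 S_sp"
    if m: "m \<in> borel_measurable borel" "\<And>x. (m x)\<^sup>2 \<le> sqrt (1 + x\<^sup>2)" for m :: "real \<Rightarrow> real"
  proof -
    have meas: "(\<lambda>x. of_real (m x) * D f x) \<in> borel_measurable lebesgue"
      using m(1) by (intro borel_measurable_times borel_measurable_lebesgueI[where f="\<lambda>x. complex_of_real (m x)"] loc_abs_cont_measurable F) measurable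
    moreover have "integrable lebesgue (\<lambda>x. (cmod (of_real (m x) * D f x))\<^sup>2)"
    proof (rule Bochner_Integration.integrable_bound[OF I])
      show "(\<lambda>x. (cmod (of_real (m x) * D f x))\<^sup>2) \<in> borel_measurable lebesgue" using meas by measurable
      show "AE x in lebesgue. norm ((cmod (of_real (m x) * D f x))\<^sup>2) \<le> norm (sqrt (1 + x\<^sup>2) * (cmod (D f x))\<^sup>2)"
        using m(2) by (intro AE_I2) (simp add: norm_mult power_mult_distrib mult_right_mono)
    qed
    ultimately show ?thesis by (simp add: L2_def)
  qed
  show "D f \<in> L2 S_sp" using *[of "\<lambda>_. 1"] by simp
  show sd: "(\<lambda>x. of_real (sqrt \<bar>x\<bar>) * D f x) \<in> L2 S_sp"
    by (rule *) (auto intro: real_le_rsqrt)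
  have "(\<lambda>x. (of_real (\<bar>x\<bar> powr (3/2)) * D (D f) x + of_real (sqrt \<bar>x\<bar>) * D f x) - of_real (sqrt \<bar>x\<bar>) * D f x) \<in> L2 S_sp"
    using f sd unfolding Dom_delta_def by (intro L2_diff) blast+
  then show "(\<lambda>x. of_real (\<bar>x\<bar> powr (3/2)) * D (D f) x) \<in> L2 S_sp" by simp
qed

text \<open>The clause on \<omega> f' in \<W> amounts to sqrt |\<omega>| f' in \<S>, which
  interpolation has provided.\<close>

lemma Dom_delta_subset_Dom_L:
  assumes f: "f \<in> Dom_delta"
  shows "f \<in> Dom_L"
proof -
  note F = Dom_delta_D[OF f] and W = Dom_delta_weights[OF f] and E = Dom_delta_deriv[OF f]
  have "(\<lambda>x. of_real (1 / sqrt \<bar>x\<bar>) * (of_real x * D f x)) \<in> L2 S_sp"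
  proof (rule L2_dominated[OF E(2)])
    show "(\<lambda>x. of_real (1 / sqrt \<bar>x\<bar>) * (of_real x * D f x)) \<in> borel_measurable lebesgue"
      by (intro borel_measurable_times loc_abs_cont_measurable F borel_measurable_lebesgueI[where f="\<lambda>x. complex_of_real (1 / sqrt \<bar>x\<bar>)"]
          borel_measurable_lebesgueI[where f="\<lambda>x. complex_of_real x"]) measurable
    show "AE x in lebesgue. cmod (of_real (1 / sqrt \<bar>x\<bar>) * (of_real x * D f x)) \<le> cmod (of_real (sqrt \<bar>x\<bar>) * D f x)"
      using AE_nonzero 
    proof eventually_elim
      case (elim x)
      have "\<bar>x\<bar> = sqrt \<bar>x\<bar> * sqrt \<bar>x\<bar>" by simp
      then have "1 / sqrt \<bar>x\<bar> * \<bar>x\<bar> = sqrt \<bar>x\<bar>" using elim by (simp add: field_simps)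
      moreover have "cmod (of_real (1 / sqrt \<bar>x\<bar>) * (of_real x * D f x)) = 1 / sqrt \<bar>x\<bar> * \<bar>x\<bar> * cmod (D f x)"
        by (simp add: norm_mult norm_divide)
      ultimately have "cmod (of_real (1 / sqrt \<bar>x\<bar>) * (of_real x * D f x)) = sqrt \<bar>x\<bar> * cmod (D f x)"
        by simp
      then show ?case by (simp add: norm_mult)
    qed
  qed
  moreover have "(\<lambda>x. of_real (1 / sqrt \<bar>x\<bar>) * mult_ln f x) \<in> L2 S_sp"
    using W(8) by (simp add: mult_ln_def)
  moreover have "f \<noteq> (\<lambda>_. 0)" using f unfolding Dom_delta_def by blast
  moreover have "mult_inv f \<in> L2 S_sp" "mult_ln f \<in> L2 S_sp"
    using W(1,7) by (simp_all only: mult_inv_def mult_ln_def)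
  ultimately show ?thesis
    unfolding Dom_L_def L2_W_iff mem_Collect_eq by (intro conjI F W(2) E(1))
qed

section \<open>Density\<close>

text \<open>The zero function satisfies every clause of \<open>Dom_L\<close> except being nonzero,
  so adding it back leaves purely linear conditions.\<close>

lemma Dom_L_Un_zero:
  "Dom_L \<union> {\<lambda>_. 0} = {f. f \<in> L2 W_sp \<and> f \<in> L2 S_sp \<and> loc_abs_cont f \<and> D f \<in> L2 S_sp
      \<and> (\<lambda>\<omega>. of_real \<omega> * D f \<omega>) \<in> L2 W_sp \<and> mult_inv f \<in> L2 S_sp \<and> mult_ln f \<in> L2 S_sp \<and> mult_ln f \<in> L2 W_sp}"
  (is "_ = ?R")
proof -
  have D0: "D (\<lambda>_. 0) = (\<lambda>_. 0)" by (simp add: fun_eq_iff D_eq)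
  have l0: "loc_abs_cont (\<lambda>_. 0)" unfolding loc_abs_cont_iff by (auto intro: lipschitz_imp_abs_cont[where M=0])
  have "(\<lambda>_. 0) \<in> L2 M" for M by (simp add: L2_def)
  then have "(\<lambda>_. 0) \<in> ?R" by (simp add: D0 l0 mult_inv_def mult_ln_def)
  then show ?thesis unfolding Dom_L_def by blast
qed

lemma Dom_L_linear:
  assumes f: "f \<in> Dom_L \<union> {\<lambda>_. 0}" and g: "g \<in> Dom_L \<union> {\<lambda>_. 0}"
  shows "(\<lambda>\<omega>. of_real a * f \<omega> + of_real b * g \<omega>) \<in> Dom_L \<union> {\<lambda>_. 0}"
proof -
  note F = f[unfolded Dom_L_Un_zero mem_Collect_eq] and G = g[unfolded Dom_L_Un_zero mem_Collect_eq]
  let ?h = "\<lambda>\<omega>. of_real a * f \<omega> + of_real b * g \<omega>"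
  have lin: "?h \<in> L2 M" if "f \<in> L2 M" "g \<in> L2 M" for M using that by (intro L2_add L2_cmult)
  have ae: "AE x in lebesgue. D ?h x = of_real a * D f x + of_real b * D g x"
    using F G by (intro AE_D_linear) auto
  have Dlin: "(\<lambda>x. of_real a * D f x + of_real b * D g x) \<in> L2 S_sp" using F G by (intro L2_add L2_cmult) auto
  have Dm: "D ?h \<in> borel_measurable lebesgue"
    by (rule borel_measurable_AE[OF L2_measurable[OF Dlin]]) (use ae in eventually_elim, simp)
  have "D ?h \<in> L2 S_sp" by (rule L2_cong_AE[OF Dlin Dm ae])
  moreover have "(\<lambda>\<omega>. of_real \<omega> * D ?h \<omega>) \<in> L2 W_sp"
  proof (rule L2_cong_AE)
    show "(\<lambda>\<omega>. of_real a * (of_real \<omega> * D f \<omega>) + of_real b * (of_real \<omega> * D g \<omega>)) \<in> L2 W_sp"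
      using F G by (intro L2_add L2_cmult) auto
    have "(\<lambda>x::real. complex_of_real x) \<in> borel_measurable lebesgue" by (rule borel_measurable_lebesgueI) measurable
    then show "(\<lambda>\<omega>. of_real \<omega> * D ?h \<omega>) \<in> borel_measurable W_sp" using Dm by (simp add: borel_measurable_times)
    show "AE \<omega> in W_sp. of_real \<omega> * D ?h \<omega> = of_real a * (of_real \<omega> * D f \<omega>) + of_real b * (of_real \<omega> * D g \<omega>)"
      by (rule AE_W_sp, use ae in eventually_elim) (simp add: algebra_simps)
  qed
  moreover have "mult_inv ?h = (\<lambda>\<omega>. of_real a * mult_inv f \<omega> + of_real b * mult_inv g \<omega>)"
    "mult_ln ?h = (\<lambda>\<omega>. of_real a * mult_ln f \<omega> + of_real b * mult_ln g \<omega>)"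
    by (simp_all add: mult_inv_def mult_ln_def algebra_simps fun_eq_iff)
  ultimately show ?thesis
    unfolding Dom_L_Un_zero using F G by (simp add: lin L2_add L2_cmult loc_abs_cont_add loc_abs_cont_cmult)
qed

text \<open>Continuity of m is asked on K only: the weights 1 / x and ln |x| are singular at 0,
  which the applications keep outside K.\<close>

lemma L2_compact_support:
  assumes k: "continuous_on UNIV k" "\<And>x. x \<notin> K \<Longrightarrow> k x = 0"
    and K: "compact K" and m: "m \<in> borel_measurable borel" "continuous_on K m"
  shows "(\<lambda>x. complex_of_real (m x) * k x) \<in> L2 S_sp"
proof -
  have "bounded ((\<lambda>x. of_real (m x) * k x) ` K)"
    using k m K by (intro compact_imp_bounded compact_continuous_image continuous_intros) (auto intro: continuous_on_subset)
  then obtain C where C: "\<And>x. x \<in> K \<Longrightarrow> cmod (of_real (m x) * k x) \<le> C" unfolding bounded_iff by auto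
  have "(\<lambda>x. of_real (m x) * k x) \<in> borel_measurable lebesgue"
    by (rule borel_measurable_lebesgueI) (use m(1) borel_measurable_continuous_onI[OF k(1)] in measurable)
  moreover have "(\<lambda>x. complex_of_real (C * indicat_real K x)) \<in> L2 S_sp"
  proof -
    have "K \<in> lmeasurable" using K by (rule lmeasurable_compact)
    then have "integrable lebesgue (\<lambda>x. C\<^sup>2 * indicat_real K x)" "K \<in> sets lebesgue"
      by (simp_all add: lmeasurable_iff_integrable fmeasurableD)
    moreover have "(cmod (complex_of_real (C * indicat_real K x)))\<^sup>2 = C\<^sup>2 * indicat_real K x" for x
      by (simp add: norm_mult indicator_def)
    ultimately show ?thesis by (simp add: L2_def)
  qed
  moreover have "cmod (of_real (m x) * k x) \<le> cmod (complex_of_real (C * indicat_real K x))" for x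
  proof (cases "x \<in> K")
    case True
    then show ?thesis using C[OF True] by (simp only: norm_of_real) simp
  qed (simp add: k(2))
  ultimately show ?thesis by (intro L2_dominated[where f="\<lambda>x. of_real (m x) * k x"] AE_I2)
qed

text \<open>Support away from 0 and from infinity makes every weight of \<open>Dom_L\<close> bounded
  where it matters.\<close>

lemma C1_compact_support_in_Dom_L:
  assumes \<psi>: "\<And>x. (\<psi> has_vector_derivative \<psi>' x) (at x)" and c: "continuous_on UNIV \<psi>'"
    and a: "0 < a" and supp: "\<And>x. \<bar>x\<bar> \<notin> {a..b} \<Longrightarrow> \<psi> x = 0" "\<And>x. \<bar>x\<bar> \<notin> {a..b} \<Longrightarrow> \<psi>' x = 0"
  shows "\<psi> \<in> Dom_L \<union> {\<lambda>_. 0}"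
proof -
  define K where "K = {-b..-a} \<union> {a..b}"
  have K: "compact K" by (auto simp: K_def)
  have K0: "x \<noteq> 0" if "x \<in> K" for x using that a by (auto simp: K_def)
  have KI: "\<bar>x\<bar> \<in> {a..b}" if "\<not> x \<notin> K" for x using that a by (auto simp: K_def)
  have KI': "x \<in> K" if "\<bar>x\<bar> \<in> {a..b}" for x using that by (auto simp: K_def abs_if split: if_splits)
  have lac: "loc_abs_cont \<psi>" by (rule C1_imp_loc_abs_cont[OF \<psi> c])
  have c\<psi>: "continuous_on UNIV \<psi>" by (rule loc_abs_cont_continuous[OF lac])
  have D\<psi>: "D \<psi> = \<psi>'" using D_eq[OF \<psi>] by (simp add: fun_eq_iff)
  have S: "(\<lambda>x. of_real (m x) * \<psi> x) \<in> L2 S_sp" "(\<lambda>x. of_real (m x) * \<psi>' x) \<in> L2 S_sp"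
    if "m \<in> borel_measurable borel" "continuous_on K m" for m
    using that supp KI' by (auto intro!: L2_compact_support[OF _ _ K] c c\<psi>)
  have "(\<lambda>x. of_real (1 / sqrt \<bar>x\<bar>) * \<psi> x) \<in> L2 S_sp"
    by (rule S) (use K0 in \<open>auto intro!: continuous_intros\<close>)
  moreover have "\<psi> \<in> L2 S_sp" using S(1)[of "\<lambda>_. 1"] by simp
  moreover have "\<psi>' \<in> L2 S_sp" using S(2)[of "\<lambda>_. 1"] by simp
  moreover have "(\<lambda>x. of_real (1 / sqrt \<bar>x\<bar> * x) * \<psi>' x) \<in> L2 S_sp"
    by (rule S) (use K0 in \<open>auto intro!: continuous_intros\<close>)
  moreover have "(\<lambda>x. of_real (1 / x) * \<psi> x) \<in> L2 S_sp"
    by (rule S) (use K0 in \<open>auto intro!: continuous_intros\<close>)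
  moreover have "(\<lambda>x. of_real (ln \<bar>x\<bar>) * \<psi> x) \<in> L2 S_sp"
    by (rule S) (use K0 in \<open>auto intro!: continuous_intros\<close>)
  moreover have "(\<lambda>x. of_real (1 / sqrt \<bar>x\<bar> * ln \<bar>x\<bar>) * \<psi> x) \<in> L2 S_sp"
    by (rule S) (use K0 in \<open>auto intro!: continuous_intros\<close>)
  ultimately show ?thesis
    unfolding Dom_L_Un_zero mem_Collect_eq L2_W_iff mult_inv_def mult_ln_def D\<psi> using lac
    by (simp add: of_real_mult mult.assoc)
qed

text \<open>For 0 < a < b the quartic is positive exactly when a < |x| < b; squaring its positive
  part makes the function C1.\<close>

definition bump :: "real \<Rightarrow> real \<Rightarrow> real \<Rightarrow> real" where
  "bump a b x = (max 0 ((x\<^sup>2 - a\<^sup>2) * (b\<^sup>2 - x\<^sup>2)))\<^sup>2"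

lemma bump_deriv:
  "(bump a b has_real_derivative 2 * max 0 ((x\<^sup>2 - a\<^sup>2) * (b\<^sup>2 - x\<^sup>2)) * (2 * x * (b\<^sup>2 - x\<^sup>2) - 2 * x * (x\<^sup>2 - a\<^sup>2))) (at x)"
proof -
  have m: "((\<lambda>y::real. (max 0 y)\<^sup>2) has_real_derivative 2 * max 0 y) (at y)" for y
  proof -
    consider "y > 0" | "y < 0" | "y = 0" by linarith
    then show ?thesis
    proof cases
      case 1
      have "((\<lambda>y::real. y\<^sup>2) has_real_derivative 2 * y) (at y)" by (auto intro!: derivative_eq_intros)
      then show ?thesis
      proof (rule DERIV_cong_ev[THEN iffD1, rotated 3, OF _ refl _ _])
        show "\<forall>\<^sub>F z in nhds y. z\<^sup>2 = (max 0 z)\<^sup>2"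
          using order_tendstoD(1)[OF filterlim_ident 1] by eventually_elim simp
      qed (use 1 in auto)
    next
      case 2
      have "((\<lambda>y::real. 0) has_real_derivative 0) (at y)" by simp
      then show ?thesis
      proof (rule DERIV_cong_ev[THEN iffD1, rotated 3, OF _ refl _ _])
        show "\<forall>\<^sub>F z in nhds y. 0 = (max 0 z)\<^sup>2"
          using order_tendstoD(2)[OF filterlim_ident 2] by eventually_elim simp
      qed (use 2 in auto)
    next
      \<comment> \<open>At the kink the difference quotient is at most |h| in modulus.\<close>
      case 3
      have "((\<lambda>h::real. (max 0 h)\<^sup>2 / h) \<longlongrightarrow> 0) (at 0)"
      proof (rule tendsto_norm_zero_cancel, rule tendsto_sandwich[of "\<lambda>_. 0" _ _ "\<lambda>h. \<bar>h\<bar>"])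
        show "\<forall>\<^sub>F h::real in at 0. norm ((max 0 h)\<^sup>2 / h) \<le> \<bar>h\<bar>"
          by (intro always_eventually allI) (simp add: max_def power2_eq_square)
        show "((\<lambda>h::real. \<bar>h\<bar>) \<longlongrightarrow> 0) (at 0)" using tendsto_rabs_zero[OF tendsto_ident_at] by simp
      qed auto
      then show ?thesis by (simp add: DERIV_def 3)
    qed
  qed
  have "((\<lambda>x. (x\<^sup>2 - a\<^sup>2) * (b\<^sup>2 - x\<^sup>2)) has_real_derivative (2 * x * (b\<^sup>2 - x\<^sup>2) - 2 * x * (x\<^sup>2 - a\<^sup>2))) (at x)"
    by (auto intro!: derivative_eq_intros simp: algebra_simps power2_eq_square power3_eq_cube)
  from DERIV_chain2[OF m this] show ?thesis by (simp add: bump_def[abs_def])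
qed

text \<open>f is truncated to a bounded function away from 0 and infinity, and a bump is factored
  out of it, leaving a bounded factor F. Continuous functions converging to F almost everywhere are
  clipped and replaced by polynomials. Multiplication by the bump puts these into the domain, and
  dominated convergence gives the norm.\<close>

lemma Dom_L_dense:
  assumes f: "f \<in> L2 W_sp" and e: "0 < e"
  shows "\<exists>g\<in>Dom_L \<union> {\<lambda>_. 0}. nrm W_sp (\<lambda>\<omega>. f \<omega> - g \<omega>) < e"
proof -
  have nsq: "(nrm M k)\<^sup>2 = (LINT x|M. (cmod (k x))\<^sup>2)" for M k by (simp add: nrm_square ip_self)
  have fm: "f \<in> borel_measurable lebesgue" using L2_measurable[OF f] by simp
  define A where "A = (\<lambda>n::nat. {x. 1 / real n \<le> \<bar>x\<bar> \<and> \<bar>x\<bar> \<le> real n \<and> cmod (f x) \<le> real n})"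
  define fn where "fn = (\<lambda>n x. if x \<in> A n then f x else 0)"
  have Am: "A n \<in> sets lebesgue" for n
  proof -
    have "(\<lambda>x. cmod (f x)) \<in> borel_measurable lebesgue" using fm by measurable
    then have "{x \<in> space lebesgue. cmod (f x) \<le> real n} \<in> sets lebesgue" by measurable
    moreover have "{x \<in> space lebesgue. 1 / real n \<le> \<bar>x\<bar> \<and> \<bar>x\<bar> \<le> real n} \<in> sets lebesgue"
      by (intro sets_completionI_sets) simp
    ultimately have "{x \<in> space lebesgue. cmod (f x) \<le> real n} \<inter> {x \<in> space lebesgue. 1 / real n \<le> \<bar>x\<bar> \<and> \<bar>x\<bar> \<le> real n} \<in> sets lebesgue"
      by (rule sets.Int)
    moreover have "A n = {x \<in> space lebesgue. cmod (f x) \<le> real n} \<inter> {x \<in> space lebesgue. 1 / real n \<le> \<bar>x\<bar> \<and> \<bar>x\<bar> \<le> real n}"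
      by (auto simp: A_def)
    ultimately show ?thesis by simp
  qed
  have fnm: "fn n \<in> borel_measurable lebesgue" for n
    unfolding fn_def using fm Am by (intro measurable_If_set) auto
  have "(\<lambda>n. LINT x|W_sp. (cmod (f x - fn n x))\<^sup>2) \<longlonglongrightarrow> (LINT x|W_sp. 0)"
  proof (rule integral_dominated_convergence[where w="\<lambda>x. (cmod (f x))\<^sup>2"])
    show "integrable W_sp (\<lambda>x. (cmod (f x))\<^sup>2)" using f by (simp add: L2_def)
    show "(\<lambda>x. (cmod (f x - fn n x))\<^sup>2) \<in> borel_measurable W_sp" for n
      unfolding borel_measurable_W_sp using fm fnm[of n] by measurable
    show "AE x in W_sp. norm ((cmod (f x - fn n x))\<^sup>2) \<le> (cmod (f x))\<^sup>2" for n
      by (intro AE_I2) (simp add: fn_def)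
    show "AE x in W_sp. (\<lambda>n. (cmod (f x - fn n x))\<^sup>2) \<longlonglongrightarrow> 0"
    proof (rule AE_W_sp, use AE_nonzero in eventually_elim)
      case (elim x)
      obtain N :: nat where N: "max (max (1 / \<bar>x\<bar>) \<bar>x\<bar>) (cmod (f x)) \<le> real N" using real_arch_simple by blast
      have "x \<in> A n" if "N \<le> n" for n
      proof -
        have n: "1 / \<bar>x\<bar> \<le> real n" "\<bar>x\<bar> \<le> real n" "cmod (f x) \<le> real n" using N that by simp_all
        have "0 < 1 / \<bar>x\<bar>" using elim by simp
        then have "0 < real n" using n(1) by linarith
        then have "1 / real n \<le> \<bar>x\<bar>" using n(1) elim by (simp add: field_simps)
        with n show ?thesis by (simp add: A_def)
      qed
      then show ?case by (intro tendsto_eventually eventually_sequentiallyI[of N]) (simp add: fn_def)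
    qed
  qed simp
  \<comment> \<open>Two errors of e^2 / 4, each doubled by |u + v|^2 \<le> 2 |u|^2 + 2 |v|^2, add up
    to e^2.\<close>
  then have "\<forall>\<^sub>F n in sequentially. (LINT x|W_sp. (cmod (f x - fn n x))\<^sup>2) < e\<^sup>2 / 4"
    using e by (intro order_tendstoD(2)) auto
  moreover have "\<forall>\<^sub>F n in sequentially. 1 \<le> n" by (rule eventually_ge_at_top)
  ultimately have "\<forall>\<^sub>F n in sequentially. (LINT x|W_sp. (cmod (f x - fn n x))\<^sup>2) < e\<^sup>2 / 4 \<and> 1 \<le> n" by (rule eventually_conj)
  then obtain n where n: "(LINT x|W_sp. (cmod (f x - fn n x))\<^sup>2) < e\<^sup>2 / 4" "1 \<le> n"
    by (auto dest: eventually_happens)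
  \<comment> \<open>Half the inner and twice the outer radius of \<open>A n\<close>: on
    \<open>A n\<close> the two factors of the quartic are at least 3 / (4 n^2) and 3 n^2, with
    product 9 / 4, hence \<phi> is at least 1 there.\<close>
  define a where "a = 1 / (2 * real n)"
  define b where "b = 2 * real n"
  have ab: "0 < a" "0 < b" using n by (simp_all add: a_def b_def)
  define \<phi> where "\<phi> = bump a b"
  have \<phi>0: "\<phi> x = 0" if "\<bar>x\<bar> \<notin> {a..b}" for x
  proof -
    have "x\<^sup>2 < a\<^sup>2 \<and> x\<^sup>2 \<le> b\<^sup>2 \<or> b\<^sup>2 < x\<^sup>2 \<and> a\<^sup>2 \<le> x\<^sup>2"
    proof -
      have "a \<le> 1" "1 \<le> b" using n by (simp_all add: a_def b_def)
      then have "\<bar>x\<bar> < a \<and> \<bar>x\<bar> \<le> b \<or> b < \<bar>x\<bar> \<and> a \<le> \<bar>x\<bar>" using that by auto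
      then show ?thesis using ab power_strict_mono[of "\<bar>x\<bar>" a 2] power_mono[of "\<bar>x\<bar>" b 2]
          power_strict_mono[of b "\<bar>x\<bar>" 2] power_mono[of a "\<bar>x\<bar>" 2] by auto
    qed
    then have "(x\<^sup>2 - a\<^sup>2) * (b\<^sup>2 - x\<^sup>2) \<le> 0" by (auto simp: mult_le_0_iff)
    then show ?thesis by (simp add: \<phi>_def bump_def)
  qed
  have \<phi>1: "1 \<le> \<phi> x" if "x \<in> A n" for x
  proof -
    have x: "1 / real n \<le> \<bar>x\<bar>" "\<bar>x\<bar> \<le> real n" using that by (auto simp: A_def)
    have "(1 / real n)\<^sup>2 \<le> x\<^sup>2" using power_mono[OF x(1), of 2] by simp
    then have 1: "3 / (4 * (real n)\<^sup>2) \<le> x\<^sup>2 - a\<^sup>2" using n by (simp add: a_def power_divide power_mult_distrib field_simps)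
    have "x\<^sup>2 \<le> (real n)\<^sup>2" using power_mono[OF x(2), of 2] by simp
    then have 2: "3 * (real n)\<^sup>2 \<le> b\<^sup>2 - x\<^sup>2" by (simp add: b_def power_mult_distrib)
    have "(3 / (4 * (real n)\<^sup>2)) * (3 * (real n)\<^sup>2) \<le> (x\<^sup>2 - a\<^sup>2) * (b\<^sup>2 - x\<^sup>2)"
      using n order_trans[OF _ 1, of 0] by (intro mult_mono 1 2) auto
    then have "1 \<le> (x\<^sup>2 - a\<^sup>2) * (b\<^sup>2 - x\<^sup>2)" using n by simp
    then have "1 \<le> max 0 ((x\<^sup>2 - a\<^sup>2) * (b\<^sup>2 - x\<^sup>2))" by simp
    then show ?thesis unfolding \<phi>_def bump_def by (rule one_le_power)
  qed
  define \<phi>' where "\<phi>' = (\<lambda>x. 2 * max 0 ((x\<^sup>2 - a\<^sup>2) * (b\<^sup>2 - x\<^sup>2)) * (2 * x * (b\<^sup>2 - x\<^sup>2) - 2 * x * (x\<^sup>2 - a\<^sup>2)))"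
  have d\<phi>: "((\<lambda>x. complex_of_real (\<phi> x)) has_vector_derivative of_real (\<phi>' x)) (at x)" for x
    using bump_deriv[of a b x] unfolding \<phi>_def \<phi>'_def
    by (intro has_vector_derivative_of_real) (simp add: has_real_derivative_iff_has_vector_derivative)
  have \<phi>'0: "\<phi>' x = 0" if "\<bar>x\<bar> \<notin> {a..b}" for x
    using \<phi>0[OF that] by (simp add: \<phi>_def bump_def \<phi>'_def)
  have c\<phi>': "continuous_on UNIV \<phi>'" unfolding \<phi>'_def by (intro continuous_intros)
  have c\<phi>: "continuous_on UNIV \<phi>" unfolding \<phi>_def bump_def[abs_def] by (intro continuous_intros)
  have poly: "(\<lambda>x. of_real (\<phi> x) * p x) \<in> Dom_L \<union> {\<lambda>_. 0}" if p: "polynomial_function p" for p :: "real \<Rightarrow> complex"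
  proof -
    obtain p' where p': "polynomial_function p'" "\<And>x. (p has_vector_derivative p' x) (at x)"
      using has_vector_derivative_polynomial_function[OF p] by blast
    show ?thesis
    proof (rule C1_compact_support_in_Dom_L)
      show "((\<lambda>x. of_real (\<phi> x) * p x) has_vector_derivative of_real (\<phi> x) * p' x + of_real (\<phi>' x) * p x) (at x)" for x
        by (intro has_vector_derivative_mult d\<phi> p')
      show "continuous_on UNIV (\<lambda>x. of_real (\<phi> x) * p' x + of_real (\<phi>' x) * p x)"
        using continuous_on_polymonial_function[OF p] continuous_on_polymonial_function[OF p'(1)]
        by (intro continuous_intros c\<phi> c\<phi>')
    qed (use ab \<phi>0 \<phi>'0 in auto)
  qed
  have \<phi>W: "(\<lambda>x. complex_of_real (\<phi> x)) \<in> L2 W_sp"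
  proof -
    have "polynomial_function (\<lambda>_::real. 1::complex)" by simp
    from poly[OF this] show ?thesis unfolding Dom_L_Un_zero by simp
  qed
  \<comment> \<open>Division is safe because \<phi> is at least 1 on \<open>A n\<close> and
    \<open>fn n\<close> is 0 elsewhere; this also keeps the bound n.\<close>
  define F where "F = (\<lambda>x. fn n x / of_real (\<phi> x))"
  have F: "cmod (F x) \<le> real n" "of_real (\<phi> x) * F x = fn n x" for x
  proof -
    have "cmod (F x) \<le> real n \<and> of_real (\<phi> x) * F x = fn n x"
    proof (cases "x \<in> A n")
      case True
      have "cmod (F x) = cmod (f x) / \<phi> x" using True \<phi>1[OF True] by (simp add: F_def fn_def norm_divide)
      also have "\<dots> \<le> cmod (f x) / 1" using \<phi>1[OF True] by (intro divide_left_mono) auto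
      finally show ?thesis using True \<phi>1[OF True] by (auto simp: F_def A_def)
    qed (simp add: F_def fn_def)
    then show "cmod (F x) \<le> real n" "of_real (\<phi> x) * F x = fn n x" by auto
  qed
  have \<phi>m: "(\<lambda>x. complex_of_real (\<phi> x)) \<in> borel_measurable lebesgue"
    using L2_measurable[OF \<phi>W] by simp
  have Fm: "F \<in> borel_measurable lebesgue"
    unfolding F_def by (intro borel_measurable_divide fnm \<phi>m)
  have "F measurable_on UNIV" by (rule lebesgue_measurable_imp_measurable_on[OF Fm]) simp
  then obtain N g where N: "negligible N" and g: "\<And>k. continuous_on UNIV (g k)"
    "\<And>x. x \<notin> N \<Longrightarrow> (\<lambda>k. g k x) \<longlonglongrightarrow> F x"
    unfolding measurable_on_def by auto
  \<comment> \<open>Radial projection onto the disc of radius n. It fixes the values of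
    \<open>F\<close>, so the pointwise limit survives, and it provides the uniform bound that
    dominated convergence needs.\<close>
  define cl where "cl = (\<lambda>z::complex. z / of_real (max 1 (cmod z / real n)))"
  have ccl: "continuous_on UNIV cl"
    unfolding cl_def using n by (intro continuous_intros) auto
  have cl: "cmod (cl z) \<le> real n" for z
  proof -
    have "cmod (cl z) = cmod z / max 1 (cmod z / real n)" by (simp add: cl_def norm_divide)
    also have "\<dots> \<le> real n" using n by (simp add: max_def field_simps) 
    finally show ?thesis .
  qed
  have clF: "cl (F x) = F x" for x
  proof -
    have "cmod (F x) / real n \<le> 1" using F(1)[of x] n by simp
    then have "max 1 (cmod (F x) / real n) = 1" by simp
    then show ?thesis by (simp add: cl_def)
  qed
  \<comment> \<open>The interval [-b, b] contains the support of \<phi>. Errors below 1 / (k + 1)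
    preserve the limit and keep the polynomials below n + 1 there.\<close>
  have "\<exists>p. polynomial_function p \<and> (\<forall>x\<in>{-b..b}. cmod (cl (g k x) - p x) < 1 / Suc k)" for k
    by (rule Stone_Weierstrass_polynomial_function)
      (auto intro!: continuous_on_compose2[OF ccl] continuous_on_subset[OF g(1)])
  then obtain p where p: "\<And>k. polynomial_function (p k)"
    "\<And>k x. x \<in> {-b..b} \<Longrightarrow> cmod (cl (g k x) - p k x) < 1 / Suc k" by metis
  have pm: "p k \<in> borel_measurable lebesgue" for k
    using continuous_on_polymonial_function[OF p(1)] by (intro borel_measurable_lebesgueI borel_measurable_continuous_onI)
  have pb: "cmod (p k x) \<le> real n + 1" if "x \<in> {-b..b}" for k x
  proof -
    have "cmod (p k x) \<le> cmod (cl (g k x)) + cmod (cl (g k x) - p k x)"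
      using norm_triangle_ineq4[of "cl (g k x)" "cl (g k x) - p k x"] by simp
    moreover have "1 / real (Suc k) \<le> 1" by simp
    ultimately show ?thesis using cl[of "g k x"] p(2)[OF that, of k] by linarith
  qed
  \<comment> \<open>On [-b, b] the modulus of \<open>F\<close> is at most n and that of
    \<open>p k\<close> at most n + 1; outside, \<phi> is 0.\<close>
  define w where "w = (\<lambda>x. (2 * real n + 1)\<^sup>2 * (cmod (of_real (\<phi> x)))\<^sup>2)"
  have "(\<lambda>k. LINT x|W_sp. (cmod (fn n x - of_real (\<phi> x) * p k x))\<^sup>2) \<longlonglongrightarrow> (LINT x|W_sp. 0)"
  proof (rule integral_dominated_convergence[where w=w])
    show "integrable W_sp w" using \<phi>W by (simp add: L2_def w_def)
    show "(\<lambda>x. (cmod (fn n x - of_real (\<phi> x) * p k x))\<^sup>2) \<in> borel_measurable W_sp" for k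
      unfolding borel_measurable_W_sp using fnm[of n] pm[of k] \<phi>m by measurable
    have eq: "fn n x - of_real (\<phi> x) * p k x = of_real (\<phi> x) * (F x - p k x)" for k x
      by (simp add: right_diff_distrib F)
    show "AE x in W_sp. norm ((cmod (fn n x - of_real (\<phi> x) * p k x))\<^sup>2) \<le> w x" for k
    proof (rule AE_I2)
      fix x
      show "norm ((cmod (fn n x - of_real (\<phi> x) * p k x))\<^sup>2) \<le> w x"
      proof (cases "x \<in> {-b..b}")
        case True
        have "cmod (F x - p k x) \<le> 2 * real n + 1"
          using norm_triangle_ineq4[of "F x" "p k x"] F(1)[of x] pb[OF True, of k] by linarith
        then have "(cmod (F x - p k x))\<^sup>2 \<le> (2 * real n + 1)\<^sup>2" by (intro power_mono) auto
        then have "(cmod (F x - p k x))\<^sup>2 * (\<phi> x)\<^sup>2 \<le> (2 * real n + 1)\<^sup>2 * (\<phi> x)\<^sup>2" by (rule mult_right_mono) simp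
        then show ?thesis unfolding eq by (simp add: w_def norm_mult power_mult_distrib mult.commute)
      next
        case False
        then have "\<phi> x = 0" by (intro \<phi>0) auto
        then show ?thesis unfolding eq by (simp add: w_def)
      qed
    qed
    have "AE x in lebesgue. x \<notin> N"
      using N by (simp add: negligible_iff_null_sets AE_not_in)
    then show "AE x in W_sp. (\<lambda>k. (cmod (fn n x - of_real (\<phi> x) * p k x))\<^sup>2) \<longlonglongrightarrow> 0"
    proof (rule AE_W_sp[OF eventually_mono])
      fix x assume x: "x \<notin> N"
      show "(\<lambda>k. (cmod (fn n x - of_real (\<phi> x) * p k x))\<^sup>2) \<longlonglongrightarrow> 0"
      proof (cases "x \<in> {-b..b}")
        case True
        have "isCont cl (F x)" using ccl by (simp add: continuous_on_eq_continuous_at)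
        then have "(\<lambda>k. cl (g k x)) \<longlonglongrightarrow> cl (F x)" by (rule isCont_tendsto_compose) (rule g(2)[OF x])
        moreover have "(\<lambda>k. cl (g k x) - p k x) \<longlonglongrightarrow> 0"
        proof (rule tendsto_norm_zero_cancel, rule tendsto_sandwich[of "\<lambda>_. 0" _ _ "\<lambda>k. 1 / Suc k"])
          show "\<forall>\<^sub>F k in sequentially. norm (cl (g k x) - p k x) \<le> 1 / Suc k"
            using p(2)[OF True] by (intro always_eventually allI) (simp add: less_imp_le)
          show "(\<lambda>k. 1 / real (Suc k)) \<longlonglongrightarrow> 0" by (rule LIMSEQ_Suc[OF lim_1_over_n])
        qed auto
        ultimately have "(\<lambda>k. cl (g k x) - (cl (g k x) - p k x)) \<longlonglongrightarrow> cl (F x) - 0" by (rule tendsto_diff)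
        then have "(\<lambda>k. p k x) \<longlonglongrightarrow> F x" by (simp add: clF)
        then have "(\<lambda>k. (cmod (of_real (\<phi> x) * (F x - p k x)))\<^sup>2) \<longlonglongrightarrow> (cmod (of_real (\<phi> x) * (F x - F x)))\<^sup>2"
          by (intro tendsto_intros)
        then show ?thesis unfolding eq by simp
      next
        case False
        then have "\<phi> x = 0" by (intro \<phi>0) auto
        then show ?thesis unfolding eq by simp
      qed
    qed
  qed simp
  then have "\<forall>\<^sub>F k in sequentially. (LINT x|W_sp. (cmod (fn n x - of_real (\<phi> x) * p k x))\<^sup>2) < e\<^sup>2 / 4"
    using e by (intro order_tendstoD(2)) auto
  then obtain k where k: "(LINT x|W_sp. (cmod (fn n x - of_real (\<phi> x) * p k x))\<^sup>2) < e\<^sup>2 / 4"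
    by (auto dest: eventually_happens)
  define G where "G = (\<lambda>x. of_real (\<phi> x) * p k x)"
  have GV: "G \<in> Dom_L \<union> {\<lambda>_. 0}" unfolding G_def by (rule poly[OF p(1)])
  then have GW: "G \<in> L2 W_sp" unfolding Dom_L_Un_zero by simp
  have fnW: "fn n \<in> L2 W_sp"
    by (rule L2_dominated[OF f]) (use fnm[of n] in \<open>auto simp: fn_def\<close>)
  have int: "integrable W_sp (\<lambda>x. (cmod (k x))\<^sup>2)" if "k \<in> L2 W_sp" for k using that by (simp add: L2_def)
  have "(nrm W_sp (\<lambda>x. f x - G x))\<^sup>2 = (LINT x|W_sp. (cmod (f x - G x))\<^sup>2)" by (rule nsq)
  also have "\<dots> \<le> (LINT x|W_sp. 2 * (cmod (f x - fn n x))\<^sup>2 + 2 * (cmod (fn n x - G x))\<^sup>2)"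
  proof (rule integral_mono)
    show "integrable W_sp (\<lambda>x. (cmod (f x - G x))\<^sup>2)" by (intro int L2_diff f GW)
    show "integrable W_sp (\<lambda>x. 2 * (cmod (f x - fn n x))\<^sup>2 + 2 * (cmod (fn n x - G x))\<^sup>2)"
      by (intro Bochner_Integration.integrable_add integrable_mult_right int L2_diff f fnW GW)
    fix x
    have "cmod (f x - G x) \<le> cmod (f x - fn n x) + cmod (fn n x - G x)"
      using norm_triangle_ineq[of "f x - fn n x" "fn n x - G x"] by simp
    then have "(cmod (f x - G x))\<^sup>2 \<le> (cmod (f x - fn n x) + cmod (fn n x - G x))\<^sup>2" by (rule power_mono) simp
    also have "\<dots> \<le> 2 * (cmod (f x - fn n x))\<^sup>2 + 2 * (cmod (fn n x - G x))\<^sup>2"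
      using sum_squares_bound[of "cmod (f x - fn n x)" "cmod (fn n x - G x)"] by (simp add: power2_sum)
    finally show "(cmod (f x - G x))\<^sup>2 \<le> 2 * (cmod (f x - fn n x))\<^sup>2 + 2 * (cmod (fn n x - G x))\<^sup>2" .
  qed
  also have "\<dots> = 2 * (LINT x|W_sp. (cmod (f x - fn n x))\<^sup>2) + 2 * (LINT x|W_sp. (cmod (fn n x - G x))\<^sup>2)"
    using int[OF L2_diff[OF f fnW]] int[OF L2_diff[OF fnW GW]] by simp
  also have "\<dots> < e\<^sup>2" using n(1) k by (simp add: G_def)
  finally have "(nrm W_sp (\<lambda>x. f x - G x))\<^sup>2 < e\<^sup>2" .
  then have "nrm W_sp (\<lambda>x. f x - G x) < e" by (rule power2_less_imp_less) (use e in simp)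
  then show ?thesis by (intro bexI[OF _ GV])
qed

lemma dense_Dom_L: "dense_real_subspace W_sp (Dom_L \<union> {\<lambda>_. 0})"
  unfolding dense_real_subspace_def
proof (intro conjI ballI allI impI)
  show "Dom_L \<union> {\<lambda>_. 0} \<subseteq> L2 W_sp" unfolding Dom_L_Un_zero by blast
  show "(\<lambda>_. 0) \<in> Dom_L \<union> {\<lambda>_. 0}" by simp
qed (rule Dom_L_linear Dom_L_dense; assumption)+

section \<open>The gradients\<close>

text \<open>The gradient of \<open>f \<mapsto> var M T (f / |f|)\<close> for symmetric \<open>T\<close>, where \<open>A\<close> stands for
  \<open>T\<^sup>2 f\<close>: it is \<open>2 ((T - e)\<^sup>2 - v) f / |f|\<^sup>2\<close>.\<close>

definition grad_var :: "real measure \<Rightarrow> oper \<Rightarrow> (real \<Rightarrow> complex) \<Rightarrow> oper" where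
  "grad_var M T A f = (\<lambda>x. 2 * (A x - 2 * expval M T (unit M f) * T f x + (expval M T (unit M f))\<^sup>2 * f x
      - of_real (var M T (unit M f)) * f x) / of_real ((nrm M f)\<^sup>2))"

lemma grad_var_L2:
  assumes "A \<in> L2 M" "T f \<in> L2 M" "f \<in> L2 M"
  shows "grad_var M T A f \<in> L2 M"
  unfolding grad_var_def mult.assoc by (intro L2_divide L2_cmult L2_diff L2_add assms)

lemma abs_grad_var_L2:
  assumes "(\<lambda>x. of_real \<bar>x\<bar> * A x) \<in> L2 N" "(\<lambda>x. of_real \<bar>x\<bar> * T f x) \<in> L2 N" "(\<lambda>x. of_real \<bar>x\<bar> * f x) \<in> L2 N"
  shows "(\<lambda>x. of_real \<bar>x\<bar> * grad_var M T A f x) \<in> L2 N"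
proof -
  have "(\<lambda>x. of_real \<bar>x\<bar> * grad_var M T A f x) = (\<lambda>x. 2 * (of_real \<bar>x\<bar> * A x
      - 2 * expval M T (unit M f) * (of_real \<bar>x\<bar> * T f x) + (expval M T (unit M f))\<^sup>2 * (of_real \<bar>x\<bar> * f x)
      - of_real (var M T (unit M f)) * (of_real \<bar>x\<bar> * f x)) / of_real ((nrm M f)\<^sup>2))"
    by (simp add: grad_var_def fun_eq_iff divide_inverse algebra_simps)
  also have "\<dots> \<in> L2 N" by (intro L2_divide L2_cmult L2_diff L2_add assms)
  finally show ?thesis .
qed

text \<open>Common form for \<S> and \<W>, which share the measurable functions and inherit Lebesgue
  null sets. Linearity almost everywhere on absolutely continuous functions yields all measurability
  and normalisation conditions of \<open>var_unit_line_deriv\<close>.\<close>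

lemma var_line_deriv:
  assumes M: "\<And>P. AE x in lebesgue. P x \<Longrightarrow> AE x in M. P x" "(borel_measurable M :: (real \<Rightarrow> complex) set) = borel_measurable lebesgue"
    and linT: "\<And>f h a b. loc_abs_cont f \<Longrightarrow> loc_abs_cont h \<Longrightarrow>
        AE x in lebesgue. T (\<lambda>x. a * f x + b * h x) x = a * T f x + b * T h x"
    and f: "loc_abs_cont f" "f \<in> L2 M" "T f \<in> L2 M" "0 < nrm M f"
    and h: "loc_abs_cont h" "h \<in> L2 M" "T h \<in> L2 M"
    and sym: "ip M (T h) f = ip M h (T f)" "ip M (T f) f = ip M f (T f)"
    and A: "A \<in> L2 M" "ip M (T f) (T h) = ip M A h"
  shows "((\<lambda>t. var M T (unit M (\<lambda>x. f x + of_real t * h x))) has_real_derivative Re (ip M (grad_var M T A f) h)) (at 0)"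
  unfolding grad_var_def
proof (rule var_unit_line_deriv[OF f(2,4) h(2) f(3) h(3) _ _ _ _ sym(1) _ A])
  fix t
  let ?g = "\<lambda>x. f x + of_real t * h x"
  have g: "loc_abs_cont ?g" by (intro loc_abs_cont_add loc_abs_cont_cmult f h)
  have 1: "AE x in lebesgue. T ?g x = T f x + of_real t * T h x"
    using linT[OF f(1) h(1), of 1 "of_real t"] by simp
  then show ae1: "AE x in M. T ?g x = T f x + of_real t * T h x" by (rule M(1))
  have lc: "(\<lambda>x. T f x + of_real t * T h x) \<in> L2 M" by (intro L2_add L2_cmult f h)
  then have lcm: "(\<lambda>x. T f x + of_real t * T h x) \<in> borel_measurable lebesgue" using L2_measurable[OF lc] by (simp only: M(2))
  have gm: "T ?g \<in> borel_measurable lebesgue"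
    by (rule borel_measurable_AE[OF lcm]) (use 1 in eventually_elim, simp)
  show "T ?g \<in> L2 M" by (rule L2_cong_AE[OF lc _ ae1]) (simp only: M(2) gm)
  \<comment> \<open>Normalisation is written as a linear combination with a zero second term, so
    that the linearity hypothesis covers it.\<close>
  have u: "unit M ?g = (\<lambda>x. (1 / of_real (nrm M ?g)) * ?g x + 0 * ?g x)" by (simp add: unit_def)
  have 2: "AE x in lebesgue. T (unit M ?g) x = T ?g x / of_real (nrm M ?g)"
    unfolding u using linT[OF g g, of "1 / of_real (nrm M ?g)" 0] by simp
  then show "AE x in M. T (unit M ?g) x = T ?g x / of_real (nrm M ?g)" by (rule M(1))
  have "(\<lambda>x. T ?g x / of_real (nrm M ?g)) \<in> borel_measurable lebesgue"
    using gm by (intro borel_measurable_divide borel_measurable_const)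
  then have "T (unit M ?g) \<in> borel_measurable lebesgue"
    by (rule borel_measurable_AE) (use 2 in eventually_elim, simp)
  then show "T (unit M ?g) \<in> borel_measurable M" by (simp only: M(2))
next
  have "ip M (T f) f = cnj (ip M (T f) f)" using sym(2) ip_commute[of M f "T f"] by simp
  then show "Im (ip M (T f) f) = 0" by (simp add: complex_eq_iff)
qed

lemma mult_ln_linear: "AE x in lebesgue. mult_ln (\<lambda>x. a * f x + b * h x) x = a * mult_ln f x + b * mult_ln h x"
  by (simp add: mult_ln_def algebra_simps)

lemma iD_linear:
  assumes "loc_abs_cont f" "loc_abs_cont h"
  shows "AE x in lebesgue. iD (\<lambda>x. a * f x + b * h x) x = a * iD f x + b * iD h x"
  using AE_D_linear[OF assms, of a b] by eventually_elim (simp add: iD_def algebra_simps)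

lemma i\<omega>D_linear:
  assumes "loc_abs_cont f" "loc_abs_cont h"
  shows "AE x in lebesgue. i\<omega>D (\<lambda>x. a * f x + b * h x) x = a * i\<omega>D f x + b * i\<omega>D h x"
  using AE_D_linear[OF assms, of a b] by eventually_elim (simp add: i\<omega>D_def algebra_simps)

lemma ip_mult_ln: "ip M (mult_ln f) h = ip M f (mult_ln h)"
  by (simp add: ip_def mult_ln_def mult_ac)

definition ln_sq :: oper where
  "ln_sq f = (\<lambda>x. of_real ((ln \<bar>x\<bar>)\<^sup>2) * f x)"

lemma ip_ln_sq: "ip M (mult_ln f) (mult_ln h) = ip M (ln_sq f) h"
  by (simp add: ip_def mult_ln_def ln_sq_def power2_eq_square mult_ac)

text \<open>\<open>(i\<omega>\<partial>)\<^sup>2 = - \<omega>\<^sup>2\<partial>\<^sup>2 - \<omega>\<partial>\<close>.\<close>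

definition i\<omega>D_sq :: oper where
  "i\<omega>D_sq f = (\<lambda>x. - of_real (x\<^sup>2) * D (D f) x - of_real x * D f x)"

text \<open>One integration by parts moves the derivative from h, which is only absolutely
  continuous, onto \<open>D f\<close>.\<close>

lemma ip_iD_sq:
  assumes f: "f \<in> Dom_delta" and h: "h \<in> Dom_L"
  shows "ip S_sp (iD f) (iD h) = ip S_sp (\<lambda>x. - D (D f) x) h"
proof -
  note F = Dom_delta_D[OF f] and E = Dom_delta_deriv[OF f] and H = Dom_L_facts[OF h]
  have i: "integrable lebesgue (\<lambda>x. D f x * cnj (D h x))" "integrable lebesgue (\<lambda>x. D (D f) x * cnj (h x))"
    "integrable lebesgue (\<lambda>x. D f x * cnj (h x))"
    using F E H by (auto intro: ip_integrable)
  have "(LINT x|lebesgue. D f x * cnj (D h x) + D (D f) x * cnj (h x)) = 0"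
  proof (rule integral_derivative_eq_0)
    show "loc_abs_cont (\<lambda>x. D f x * cnj (h x))" by (intro loc_abs_cont_mult loc_abs_cont_cnj F H)
    show "AE x in lebesgue. ((\<lambda>x. D f x * cnj (h x)) has_vector_derivative D f x * cnj (D h x) + D (D f) x * cnj (h x)) (at x)"
      using loc_abs_cont_AE_vector_derivative[OF F(2)] loc_abs_cont_AE_vector_derivative[OF H(1)]
      by eventually_elim (rule has_vector_derivative_mult_cnj)
    show "integrable lebesgue (\<lambda>x. D f x * cnj (h x) / of_real (1 + \<bar>x\<bar>))"
      by (rule integrable_divide_weight[OF i(3)])
  qed (use i in auto)
  then have "(LINT x|lebesgue. D f x * cnj (D h x)) = - (LINT x|lebesgue. D (D f) x * cnj (h x))"
    using i by (simp add: add_eq_0_iff)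
  then show ?thesis by (simp add: ip_def iD_def mult_ac)
qed

lemma has_vector_derivative_abs:
  assumes "x \<noteq> 0"
  shows "((\<lambda>x. complex_of_real \<bar>x\<bar>) has_vector_derivative of_real (sgn x)) (at x)"
proof (rule has_vector_derivative_of_real)
  have "(abs has_real_derivative sgn x) (at x)"
  proof (cases "x > 0")
    case True
    have "((\<lambda>x. x) has_real_derivative 1) (at x)" by (rule DERIV_ident)
    moreover have "\<forall>\<^sub>F y in nhds x. y = \<bar>y\<bar>"
      using order_tendstoD(1)[OF filterlim_ident True] by eventually_elim simp
    ultimately show ?thesis using DERIV_cong_ev[of x x "\<lambda>x. x" abs 1 1] True by simp
  next
    case False
    then have x: "x < 0" using assms by simp
    have "((\<lambda>x. - x) has_real_derivative - 1) (at x)" by (auto intro!: derivative_eq_intros)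
    moreover have "\<forall>\<^sub>F y in nhds x. - y = \<bar>y\<bar>"
      using order_tendstoD(2)[OF filterlim_ident x] by eventually_elim simp
    ultimately show ?thesis using DERIV_cong_ev[of x x "\<lambda>x. - x" abs "- 1" "- 1"] x by simp
  qed
  then show "((\<lambda>x. \<bar>x\<bar>) has_real_derivative sgn x) (at x)" by simp
qed

lemma integrable_ip_W:
  assumes "f \<in> L2 W_sp" "g \<in> L2 W_sp"
  shows "integrable lebesgue (\<lambda>x. of_real (1 / \<bar>x\<bar>) * (f x * cnj (g x)))"
proof -
  have m: "(\<lambda>x::real. 1 / \<bar>x\<bar>) \<in> borel_measurable lebesgue" by (rule borel_measurable_lebesgueI) measurable
  have "(\<lambda>x. f x * cnj (g x)) \<in> borel_measurable lebesgue"
    using assms[THEN L2_measurable] by (intro borel_measurable_times borel_measurable_cnj) auto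
  then show ?thesis
    using ip_integrable[OF assms] m unfolding W_sp_def
    by (subst (asm) integrable_density) (auto simp: scaleR_conv_of_real)
qed

lemma L2_W_I:
  assumes "k \<in> L2 S_sp" "g \<in> borel_measurable lebesgue"
    and "\<And>x. x \<noteq> 0 \<Longrightarrow> cmod (of_real (1 / sqrt \<bar>x\<bar>) * g x) = cmod (k x)"
  shows "g \<in> L2 W_sp"
  unfolding L2_W_iff
proof (rule L2_dominated[OF assms(1)])
  have "(\<lambda>x::real. complex_of_real (1 / sqrt \<bar>x\<bar>)) \<in> borel_measurable lebesgue"
    by (rule borel_measurable_lebesgueI) measurable
  then show "(\<lambda>x. of_real (1 / sqrt \<bar>x\<bar>) * g x) \<in> borel_measurable lebesgue"
    using assms(2) by (intro borel_measurable_times)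
  show "AE x in lebesgue. cmod (of_real (1 / sqrt \<bar>x\<bar>) * g x) \<le> cmod (k x)"
    using AE_nonzero by eventually_elim (simp add: assms(3) del: of_real_divide)
qed

lemma measurable_weight_mult:
  assumes "m \<in> borel_measurable borel" "g \<in> borel_measurable lebesgue"
  shows "(\<lambda>x. complex_of_real (m x) * g x) \<in> borel_measurable lebesgue"
proof -
  have "(\<lambda>x. complex_of_real (m x)) \<in> borel_measurable lebesgue"
    by (rule borel_measurable_lebesgueI) (use assms(1) in measurable)
  then show ?thesis using assms(2) by (intro borel_measurable_times)
qed

lemma L2_W_weight:
  assumes k: "(\<lambda>x. of_real (k x) * g x) \<in> L2 S_sp" and g: "g \<in> borel_measurable lebesgue"
    and m: "m \<in> borel_measurable borel" "\<And>x. x \<noteq> 0 \<Longrightarrow> \<bar>m x\<bar> / sqrt \<bar>x\<bar> = \<bar>k x\<bar>"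
  shows "(\<lambda>x. of_real (m x) * g x) \<in> L2 W_sp"
proof (rule L2_W_I[OF k measurable_weight_mult[OF m(1) g]])
  fix x :: real assume "x \<noteq> 0"
  from m(2)[OF this] have "\<bar>m x\<bar> / sqrt \<bar>x\<bar> * cmod (g x) = \<bar>k x\<bar> * cmod (g x)" by simp
  then show "cmod (of_real (1 / sqrt \<bar>x\<bar>) * (of_real (m x) * g x)) = cmod (of_real (k x) * g x)"
    by (simp add: norm_mult norm_divide)
qed

text \<open>These are the terms of the gradients. Each weight m in \<W> is the weight m / sqrt |x|
  in \<S>, where the earlier estimates apply.\<close>

lemma Dom_delta_W:
  assumes f: "f \<in> Dom_delta"
  shows "(\<lambda>x. of_real \<bar>x\<bar> * ln_sq f x) \<in> L2 W_sp" "(\<lambda>x. of_real \<bar>x\<bar> * mult_ln f x) \<in> L2 W_sp"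
    "(\<lambda>x. of_real \<bar>x\<bar> * f x) \<in> L2 W_sp" "ln_sq f \<in> L2 W_sp" "ln_sq f \<in> L2 S_sp"
    "(\<lambda>x. of_real \<bar>x\<bar> * - D (D f) x) \<in> L2 W_sp" "(\<lambda>x. of_real \<bar>x\<bar> * iD f x) \<in> L2 W_sp"
    "i\<omega>D_sq f \<in> L2 W_sp" "(\<lambda>x. of_real (1 / \<bar>x\<bar>) * f x) \<in> L2 W_sp"
proof -
  note F = Dom_delta_D[OF f] and W = Dom_delta_weights[OF f] and E = Dom_delta_deriv[OF f]
  note X = Dom_L_facts[OF Dom_delta_subset_Dom_L[OF f]]
  have fm: "f \<in> borel_measurable lebesgue" "D f \<in> borel_measurable lebesgue" "D (D f) \<in> borel_measurable lebesgue"
    using F by (auto intro: loc_abs_cont_measurable)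
  have sq: "\<bar>x\<bar> / sqrt \<bar>x\<bar> = sqrt \<bar>x\<bar>" for x :: real by (simp add: real_div_sqrt)
  \<comment> \<open>This power is the one in the combined second-order condition of
    \<open>Dom_delta\<close>.\<close>
  have sq3: "x\<^sup>2 / sqrt \<bar>x\<bar> = \<bar>x\<bar> powr (3/2)" if "x \<noteq> 0" for x :: real
  proof -
    have "\<bar>x\<bar> powr (3/2) = \<bar>x\<bar> powr (1 + 1/2)" by simp
    also have "\<dots> = \<bar>x\<bar> * sqrt \<bar>x\<bar>" using that by (subst powr_add) (simp add: powr_half_sqrt)
    also have "\<dots> = \<bar>x\<bar> * (\<bar>x\<bar> / sqrt \<bar>x\<bar>)" by (simp only: sq)
    also have "\<dots> = x\<^sup>2 / sqrt \<bar>x\<bar>"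
      by (simp only: times_divide_eq_right abs_mult_self_eq power2_eq_square)
    finally show ?thesis by simp
  qed
  have "(\<lambda>x. of_real (\<bar>x\<bar> * (ln \<bar>x\<bar>)\<^sup>2) * f x) \<in> L2 W_sp"
    by (rule L2_W_weight[OF W(10) fm(1)]) (auto simp: abs_mult sq times_divide_eq_left[symmetric] simp del: times_divide_eq_left)
  then show "(\<lambda>x. of_real \<bar>x\<bar> * ln_sq f x) \<in> L2 W_sp" by (simp add: ln_sq_def mult.assoc)
  have "(\<lambda>x. of_real (\<bar>x\<bar> * ln \<bar>x\<bar>) * f x) \<in> L2 W_sp"
    by (rule L2_W_weight[OF W(9) fm(1)]) (auto simp: abs_mult sq times_divide_eq_left[symmetric] simp del: times_divide_eq_left)
  then show "(\<lambda>x. of_real \<bar>x\<bar> * mult_ln f x) \<in> L2 W_sp" by (simp add: mult_ln_def mult.assoc)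
  show "(\<lambda>x. of_real \<bar>x\<bar> * f x) \<in> L2 W_sp"
    by (rule L2_W_weight[OF W(4) fm(1)]) (auto simp: sq)
  show "ln_sq f \<in> L2 W_sp" unfolding ln_sq_def
    by (rule L2_W_weight[OF W(6) fm(1)]) auto
  show "ln_sq f \<in> L2 S_sp" using W(5) by (simp add: ln_sq_def)
  have "(\<lambda>x. - 1 * (of_real \<bar>x\<bar> * D (D f) x)) \<in> L2 W_sp"
    by (intro L2_cmult L2_W_weight[OF E(3) fm(3)]) (auto simp: sq)
  then show "(\<lambda>x. of_real \<bar>x\<bar> * - D (D f) x) \<in> L2 W_sp" by simp
  have "(\<lambda>x. \<i> * (of_real \<bar>x\<bar> * D f x)) \<in> L2 W_sp"
    by (intro L2_cmult L2_W_weight[OF E(2) fm(2)]) (auto simp: sq)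
  then show "(\<lambda>x. of_real \<bar>x\<bar> * iD f x) \<in> L2 W_sp" by (simp add: iD_def mult.left_commute)
  have "(\<lambda>x. - 1 * (of_real (x\<^sup>2) * D (D f) x) - of_real x * D f x) \<in> L2 W_sp"
  proof (intro L2_diff L2_cmult)
    show "(\<lambda>x. of_real (x\<^sup>2) * D (D f) x) \<in> L2 W_sp"
      by (rule L2_W_weight[OF E(4) fm(3)]) (auto simp: sq3)
    show "(\<lambda>x. of_real x * D f x) \<in> L2 W_sp"
      by (rule L2_W_weight[OF E(2) fm(2)]) (auto simp: sq)
  qed
  then show "i\<omega>D_sq f \<in> L2 W_sp" by (simp add: i\<omega>D_sq_def)
  show "(\<lambda>x. of_real (1 / \<bar>x\<bar>) * f x) \<in> L2 W_sp"
    by (rule L2_W_weight[OF W(3) fm(1)]) auto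
qed

text \<open>The difference of the two integrands is the derivative of |x| f' times the conjugate of
  h, where |x| is x^2 times the density. The factor |x| vanishes at 0 and is Lipschitz, so the line
  need not be split.\<close>

lemma ip_i\<omega>D_sq:
  assumes f: "f \<in> Dom_delta" and h: "h \<in> Dom_L"
  shows "ip W_sp (i\<omega>D f) (i\<omega>D h) = ip W_sp (i\<omega>D_sq f) h"
proof -
  note F = Dom_delta_D[OF f] and E = Dom_delta_deriv[OF f] and H = Dom_L_facts[OF h]
  note X = Dom_L_facts[OF Dom_delta_subset_Dom_L[OF f]] and W = Dom_delta_W[OF f]
  define l where "l = (\<lambda>x. of_real (1 / \<bar>x\<bar>) * (i\<omega>D f x * cnj (i\<omega>D h x)))"
  define r where "r = (\<lambda>x. of_real (1 / \<bar>x\<bar>) * (i\<omega>D_sq f x * cnj (h x)))"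
  have int: "integrable lebesgue l" "integrable lebesgue r"
    unfolding l_def r_def by (intro integrable_ip_W X H W)+
  have "(LINT x|lebesgue. l x - r x) = 0"
  proof (rule integral_derivative_eq_0)
    let ?G = "\<lambda>x. of_real \<bar>x\<bar> * (D f x * cnj (h x))"
    have "loc_abs_cont (\<lambda>x. complex_of_real \<bar>x\<bar>)"
      unfolding loc_abs_cont_iff
    proof (intro allI, rule lipschitz_imp_abs_cont[where M=1])
      fix x y :: real
      have "norm (complex_of_real \<bar>y\<bar> - complex_of_real \<bar>x\<bar>) = \<bar>\<bar>y\<bar> - \<bar>x\<bar>\<bar>"
        by (simp only: of_real_diff[symmetric] norm_of_real)
      then show "norm (complex_of_real \<bar>y\<bar> - complex_of_real \<bar>x\<bar>) \<le> 1 * \<bar>y - x\<bar>" by simp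
    qed
    then show "loc_abs_cont ?G" by (intro loc_abs_cont_mult loc_abs_cont_cnj F H)
    show "AE x in lebesgue. (?G has_vector_derivative l x - r x) (at x)"
      using loc_abs_cont_AE_vector_derivative[OF F(2)] loc_abs_cont_AE_vector_derivative[OF H(1)] AE_nonzero
    proof eventually_elim
      case (elim x)
      have "(?G has_vector_derivative of_real \<bar>x\<bar> * (D f x * cnj (D h x) + D (D f) x * cnj (h x))
          + of_real (sgn x) * (D f x * cnj (h x))) (at x)"
        by (intro has_vector_derivative_mult has_vector_derivative_mult_cnj has_vector_derivative_abs elim)
      moreover have "of_real \<bar>x\<bar> * (D f x * cnj (D h x) + D (D f) x * cnj (h x))
          + of_real (sgn x) * (D f x * cnj (h x)) = l x - r x"
      proof -
        have 1: "complex_of_real (1 / \<bar>x\<bar>) * of_real x * of_real x = of_real \<bar>x\<bar>"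
          using elim(3) by (simp add: abs_if flip: of_real_mult of_real_divide)
        have 2: "complex_of_real (1 / \<bar>x\<bar>) * of_real x = of_real (sgn x)"
          by (simp add: sgn_if abs_if flip: of_real_mult of_real_divide)
        have l: "l x = (of_real (1 / \<bar>x\<bar>) * of_real x * of_real x) * (D f x * cnj (D h x))"
          unfolding l_def i\<omega>D_def by (simp add: mult_ac del: of_real_divide)
        have r: "r x = - (of_real (1 / \<bar>x\<bar>) * of_real x * of_real x) * (D (D f) x * cnj (h x))
           - (of_real (1 / \<bar>x\<bar>) * of_real x) * (D f x * cnj (h x))"
          unfolding r_def i\<omega>D_sq_def by (simp add: power2_eq_square algebra_simps del: of_real_divide)
        show ?thesis unfolding l r 1 unfolding 2 by (simp add: algebra_simps)
      qed
      ultimately show ?case by simp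
    qed
    \<comment> \<open>Integrability is known for f' times the conjugate of h, not with the extra
      factor |x|; the weight 1 + |x| in the boundary lemma is made for this case.\<close>
    show "integrable lebesgue (\<lambda>x. ?G x / of_real (1 + \<bar>x\<bar>))"
    proof (rule Bochner_Integration.integrable_bound)
      show k: "integrable lebesgue (\<lambda>x. D f x * cnj (h x))" by (intro ip_integrable E H)
      have "(\<lambda>x. of_real \<bar>x\<bar> / complex_of_real (1 + \<bar>x\<bar>) * (D f x * cnj (h x))) \<in> borel_measurable lebesgue"
        using measurable_weight_mult[of "\<lambda>x. \<bar>x\<bar> / (1 + \<bar>x\<bar>)"] k by simp
      then show "(\<lambda>x. ?G x / of_real (1 + \<bar>x\<bar>)) \<in> borel_measurable lebesgue" by simp
      have "norm (?G x / of_real (1 + \<bar>x\<bar>)) \<le> norm (D f x * cnj (h x))" for x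
      proof -
        have "norm (?G x / of_real (1 + \<bar>x\<bar>)) = (\<bar>x\<bar> / (1 + \<bar>x\<bar>)) * norm (D f x * cnj (h x))"
          by (simp only: norm_divide norm_mult norm_of_real) simp
        also have "\<dots> \<le> 1 * norm (D f x * cnj (h x))" by (intro mult_right_mono) auto
        finally show ?thesis by simp
      qed
      then show "AE x in lebesgue. norm (?G x / of_real (1 + \<bar>x\<bar>)) \<le> norm (D f x * cnj (h x))" by simp
    qed
  qed (intro Bochner_Integration.integrable_diff int)
  then have "(LINT x|lebesgue. l x) = (LINT x|lebesgue. r x)" using int by simp
  then show ?thesis
    using L2_measurable[OF X(6)] L2_measurable[OF H(6)] L2_measurable[OF W(8)] L2_measurable[OF H(3)]
    by (simp add: ip_W l_def r_def)
qed

section \<open>Variations along lines\<close>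

lemma has_variationI:
  assumes "f \<in> Dom_L" "g \<in> L2 W_sp"
    and "\<And>h. h \<in> Dom_L \<Longrightarrow> ((\<lambda>t. F (\<lambda>\<omega>. f \<omega> + of_real t * h \<omega>)) has_real_derivative Re (ip W_sp g h)) (at 0)"
  shows "has_variation W_sp Dom_L F f g"
  unfolding has_variation_def
proof (intro conjI ballI dense_Dom_L assms(1,2))
  fix h assume "h \<in> Dom_L"
  from assms(3)[OF this]
  show "((\<lambda>t. (F (\<lambda>\<omega>. f \<omega> + of_real t * h \<omega>) - F f) / t) \<longlongrightarrow> Re (ip W_sp g h)) (at 0)"
    unfolding DERIV_def by simp
qed

lemma var_derivs:
  assumes f: "f \<in> Dom_delta" and h: "h \<in> Dom_L"
  shows "((\<lambda>t. var S_sp mult_ln (unit S_sp (\<lambda>x. f x + of_real t * h x))) has_real_derivative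
      Re (ip S_sp (grad_var S_sp mult_ln (ln_sq f) f) h)) (at 0)" (is ?S_ln)
    "((\<lambda>t. var W_sp mult_ln (unit W_sp (\<lambda>x. f x + of_real t * h x))) has_real_derivative
      Re (ip W_sp (grad_var W_sp mult_ln (ln_sq f) f) h)) (at 0)" (is ?W_ln)
    "((\<lambda>t. var S_sp iD (unit S_sp (\<lambda>x. f x + of_real t * h x))) has_real_derivative
      Re (ip S_sp (grad_var S_sp iD (\<lambda>x. - D (D f) x) f) h)) (at 0)" (is ?S_D)
    "((\<lambda>t. var W_sp i\<omega>D (unit W_sp (\<lambda>x. f x + of_real t * h x))) has_real_derivative
      Re (ip W_sp (grad_var W_sp i\<omega>D (i\<omega>D_sq f) f) h)) (at 0)" (is ?W_D)
proof -
  have fL: "f \<in> Dom_L" by (rule Dom_delta_subset_Dom_L[OF f])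
  note X = Dom_L_facts[OF fL] and H = Dom_L_facts[OF h] and W = Dom_delta_W[OF f]
  have ddS: "(\<lambda>x. - D (D f) x) \<in> L2 S_sp"
    using L2_cmult[OF Dom_delta_D(5)[OF f], of "- 1"] by simp
  show ?S_ln
    by (rule var_line_deriv[where M=S_sp and T=mult_ln and A="ln_sq f" and f=f and h=h])
      (assumption | rule refl mult_ln_linear X(1,2,8,11) H(1,2,8) ip_mult_ln W(5) ip_ln_sq)+
  show ?W_ln
    by (rule var_line_deriv[where M=W_sp and T=mult_ln and A="ln_sq f" and f=f and h=h])
      (assumption | rule AE_W_sp borel_measurable_W_sp mult_ln_linear X(1,3,9,12) H(1,3,9) ip_mult_ln W(4) ip_ln_sq)+
  show ?S_D
    by (rule var_line_deriv[where M=S_sp and T=iD and A="\<lambda>x. - D (D f) x" and f=f and h=h])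
      (assumption | rule refl iD_linear X(1,2,5,11) H(1,2,5) iD_symmetric[OF fL h] iD_symmetric[OF fL fL] ddS ip_iD_sq[OF f h])+
  show ?W_D
    by (rule var_line_deriv[where M=W_sp and T=i\<omega>D and A="i\<omega>D_sq f" and f=f and h=h])
      (assumption | rule AE_W_sp borel_measurable_W_sp i\<omega>D_linear X(1,3,6,12) H(1,3,6)
        i\<omega>D_symmetric[OF fL h] i\<omega>D_symmetric[OF fL fL] W(8) ip_i\<omega>D_sq[OF f h])+
qed

text \<open>Without the two expected value conditions.\<close>

definition gen_grad_LA :: oper where
  "gen_grad_LA f = (\<lambda>x. of_real \<bar>x\<bar> * grad_var S_sp mult_ln (ln_sq f) f x + grad_var W_sp mult_ln (ln_sq f) f x)"

text \<open>The last summand is the variance in \<W> times the \<W>-gradient of the quotient of the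
  squared \<S>-norms of f / \<omega> and f, by the quotient rule; the weight 1 / \<omega>^2 in \<S>
  becomes 1 / |\<omega>| in \<W>.\<close>

definition gen_grad_LB :: oper where
  "gen_grad_LB f = (\<lambda>x. of_real \<bar>x\<bar> * grad_var S_sp iD (\<lambda>x. - D (D f) x) f x
     + of_real ((nrm S_sp (mult_inv f))\<^sup>2 / (nrm S_sp f)\<^sup>2) * grad_var W_sp i\<omega>D (i\<omega>D_sq f) f x
     + 2 * of_real (var W_sp i\<omega>D (unit W_sp f))
       * (of_real (1 / \<bar>x\<bar>) * (f x / of_real ((nrm S_sp f)\<^sup>2))
          - of_real (\<bar>x\<bar> * ((nrm S_sp (mult_inv f))\<^sup>2 / (nrm S_sp f) ^ 4)) * f x))"

lemma gen_grad_L2: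
  assumes f: "f \<in> Dom_delta"
  shows "gen_grad_LA f \<in> L2 W_sp" "gen_grad_LB f \<in> L2 W_sp"
proof -
  note X = Dom_L_facts[OF Dom_delta_subset_Dom_L[OF f]] and W = Dom_delta_W[OF f]
  show "gen_grad_LA f \<in> L2 W_sp"
    unfolding gen_grad_LA_def by (intro L2_add abs_grad_var_L2 grad_var_L2 W X)
  have "(\<lambda>x. of_real (1 / \<bar>x\<bar>) * (f x / of_real ((nrm S_sp f)\<^sup>2))
      - of_real (\<bar>x\<bar> * ((nrm S_sp (mult_inv f))\<^sup>2 / (nrm S_sp f) ^ 4)) * f x)
    = (\<lambda>x. of_real (1 / \<bar>x\<bar>) * f x / of_real ((nrm S_sp f)\<^sup>2)
      - of_real ((nrm S_sp (mult_inv f))\<^sup>2 / (nrm S_sp f) ^ 4) * (of_real \<bar>x\<bar> * f x))"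
    by (simp add: fun_eq_iff)
  also have "\<dots> \<in> L2 W_sp" by (intro L2_diff L2_divide L2_cmult W)
  finally show "gen_grad_LB f \<in> L2 W_sp"
    unfolding gen_grad_LB_def mult.assoc
    by (intro L2_add L2_cmult abs_grad_var_L2[of "\<lambda>x. - D (D f) x"] grad_var_L2 W X)
qed

lemma ip_S_abs:
  assumes "g \<in> L2 S_sp" "h \<in> L2 S_sp"
  shows "ip S_sp g h = ip W_sp (\<lambda>x. of_real \<bar>x\<bar> * g x) h"
  using assms by (intro ip_S_eq_ip_W) (auto dest: L2_measurable)

lemma LA_deriv:
  assumes f: "f \<in> Dom_delta" and h: "h \<in> Dom_L"
  shows "((\<lambda>t. LA (\<lambda>x. f x + of_real t * h x)) has_real_derivative Re (ip W_sp (gen_grad_LA f) h)) (at 0)"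
proof -
  note X = Dom_L_facts[OF Dom_delta_subset_Dom_L[OF f]] and H = Dom_L_facts[OF h] and W = Dom_delta_W[OF f]
  have "ip W_sp (gen_grad_LA f) h = ip S_sp (grad_var S_sp mult_ln (ln_sq f) f) h + ip W_sp (grad_var W_sp mult_ln (ln_sq f) f) h"
    unfolding gen_grad_LA_def
    by (subst ip_add_left, (intro abs_grad_var_L2 grad_var_L2 W X H)+) (subst ip_S_abs, (intro grad_var_L2 W X H)+, rule refl)
  then show ?thesis
    unfolding LA_def by (simp only: plus_complex.sel) (intro DERIV_add var_derivs f h)
qed

lemma LB_deriv:
  assumes f: "f \<in> Dom_delta" and h: "h \<in> Dom_L"
  shows "((\<lambda>t. LB (\<lambda>x. f x + of_real t * h x)) has_real_derivative Re (ip W_sp (gen_grad_LB f) h)) (at 0)"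
proof -
  note X = Dom_L_facts[OF Dom_delta_subset_Dom_L[OF f]] and H = Dom_L_facts[OF h] and W = Dom_delta_W[OF f]
  define gS where "gS = grad_var S_sp iD (\<lambda>x. - D (D f) x) f"
  define gW where "gW = grad_var W_sp i\<omega>D (i\<omega>D_sq f) f"
  define N where "N = (nrm S_sp f)\<^sup>2"
  define P where "P = (nrm S_sp (mult_inv f))\<^sup>2"
  define v where "v = var W_sp i\<omega>D (unit W_sp f)"
  define ft where "ft = (\<lambda>t::real. \<lambda>x. f x + of_real t * h x)"
  have f0: "ft 0 = f" by (simp add: ft_def)
  have N: "0 < N" using X(11) by (simp add: N_def)
  have gSL: "gS \<in> L2 S_sp"
    unfolding gS_def using L2_cmult[OF Dom_delta_D(5)[OF f], of "- 1"] by (intro grad_var_L2 X) simp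
  have agS: "(\<lambda>x. of_real \<bar>x\<bar> * gS x) \<in> L2 W_sp" unfolding gS_def by (intro abs_grad_var_L2 W)
  have gWL: "gW \<in> L2 W_sp" unfolding gW_def by (intro grad_var_L2 W X)
  have d1: "((\<lambda>t. var S_sp iD (unit S_sp (ft t))) has_real_derivative Re (ip S_sp gS h)) (at 0)"
    unfolding ft_def gS_def by (rule var_derivs(3)[OF f h])
  have d2: "((\<lambda>t. var W_sp i\<omega>D (unit W_sp (ft t))) has_real_derivative Re (ip W_sp gW h)) (at 0)"
    unfolding ft_def gW_def by (rule var_derivs(4)[OF f h])
  have inv: "mult_inv (ft t) = (\<lambda>x. mult_inv f x + of_real t * mult_inv h x)" for t
    by (simp add: mult_inv_def ft_def algebra_simps)
  have d3: "((\<lambda>t. (nrm S_sp (mult_inv (ft t)))\<^sup>2) has_real_derivative 2 * Re (ip S_sp (mult_inv f) (mult_inv h))) (at 0)"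
    unfolding inv by (rule nrm_square_line_deriv[OF X(7) H(7)])
  have d4: "((\<lambda>t. (nrm S_sp (ft t))\<^sup>2) has_real_derivative 2 * Re (ip S_sp f h)) (at 0)"
    unfolding ft_def by (rule nrm_square_line_deriv[OF X(2) H(2)])
  define p where "p = ip W_sp (\<lambda>x. of_real (1 / \<bar>x\<bar>) * f x) h"
  define q where "q = ip W_sp (\<lambda>x. of_real \<bar>x\<bar> * f x) h"
  \<comment> \<open>One factor 1 / |x| is the density of \<W>, the other is the weight in
    \<open>p\<close>; together they are the square of 1 / x.\<close>
  have p: "ip S_sp (mult_inv f) (mult_inv h) = p"
  proof -
    have m: "f \<in> borel_measurable lebesgue" "h \<in> borel_measurable lebesgue"
      using X(2) H(2) by (auto dest: L2_measurable)
    have "p = (LINT x|lebesgue. of_real (1 / \<bar>x\<bar>) * (of_real (1 / \<bar>x\<bar>) * f x * cnj (h x)))"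
      unfolding p_def by (intro ip_W measurable_weight_mult m) measurable
    also have "(\<lambda>x. of_real (1 / \<bar>x\<bar>) * (of_real (1 / \<bar>x\<bar>) * f x * cnj (h x))) = (\<lambda>x. mult_inv f x * cnj (mult_inv h x))"
    proof
      fix x :: real
      have "complex_of_real (1 / \<bar>x\<bar>) * of_real (1 / \<bar>x\<bar>) = of_real (1 / x) * of_real (1 / x)"
        by (simp add: abs_mult_self_eq flip: of_real_mult)
      then have "of_real (1 / \<bar>x\<bar>) * of_real (1 / \<bar>x\<bar>) * (f x * cnj (h x)) = of_real (1 / x) * of_real (1 / x) * (f x * cnj (h x))"
        by (simp only:)
      then show "of_real (1 / \<bar>x\<bar>) * (of_real (1 / \<bar>x\<bar>) * f x * cnj (h x)) = mult_inv f x * cnj (mult_inv h x)"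
        by (simp add: mult_inv_def mult_ac)
    qed
    finally show ?thesis by (simp add: ip_def)
  qed
  have q: "ip S_sp f h = q" unfolding q_def by (rule ip_S_abs[OF X(2) H(2)])
  have D: "((\<lambda>t. var S_sp iD (unit S_sp (ft t)) + var W_sp i\<omega>D (unit W_sp (ft t)) * ((nrm S_sp (mult_inv (ft t)))\<^sup>2 / (nrm S_sp (ft t))\<^sup>2))
    has_real_derivative Re (ip S_sp gS h) + (Re (ip W_sp gW h) * (P / N) + v * ((2 * Re p * N - P * (2 * Re q)) / (N * N)))) (at 0)"
  proof (rule DERIV_cong[OF DERIV_add[OF d1 DERIV_mult[OF d2 DERIV_divide[OF d3 d4]]]])
    show "(nrm S_sp (ft 0))\<^sup>2 \<noteq> 0" using N by (simp add: f0 N_def)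
  qed (simp only: f0 p q N_def[symmetric] P_def[symmetric] v_def[symmetric] mult.commute)
  have "ip W_sp (gen_grad_LB f) h = ip S_sp gS h + of_real (P / N) * ip W_sp gW h
      + 2 * of_real v * (p / of_real N - of_real (P / N\<^sup>2) * q)"
  proof -
    have N4: "(nrm S_sp f) ^ 4 = N\<^sup>2" by (simp add: N_def)
    have "gen_grad_LB f = (\<lambda>x. of_real \<bar>x\<bar> * gS x + of_real (P / N) * gW x
        + (2 * of_real v) * ((1 / of_real N) * (of_real (1 / \<bar>x\<bar>) * f x) - of_real (P / N\<^sup>2) * (of_real \<bar>x\<bar> * f x)))"
      unfolding gen_grad_LB_def N4 by (simp add: gS_def gW_def P_def N_def v_def fun_eq_iff mult_ac)
    then have "ip W_sp (gen_grad_LB f) h = ip W_sp (\<lambda>x. of_real \<bar>x\<bar> * gS x) h + of_real (P / N) * ip W_sp gW h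
      + (2 * of_real v) * ((1 / of_real N) * p - of_real (P / N\<^sup>2) * q)"
      unfolding p_def q_def
      by (simp only: ip_cmult_left ip_add_left ip_diff_left L2_add L2_diff L2_cmult agS gWL W H(3))
    then show ?thesis using ip_S_abs[OF gSL H(2)] by simp
  qed
  then have "Re (ip W_sp (gen_grad_LB f) h) = Re (ip S_sp gS h) + (Re (ip W_sp gW h) * (P / N) + v * ((2 * Re p * N - P * (2 * Re q)) / (N * N)))"
  proof -
    assume eq: "ip W_sp (gen_grad_LB f) h = ip S_sp gS h + of_real (P / N) * ip W_sp gW h
      + 2 * of_real v * (p / of_real N - of_real (P / N\<^sup>2) * q)"
    have "2 * of_real v * (p / of_real N - of_real (P / N\<^sup>2) * q) = of_real (2 * v / N) * p - of_real (2 * v * P / N\<^sup>2) * q"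
      by (simp add: algebra_simps)
    moreover have "Re (of_real c * z) = c * Re z" for c z by simp
    ultimately have "Re (ip W_sp (gen_grad_LB f) h) = Re (ip S_sp gS h) + P / N * Re (ip W_sp gW h) + (2 * v / N * Re p - 2 * v * P / N\<^sup>2 * Re q)"
      unfolding eq by (simp only: plus_complex.sel minus_complex.sel)
    also have "\<dots> = Re (ip S_sp gS h) + (Re (ip W_sp gW h) * (P / N) + v * ((2 * Re p * N - P * (2 * Re q)) / (N * N)))"
      using N by (simp add: field_simps power2_eq_square)
    finally show ?thesis .
  qed
  then show ?thesis using D unfolding LB_def ft_def by simp
qed

lemma variations:
  assumes f: "f \<in> Dom_delta"
  shows "has_variation W_sp Dom_L LA f (gen_grad_LA f)" "has_variation W_sp Dom_L LB f (gen_grad_LB f)"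
    "has_variation W_sp Dom_L L f (\<lambda>x. gen_grad_LA f x + gen_grad_LB f x)"
proof -
  note fL = Dom_delta_subset_Dom_L[OF f] and G = gen_grad_L2[OF f]
  show "has_variation W_sp Dom_L LA f (gen_grad_LA f)" by (intro has_variationI fL G LA_deriv f)
  show "has_variation W_sp Dom_L LB f (gen_grad_LB f)" by (intro has_variationI fL G LB_deriv f)
  show "has_variation W_sp Dom_L L f (\<lambda>x. gen_grad_LA f x + gen_grad_LB f x)"
  proof (rule has_variationI[OF fL L2_add[OF G]])
    fix h assume h: "h \<in> Dom_L"
    show "((\<lambda>t. L (\<lambda>x. f x + of_real t * h x)) has_real_derivative Re (ip W_sp (\<lambda>x. gen_grad_LA f x + gen_grad_LB f x) h)) (at 0)"
      unfolding L_def ip_add_left[OF G Dom_L_facts(3)[OF h]] plus_complex.sel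
      by (intro DERIV_add LA_deriv LB_deriv f h)
  qed
qed

text \<open>Moves the expected value condition, stated for f, to the normalised function that occurs
  in the gradients.\<close>

lemma expval_unit_loc_abs_cont:
  assumes linT: "AE x in lebesgue. T (\<lambda>x. (1 / of_real (nrm M f)) * f x + 0 * f x) x = (1 / of_real (nrm M f)) * T f x + 0 * T f x"
    and M: "\<And>P. AE x in lebesgue. P x \<Longrightarrow> AE x in M. P x" "(borel_measurable M :: (real \<Rightarrow> complex) set) = borel_measurable lebesgue"
    and f: "f \<in> L2 M" "T f \<in> L2 M"
  shows "expval M T (unit M f) = expval M T f / of_real ((nrm M f)\<^sup>2)"
proof -
  have ae: "AE x in lebesgue. T (unit M f) x = T f x / of_real (nrm M f)"
    using linT by (simp add: unit_def)
  have "(\<lambda>x. T f x / of_real (nrm M f)) \<in> borel_measurable lebesgue"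
    using L2_measurable[OF L2_divide[OF f(2), of "of_real (nrm M f)"]] by (simp only: M(2))
  then have "T (unit M f) \<in> borel_measurable lebesgue"
    by (rule borel_measurable_AE) (use ae in eventually_elim, simp)
  then have "T (unit M f) \<in> borel_measurable M" by (simp only: M(2))
  from expval_unit[of T f M, OF f(2) this f(1) M(1)[OF ae]] show ?thesis by (simp add: expval_def)
qed

text \<open>The condition removes the expectation from the \<S> summand only; the one in \<W> stays
  in the formula.\<close>

lemma gen_grad_LA_eq:
  assumes f: "f \<in> Dom_delta" and e: "expval S_sp mult_ln f = 0"
  shows "gen_grad_LA f = grad_LA f"
proof -
  note X = Dom_L_facts[OF Dom_delta_subset_Dom_L[OF f]]
  have "expval S_sp mult_ln (unit S_sp f) = 0"
    using expval_unit_loc_abs_cont[where T=mult_ln and M=S_sp and f=f, OF mult_ln_linear _ refl X(2,8)] e by simp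
  then show ?thesis
    unfolding gen_grad_LA_def grad_LA_def grad_var_def ln_sq_def mult_ln_def[of f]
    by (simp add: fun_eq_iff divide_inverse power2_eq_square algebra_simps)
qed

text \<open>Again only the \<S> summand simplifies; the \<W> expectation of
  \<open>i\<omega>D\<close> survives as e in \<open>grad_LB\<close>.\<close>

lemma gen_grad_LB_eq:
  assumes f: "f \<in> Dom_delta" and e: "expval S_sp iD f = 0"
  shows "gen_grad_LB f = grad_LB f"
proof -
  note X = Dom_L_facts[OF Dom_delta_subset_Dom_L[OF f]]
  have "expval S_sp iD (unit S_sp f) = 0"
    using expval_unit_loc_abs_cont[where T=iD and M=S_sp and f=f, OF iD_linear[OF X(1,1)] _ refl X(2,5)] e by simp
  then show ?thesis
    unfolding gen_grad_LB_def grad_LB_def grad_var_def i\<omega>D_sq_def Let_def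
    by (simp add: fun_eq_iff divide_inverse algebra_simps)
qed

text \<open>On the negative half line both sides are 0, and elsewhere |x| is x.\<close>

lemma grad_LA_pos_eq:
  assumes "\<forall>\<omega><0. f \<omega> = 0"
  shows "grad_LA_pos f = grad_LA f"
proof
  fix x show "grad_LA_pos f x = grad_LA f x"
    using assms by (cases "x < 0") (simp_all add: grad_LA_pos_def grad_LA_def)
qed

lemma D_eq_0_neg:
  assumes "\<forall>\<omega><0. f \<omega> = 0" "x < 0"
  shows "D f x = 0"
proof (rule D_eq)
  have "((\<lambda>_. 0) has_vector_derivative 0) (at x)" by simp
  then show "(f has_vector_derivative 0) (at x)"
    by (rule has_vector_derivative_transform_within_open[of _ _ _ "{..<0}"]) (use assms in auto)
qed

text \<open>When f vanishes for negative \<omega>, sgn acts as 1, so the unnormalised expectation of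
  \<open>i\<omega>D\<close> in \<W> equals that of \<open>iD\<close> in \<S>, which is 0 by
  assumption. The derivatives of f vanish on the open negative half line as well.\<close>

lemma grad_LB_pos_eq:
  assumes f: "f \<in> Dom_delta" and e: "expval S_sp iD f = 0" and neg: "\<forall>\<omega><0. f \<omega> = 0"
  shows "grad_LB_pos f = grad_LB f"
proof -
  note X = Dom_L_facts[OF Dom_delta_subset_Dom_L[OF f]]
  have D1: "D f x = 0" if "x < 0" for x by (rule D_eq_0_neg[OF neg that])
  have D2: "D (D f) x = 0" if "x < 0" for x using D_eq_0_neg[OF _ that, of "D f"] D1 by blast
  have "ip W_sp (i\<omega>D f) f = \<i> * (LINT x|lebesgue. of_real (sgn x) * (D f x * cnj (f x)))"
    using X by (intro ip_W_i\<omega>D) auto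
  also have "(\<lambda>x. of_real (sgn x) * (D f x * cnj (f x))) = (\<lambda>x. D f x * cnj (f x))"
  proof
    \<comment> \<open>At 0 sgn is 0 rather than 1, but f is 0 there too.\<close>
    fix x :: real show "of_real (sgn x) * (D f x * cnj (f x)) = D f x * cnj (f x)"
      using neg X(10) by (cases "x < 0"; cases "x = 0") auto
  qed
  also have "\<i> * (LINT x|lebesgue. D f x * cnj (f x)) = expval S_sp iD f"
    by (simp add: expval_def ip_def iD_def mult.assoc)
  finally have "expval W_sp i\<omega>D f = 0" using e by (simp add: expval_def)
  then have e0: "expval W_sp i\<omega>D (unit W_sp f) = 0"
    using expval_unit_loc_abs_cont[where T=i\<omega>D and M=W_sp and f=f, OF i\<omega>D_linear[OF X(1,1)] AE_W_sp borel_measurable_W_sp X(3,6)] by simp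
  show ?thesis
  proof
    fix x show "grad_LB_pos f x = grad_LB f x"
    proof (cases "x < 0")
      case True
      then show ?thesis using neg D1 D2 by (simp add: grad_LB_pos_def grad_LB_def Let_def e0)
    next
      case False
      then show ?thesis by (simp add: grad_LB_pos_def grad_LB_def Let_def e0)
    qed
  qed
qed

text \<open>The density ties \<S> to \<W> by |\<omega>|, and a zero expectation of \<open>iD\<close>
  in \<S> need not make that of \<open>i\<omega>D\<close> in \<W> vanish; hence the two-sided
  gradients. The formulas with \<omega> follow from them when f vanishes on the negative
  frequencies. Bare existence rests on the gradients that retain all expectations.\<close>

theorem theorem32:
  shows "(\<forall>f\<in>Dom_delta. \<exists>g. has_variation W_sp Dom_L L f g)
    \<and> (\<forall>f\<in>Dom_delta. expval S_sp iD f = 0 \<longrightarrow> expval S_sp mult_ln f = 0 \<longrightarrow>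
          has_variation W_sp Dom_L LA f (grad_LA f)
        \<and> has_variation W_sp Dom_L LB f (grad_LB f)
        \<and> has_variation W_sp Dom_L L f (\<lambda>\<omega>. grad_LA f \<omega> + grad_LB f \<omega>))
    \<and> (\<forall>f\<in>Dom_delta. expval S_sp iD f = 0 \<longrightarrow> expval S_sp mult_ln f = 0 \<longrightarrow> (\<forall>\<omega><0. f \<omega> = 0) \<longrightarrow>
          has_variation W_sp Dom_L LA f (grad_LA_pos f)
        \<and> has_variation W_sp Dom_L LB f (grad_LB_pos f)
        \<and> has_variation W_sp Dom_L L f (\<lambda>\<omega>. grad_LA_pos f \<omega> + grad_LB_pos f \<omega>))"
proof -
  have gen: "has_variation W_sp Dom_L LA f (grad_LA f) \<and> has_variation W_sp Dom_L LB f (grad_LB f)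
      \<and> has_variation W_sp Dom_L L f (\<lambda>\<omega>. grad_LA f \<omega> + grad_LB f \<omega>)"
    if "f \<in> Dom_delta" "expval S_sp iD f = 0" "expval S_sp mult_ln f = 0" for f
    using variations[OF that(1)] gen_grad_LA_eq[OF that(1,3)] gen_grad_LB_eq[OF that(1,2)] by simp
  have pos: "has_variation W_sp Dom_L LA f (grad_LA_pos f) \<and> has_variation W_sp Dom_L LB f (grad_LB_pos f)
      \<and> has_variation W_sp Dom_L L f (\<lambda>\<omega>. grad_LA_pos f \<omega> + grad_LB_pos f \<omega>)"
    if "f \<in> Dom_delta" "expval S_sp iD f = 0" "expval S_sp mult_ln f = 0" "\<forall>\<omega><0. f \<omega> = 0" for f
    using gen[OF that(1-3)] grad_LA_pos_eq[OF that(4)] grad_LB_pos_eq[OF that(1,2,4)] by simp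
  show ?thesis using variations(3) gen pos by blast
qed

end
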